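(* There exists an absolute constant $c>0$ such that the following holds for every positive integer $n$ and every $q\in[0,n-1)$ which is not an odd integer. There exist an infinitely smooth, origin-symmetric convex body $D\subseteq\mathbb R^n$ with $|D|_n=1$ and an even continuous non-negative function $g:\mathbb R^n\to\mathbb R$ with $\int_D g=1$ such that $$\max_{\xi\in S^{n-1}}\ \frac{1}{\cos(\pi q/2)}\,\mathcal R g(\xi,\cdot)_t^{(q)}(0)\ \le\ \frac{1}{\sqrt n}\,\bigl(c(q+1)\bigr)^{\frac{q+1}{2}}.$$
   Context: $|\cdot|_n$ denotes volume (Lebesgue measure) in $\mathbb R^n$, and $|x|_2$ the Euclidean norm. A star body is a set $K=\{0\}\cup\{x\in\mathbb R^n\setminus\{0\}: |x|_2\le\rho_K(x/|x|_2)\}$, where $\rho_K:S^{n-1}\to(0,\infty)$ is continuous and bounded. A convex body is a convex star body. It is called infinitely smooth if $\rho_K$ is an infinitely smooth function on the sphere. Radon transform: for $f:\mathbb R^n\to\mathbb R$ continuous, $\xi\in S^{n-1}$, $t\in\mathbb R$, $\mathcal R f(\xi,t)=\int_{\xi^\perp+t\xi} f$ (integral with respect to $(n-1)$-dimensional Lebesgue measure on the hyperplane), where $\xi^\perp=\{x:(x,\xi)=0\}$. Fractional derivative: for a function $\varphi:[0,\infty)\to\mathbb R$, the fractional derivative of order $q$ at $0$ is the analytic continuation in $q\in\mathbb C$ of $\varphi^{(q)}(0)=\frac{1}{\Gamma(-q)}\int_0^\infty t^{-1-q}\varphi(t)\,dt$. If $\varphi$ is $m$-times continuously differentiable and integrable,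 this continuation exists for $-1<\Re(q)<m$ and is given by $$\varphi^{(q)}(0)=\frac{1}{\Gamma(-q)}\int_0^1 t^{-1-q}\Bigl(\varphi(t)-\sum_{k=0}^{m-1}\varphi^{(k)}(0)\frac{t^k}{k!}\Bigr)dt+\frac{1}{\Gamma(-q)}\int_1^\infty t^{-1-q}\varphi(t)\,dt+\frac{1}{\Gamma(-q)}\sum_{k=0}^{m-1}\frac{\varphi^{(k)}(0)}{k!\,(k-q)},$$ where the $\varphi^{(k)}(0)$ inside the sums are ordinary derivatives. The value at non-negative integers $q=k<m$ is taken by continuity and equals $(-1)^k$ times the ordinary $k$-th derivative at $0$. The value does not depend on the choice of $m$. $\mathcal R g(\xi,\cdot)_t^{(q)}(0)$ denotes the fractional derivative of order $q$ at $t=0$ of the function $t\mapsto\mathcal R g(\xi,t)$ (restricted to $t\ge 0$). It is part of the assertion that this quantity is well defined for the function $g$ and every $\xi\in S^{n-1}$. *)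

theory Defs
  imports "HOL-Complex_Analysis.Complex_Analysis"
begin

text \<open>
  The dimension is quantified inside the theorem (after an absolute constant), so it cannot be a
  type: points of \<open>\<real>\<^sup>n\<close> are the extensional functions \<open>{..<n} \<rightarrow>\<^sub>E UNIV\<close>, which is the
  carrier of both the product topology and the product measure of the library.
\<close>

definition Rn_top :: "nat \<Rightarrow> (nat \<Rightarrow> real) topology" where
  "Rn_top n = product_topology (\<lambda>_. euclideanreal) {..<n}"

definition Rn :: "nat \<Rightarrow> (nat \<Rightarrow> real) set" where
  "Rn n = {..<n} \<rightarrow>\<^sub>E UNIV"

definition Rn_lebesgue :: "nat \<Rightarrow> (nat \<Rightarrow> real) measure" where
  "Rn_lebesgue n = Pi\<^sub>M {..<n} (\<lambda>_. lborel)"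

lemma topspace_Rn_top [simp]: "topspace (Rn_top n) = Rn n"
  by (simp add: Rn_top_def Rn_def)

lemma space_Rn_lebesgue [simp]: "space (Rn_lebesgue n) = Rn n"
  by (simp add: Rn_lebesgue_def Rn_def space_PiM)

definition Rn_zero :: "nat \<Rightarrow> nat \<Rightarrow> real" where
  "Rn_zero n = (\<lambda>i\<in>{..<n}. 0)"

definition Rn_scale :: "nat \<Rightarrow> real \<Rightarrow> (nat \<Rightarrow> real) \<Rightarrow> nat \<Rightarrow> real" where
  "Rn_scale n a x = (\<lambda>i\<in>{..<n}. a * x i)"

definition Rn_add :: "nat \<Rightarrow> (nat \<Rightarrow> real) \<Rightarrow> (nat \<Rightarrow> real) \<Rightarrow> nat \<Rightarrow> real" where
  "Rn_add n x y = (\<lambda>i\<in>{..<n}. x i + y i)"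

definition Rn_inner :: "nat \<Rightarrow> (nat \<Rightarrow> real) \<Rightarrow> (nat \<Rightarrow> real) \<Rightarrow> real" where
  "Rn_inner n x y = (\<Sum>i<n. x i * y i)"

definition Rn_norm :: "nat \<Rightarrow> (nat \<Rightarrow> real) \<Rightarrow> real" where
  "Rn_norm n x = L2_set x {..<n}"

definition Rn_sphere :: "nat \<Rightarrow> (nat \<Rightarrow> real) set" where
  "Rn_sphere n = {x \<in> Rn n. Rn_norm n x = 1}"

definition Rn_convex :: "nat \<Rightarrow> (nat \<Rightarrow> real) set \<Rightarrow> bool" where
  "Rn_convex n K \<longleftrightarrow>
    (\<forall>x\<in>K. \<forall>y\<in>K. \<forall>u\<in>{0..1}. Rn_add n (Rn_scale n (1 - u) x) (Rn_scale n u y) \<in> K)"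

definition Rn_symmetric :: "nat \<Rightarrow> (nat \<Rightarrow> real) set \<Rightarrow> bool" where
  "Rn_symmetric n K \<longleftrightarrow> Rn_scale n (-1) ` K = K"

text \<open>\<open>C\<^sup>k\<close> functions on an open set \<open>U\<close>; \<open>f' i\<close> is the partial derivative in direction \<open>i\<close>.\<close>

primrec Ck_on :: "nat \<Rightarrow> nat \<Rightarrow> (nat \<Rightarrow> real) set \<Rightarrow> ((nat \<Rightarrow> real) \<Rightarrow> real) \<Rightarrow> bool" where
  "Ck_on n 0 U f \<longleftrightarrow> continuous_map (subtopology (Rn_top n) U) euclideanreal f"
| "Ck_on n (Suc k) U f \<longleftrightarrow>
     continuous_map (subtopology (Rn_top n) U) euclideanreal f \<and>
     (\<exists>f'. \<forall>i<n. (\<forall>x\<in>U. ((\<lambda>s. f (x(i := s))) has_real_derivative f' i x) (at (x i))) \<and>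
                 Ck_on n k U (f' i))"

text \<open>Smoothness on the sphere as an embedded submanifold: a smooth extension to an open
  neighbourhood exists.\<close>

definition smooth_on_sphere :: "nat \<Rightarrow> ((nat \<Rightarrow> real) \<Rightarrow> real) \<Rightarrow> bool" where
  "smooth_on_sphere n \<rho> \<longleftrightarrow>
    (\<exists>U F. openin (Rn_top n) U \<and> Rn_sphere n \<subseteq> U \<and> (\<forall>k. Ck_on n k U F) \<and>
           (\<forall>\<theta>\<in>Rn_sphere n. F \<theta> = \<rho> \<theta>))"

text \<open>\<open>\<rho>\<close> is the radial function of the star body \<open>K\<close>. Since \<open>K\<close> determines \<open>\<rho>\<close> on the sphere,
  the existential quantifiers below speak about the unique radial function of \<open>K\<close>.\<close>

definition radial_function :: "nat \<Rightarrow> (nat \<Rightarrow> real) set \<Rightarrow> ((nat \<Rightarrow> real) \<Rightarrow> real) \<Rightarrow> bool" where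
  "radial_function n K \<rho> \<longleftrightarrow>
    continuous_map (subtopology (Rn_top n) (Rn_sphere n)) euclideanreal \<rho> \<and>
    (\<forall>\<theta>\<in>Rn_sphere n. 0 < \<rho> \<theta>) \<and>
    bounded (\<rho> ` Rn_sphere n) \<and>
    K = {Rn_zero n} \<union>
        {x \<in> Rn n - {Rn_zero n}. Rn_norm n x \<le> \<rho> (Rn_scale n (1 / Rn_norm n x) x)}"

definition star_body :: "nat \<Rightarrow> (nat \<Rightarrow> real) set \<Rightarrow> bool" where
  "star_body n K \<longleftrightarrow> (\<exists>\<rho>. radial_function n K \<rho>)"

definition convex_body :: "nat \<Rightarrow> (nat \<Rightarrow> real) set \<Rightarrow> bool" where
  "convex_body n K \<longleftrightarrow> star_body n K \<and> Rn_convex n K"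

definition infinitely_smooth :: "nat \<Rightarrow> (nat \<Rightarrow> real) set \<Rightarrow> bool" where
  "infinitely_smooth n K \<longleftrightarrow> (\<exists>\<rho>. radial_function n K \<rho> \<and> smooth_on_sphere n \<rho>)"

text \<open>Lebesgue measure of dimension \<open>n - 1\<close> on the hyperplane \<open>\<xi>\<^sup>\<bottom> + t\<xi>\<close> (for a unit vector
  \<open>\<xi>\<close>, \<open>n \<ge> 1\<close>) is transported by the isometry that an orthonormal basis \<open>e\<close> of \<open>\<xi>\<^sup>\<bottom>\<close>
  induces; by rotation invariance it does not depend on the basis chosen.\<close>

definition orthonormal_basis_perp :: "nat \<Rightarrow> (nat \<Rightarrow> real) \<Rightarrow> (nat \<Rightarrow> nat \<Rightarrow> real) \<Rightarrow> bool" where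
  "orthonormal_basis_perp n \<xi> e \<longleftrightarrow>
    (\<forall>j<n-1. e j \<in> Rn n \<and> Rn_inner n (e j) \<xi> = 0) \<and>
    (\<forall>j<n-1. \<forall>k<n-1. Rn_inner n (e j) (e k) = (if j = k then 1 else 0))"

definition hyperplane_lebesgue :: "nat \<Rightarrow> (nat \<Rightarrow> real) \<Rightarrow> real \<Rightarrow> (nat \<Rightarrow> real) measure" where
  "hyperplane_lebesgue n \<xi> t =
    (let e = (SOME e. orthonormal_basis_perp n \<xi> e)
     in distr (Rn_lebesgue (n - 1)) (Rn_lebesgue n)
          (\<lambda>y. \<lambda>i\<in>{..<n}. (\<Sum>j<n-1. y j * e j i) + t * \<xi> i))"

definition radon :: "nat \<Rightarrow> ((nat \<Rightarrow> real) \<Rightarrow> real) \<Rightarrow> (nat \<Rightarrow> real) \<Rightarrow> real \<Rightarrow> real" where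
  "radon n f \<xi> t = (LINT x | hyperplane_lebesgue n \<xi> t. f x)"

text \<open>The fractional derivative of order \<open>q\<close> of \<open>\<phi>\<close> (on \<open>[0,\<infinity>)\<close>) at \<open>0\<close> exists and equals \<open>v\<close>:
  the function \<open>z \<mapsto> 1/\<Gamma>(-z) \<integral>\<^sub>0\<^sup>\<infinity> t\<^sup>-\<^sup>1\<^sup>-\<^sup>z \<phi>(t) dt\<close>, given by an absolutely convergent integral for
  \<open>-1 < Re z < 0\<close>, has an analytic continuation to a strip containing \<open>q\<close>, with value \<open>v\<close> at \<open>q\<close>.
  The values at non-negative integers are those of the continuation.\<close>

definition has_frac_deriv_0 :: "(real \<Rightarrow> real) \<Rightarrow> real \<Rightarrow> real \<Rightarrow> bool" where
  "has_frac_deriv_0 \<phi> q v \<longleftrightarrow> -1 < q \<and>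
    (\<exists>F a. q < a \<and> F holomorphic_on {z. -1 < Re z \<and> Re z < a} \<and>
      (\<forall>z. -1 < Re z \<and> Re z < 0 \<longrightarrow>
         set_integrable lborel {0<..} (\<lambda>t. of_real t powr (-1 - z) * of_real (\<phi> t)) \<and>
         F z = 1 / Gamma (-z) *
           (LINT t:{0<..}|lborel. of_real t powr (-1 - z) * of_real (\<phi> t))) \<and>
      F (of_real q) = of_real v)"

lemma has_frac_deriv_0_unique:
  assumes "has_frac_deriv_0 \<phi> q v" "has_frac_deriv_0 \<phi> q w"
  shows "v = w"
proof -
  let ?I = "\<lambda>z. 1 / Gamma (-z) * (LINT t:{0<..}|lborel. of_real t powr (-1 - z) * of_real (\<phi> t))"
  obtain F a where F: "q < a" "F holomorphic_on {z. -1 < Re z \<and> Re z < a}"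
      "\<And>z. -1 < Re z \<Longrightarrow> Re z < 0 \<Longrightarrow> F z = ?I z" "F (of_real q) = of_real v" "-1 < q"
    using assms(1) unfolding has_frac_deriv_0_def by blast
  obtain G b where G: "q < b" "G holomorphic_on {z. -1 < Re z \<and> Re z < b}"
      "\<And>z. -1 < Re z \<Longrightarrow> Re z < 0 \<Longrightarrow> G z = ?I z" "G (of_real q) = of_real w"
    using assms(2) unfolding has_frac_deriv_0_def by blast
  define c where "c = min a b"
  define S where "S = (\<lambda>r. {z. -1 < Re z} \<inter> {z. Re z < r})"
  have op: "open (S r)" for r
    unfolding S_def by (intro open_Int open_halfspace_Re_gt open_halfspace_Re_lt)
  have conv: "convex (S r)" for r
    unfolding S_def by (intro convex_Int convex_halfspace_Re_gt convex_halfspace_Re_lt)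
  have q: "q < c" "-1 < c" using F G by (auto simp: c_def)
  have "F (of_real q) = G (of_real q)"
  proof (rule analytic_continuation_open[of "S (min 0 c)" "S c" F G])
    show "S (min 0 c) \<noteq> {}"
    proof -
      obtain r where "-1 < r" "r < min 0 c" using dense[of "-1" "min 0 c"] q by auto
      then have "complex_of_real r \<in> S (min 0 c)" by (simp add: S_def)
      then show ?thesis by blast
    qed
    show "F holomorphic_on S c"
      by (rule holomorphic_on_subset[OF F(2)]) (auto simp: S_def c_def)
    show "G holomorphic_on S c"
      by (rule holomorphic_on_subset[OF G(2)]) (auto simp: S_def c_def)
    show "F z = G z" if "z \<in> S (min 0 c)" for z
      using that F(3) G(3) by (simp add: S_def)
    show "connected (S c)"
      by (rule convex_connected[OF conv])
  qed ((rule op)+, use q F(5) in \<open>auto simp: S_def\<close>)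
  then show ?thesis using F(4) G(4) by simp
qed

end

theory Submission
  imports Defs "HOL-Probability.Probability" "Jordan_Normal_Form.Determinant"
begin

text \<open>
  \<^bold>\<open>Fourier side.\<close> For an even density \<open>g\<close> the fractional derivative of order \<open>q\<close> at \<open>0\<close> of
  \<open>t \<mapsto> \<R>g(\<xi>,t)\<close>, divided by \<open>cos (\<pi>q/2)\<close>, equals \<open>(1/\<pi>) \<integral>\<^sub>0\<^sup>\<infinity> r\<^sup>q \<phi>(r\<xi>) dr\<close>, where \<open>\<phi>\<close> is the Fourier
  transform of \<open>g\<close> (lemma \<open>has_frac_deriv_0_normal_sym\<close>, for Gaussians). Take \<open>g\<close> proportional to
  the density of \<open>X + \<sigma>G\<close>, where \<open>G\<close> is standard Gaussian, \<open>\<sigma>\<close> is a constant and \<open>X\<close> is symmetric and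
  takes finitely many values. Then \<open>\<phi>(r\<xi>) = exp (- \<sigma>\<^sup>2r\<^sup>2/2) \<psi>(r)\<close> with \<open>\<psi>(r) = E cos (r\<langle>X,\<xi>\<rangle>)\<close>. The Gaussian
  factor absorbs \<open>r\<^sup>q\<close> at the cost of \<open>(C(q+1))\<^sup>q\<^sup>/\<^sup>2\<close>, and it remains to gain \<open>1 / sqrt n\<close>. For this it is
  enough that \<open>\<bar>\<psi>(r)\<bar> \<le> min 1 (C / (n r\<^sup>2))\<close> for \<open>r \<le> sqrt n\<close> in every direction \<open>\<xi>\<close> (lemma
  \<open>gaussian_moment_bound\<close>). Roughly, \<open>X\<close> should have length of order \<open>n\<close>, and none of its marginals
  should be concentrated on a scale below \<open>sqrt n\<close>.

  \<^bold>\<open>The random vector.\<close> There are sign vectors \<open>Y\<^sub>1, \<dots>, Y\<^sub>N\<close> with \<open>N = B n\<close> for a constant \<open>B\<close>, such that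
  for every vector \<open>\<eta>\<close> with \<open>1/2 \<le> \<bar>\<eta>\<bar> \<le> 1\<close> the average of \<open>cos \<langle>Y\<^sub>i,\<eta>\<rangle>\<close> is at most \<open>1 - \<delta>\<close>
  (lemma \<open>exists_sign_matrix\<close>). A uniformly chosen point of \<open>{\<plusminus>Y\<^sub>i}\<close> therefore has a characteristic
  function of absolute value at most some \<open>\<kappa> < 1\<close> at frequencies of one order of magnitude. All larger
  frequencies are handled by the same points at smaller scales: \<open>X\<close> is the sum over \<open>k\<close> of \<open>A k\<close>
  independent copies scaled by \<open>\<alpha> / 2\<^sup>k\<close>, with \<open>\<alpha>\<close> of order \<open>sqrt n\<close>. At the \<open>k\<close>-th frequency scale the
  characteristic function is at most \<open>\<kappa>\<close> to the power \<open>A k\<close>, hence at most \<open>4\<close> to the power \<open>- k\<close>; and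
  since the series of \<open>k / 2\<^sup>k\<close> converges, \<open>X\<close> stays in a constant multiple of the convex hull of the points
  \<open>\<plusminus> sqrt n Y\<^sub>i\<close> (lemma \<open>exists_points_decay\<close>).

  \<^bold>\<open>The body.\<close> That hull, enlarged by a ball of radius \<open>sqrt n\<close>, has volume at most \<open>C\<^sup>n\<close>. Although the
  vertices have length \<open>n\<close>, there are only \<open>O(n)\<close> of them, and by Maurey's argument every point is within
  \<open>O(sqrt n)\<close> of an average of \<open>n\<close> vertices, of which there are only exponentially many. To obtain a
  smooth body, the hull is replaced by an intersection of finitely many slabs, and the greedy
  version of the argument applies directly to that intersection (lemmas \<open>greedy_approximation\<close> and
  \<open>slab_body_emeasure_le\<close>); a sum of high even powers of the linear forms then rounds the corners
  (lemma \<open>exists_smooth_body\<close>). After scaling to volume \<open>1\<close> by a factor bounded below, and with \<open>X\<close>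
  and \<open>\<sigma>\<close> multiplied by a suitable constant, the body contains at least half of the mass of \<open>X + \<sigma>G\<close>.
\<close>

section \<open>Sign vectors without concentrated marginals\<close>

text \<open>
  Round each \<open>f j\<close> to \<open>1\<close> with probability \<open>f j\<close> and to \<open>0\<close> otherwise, independently: the errors
  have mean zero, so the expected squared length of the error vector is the sum of the variances
  \<open>f j * (1 - f j)\<close> times squared lengths. Choosing the roundings one after another and never
  exceeding the average derandomises this.
\<close>

lemma exists_rounding:
  fixes f :: "'a \<Rightarrow> real" and v :: "'a \<Rightarrow> 'b \<Rightarrow> real"
  assumes "finite J" "\<And>j. j \<in> J \<Longrightarrow> 0 \<le> f j \<and> f j \<le> 1"
  shows "\<exists>b :: 'a \<Rightarrow> int. (\<forall>j\<in>J. b j \<in> {0, 1}) \<and>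
    (\<Sum>i\<in>I. (\<Sum>j\<in>J. (of_int (b j) - f j) * v j i)\<^sup>2) \<le> (\<Sum>j\<in>J. \<Sum>i\<in>I. (v j i)\<^sup>2) / 4"
  using assms
proof (induction J rule: finite_induct)
  case empty
  then show ?case by auto
next
  case (insert j J)
  obtain b where b: "\<forall>j\<in>J. b j \<in> {0, 1::int}"
    "(\<Sum>i\<in>I. (\<Sum>j\<in>J. (of_int (b j) - f j) * v j i)\<^sup>2) \<le> (\<Sum>j\<in>J. \<Sum>i\<in>I. (v j i)\<^sup>2) / 4"
    using insert by auto
  define s where "s i = (\<Sum>j\<in>J. (of_int (b j) - f j) * v j i)" for i
  define E where "E c = (\<Sum>i\<in>I. (s i + (of_int c - f j) * v j i)\<^sup>2)" for c :: int
  have E: "E c = (\<Sum>i\<in>I. (s i)\<^sup>2) + 2 * (of_int c - f j) * (\<Sum>i\<in>I. s i * v j i)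
      + (of_int c - f j)\<^sup>2 * (\<Sum>i\<in>I. (v j i)\<^sup>2)" for c
    unfolding E_def sum_distrib_left sum.distrib[symmetric]
    by (rule sum.cong) (simp_all add: power2_eq_square algebra_simps)
  \<comment> \<open>Averaged over a Bernoulli variable with mean \<open>f j\<close>, the cross term vanishes.\<close>
  have av: "f j * E 1 + (1 - f j) * E 0 = (\<Sum>i\<in>I. (s i)\<^sup>2) + f j * (1 - f j) * (\<Sum>i\<in>I. (v j i)\<^sup>2)"
    unfolding E by (simp add: power2_eq_square algebra_simps)
  have "f j * (1 - f j) \<le> 1 / 4"
    using zero_le_power2[of "f j - 1/2"] by (simp add: power2_eq_square algebra_simps)
  then have "f j * (1 - f j) * (\<Sum>i\<in>I. (v j i)\<^sup>2) \<le> 1/4 * (\<Sum>i\<in>I. (v j i)\<^sup>2)"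
    by (intro mult_right_mono) (auto intro: sum_nonneg)
  then have av': "f j * E 1 + (1 - f j) * E 0 \<le> (\<Sum>i\<in>I. (s i)\<^sup>2) + (\<Sum>i\<in>I. (v j i)\<^sup>2) / 4" (is "_ \<le> ?R")
    using av by simp
  have "\<exists>c\<in>{0,1}. E c \<le> ?R"
  proof (rule ccontr)
    assume "\<not> ?thesis"
    then have "?R \<le> E 1" "?R \<le> E 0" "?R < E 1" "?R < E 0" by auto
    moreover have "0 \<le> f j" "f j \<le> 1" using insert by auto
    ultimately have "?R < f j * E 1 + (1 - f j) * E 0"
      using convex_bound_lt[of "- E 1" "- ?R" "- E 0" "f j" "1 - f j"] by (simp add: algebra_simps)
    then show False using av' by simp
  qed
  then obtain c where c: "c \<in> {0,1}" "E c \<le> ?R" by blast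
  have eq: "(\<Sum>k\<in>insert j J. (of_int ((b(j := c)) k) - f k) * v k i) = s i + (of_int c - f j) * v j i" for i
  proof -
    have "(\<Sum>k\<in>J. (of_int ((b(j := c)) k) - f k) * v k i) = s i"
      unfolding s_def using insert by (intro sum.cong) auto
    then show ?thesis using insert by simp
  qed
  show ?case
  proof (intro exI conjI)
    show "\<forall>k\<in>insert j J. (b(j := c)) k \<in> {0, 1}" using b c by auto
    show "(\<Sum>i\<in>I. (\<Sum>k\<in>insert j J. (of_int ((b(j := c)) k) - f k) * v k i)\<^sup>2)
      \<le> (\<Sum>j\<in>insert j J. \<Sum>i\<in>I. (v j i)\<^sup>2) / 4"
      unfolding eq using c(2) b(2) insert(1,2) by (simp add: E_def s_def)
  qed
qed

text \<open>
  Weighting a vector \<open>m\<close> by \<open>2\<close> to the power \<open>- (\<Sum>i\<in>I. \<bar>m i\<bar>)\<close> makes the count a product of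
  one-dimensional geometric series, each of which is at most \<open>3\<close>. The point is that the bound is
  exponential in the dimension, with no logarithm.
\<close>

lemma card_int_vectors_l1_bounded:
  fixes I :: "'a set" and M :: nat
  assumes "finite I"
  defines "S \<equiv> {m \<in> I \<rightarrow>\<^sub>E (UNIV :: int set). (\<Sum>i\<in>I. \<bar>m i\<bar>) \<le> int M}"
  shows "finite S" "card S \<le> 2 ^ M * 3 ^ card I"
proof -
  have le: "\<bar>m i\<bar> \<le> int M" if "m \<in> S" "i \<in> I" for m i
    using that member_le_sum[of i I "\<lambda>i. \<bar>m i\<bar>"] assms(1) unfolding S_def by auto
  have sub: "S \<subseteq> I \<rightarrow>\<^sub>E {- int M..int M}"
  proof
    fix m assume m: "m \<in> S"
    then have "m \<in> I \<rightarrow>\<^sub>E UNIV" unfolding S_def by blast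
    then show "m \<in> I \<rightarrow>\<^sub>E {- int M..int M}"
      using le[OF m] by (force simp: PiE_iff abs_le_iff)
  qed
  show fin: "finite S" by (rule finite_subset[OF sub]) (simp add: finite_PiE assms(1))
  have one: "(\<Sum>k\<in>{- int M..int M}. (1/2::real) ^ nat \<bar>k\<bar>) = 3 - 2 * (1/2) ^ M"
  proof (induction M)
    case (Suc M)
    have "{- int (Suc M)..int (Suc M)} = insert (- int (Suc M)) (insert (int (Suc M)) {- int M..int M})"
      by auto
    moreover have "nat (int M + 1) = Suc M" "nat (1 + int M) = Suc M" by auto
    ultimately show ?case using Suc by simp
  qed simp
  have "real (card S) * (1/2) ^ M = (\<Sum>m\<in>S. (1/2::real) ^ M)" by simp
  also have "\<dots> \<le> (\<Sum>m\<in>S. \<Prod>i\<in>I. (1/2) ^ nat \<bar>m i\<bar>)"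
  proof (rule sum_mono)
    fix m assume "m \<in> S"
    then have "int (\<Sum>i\<in>I. nat \<bar>m i\<bar>) \<le> int M"
      by (simp add: S_def)
    then have "(\<Sum>i\<in>I. nat \<bar>m i\<bar>) \<le> M" by linarith
    then have "(1/2::real) ^ M \<le> (1/2) ^ (\<Sum>i\<in>I. nat \<bar>m i\<bar>)" by (intro power_decreasing) auto
    then show "(1/2::real) ^ M \<le> (\<Prod>i\<in>I. (1/2) ^ nat \<bar>m i\<bar>)" by (simp add: power_sum)
  qed
  also have "\<dots> \<le> (\<Sum>m\<in>I \<rightarrow>\<^sub>E {- int M..int M}. \<Prod>i\<in>I. (1/2) ^ nat \<bar>m i\<bar>)"
    by (rule sum_mono2) (use sub assms(1) in \<open>auto intro!: finite_PiE prod_nonneg\<close>)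
  also have "\<dots> = (\<Prod>i\<in>I. \<Sum>k\<in>{- int M..int M}. (1/2) ^ nat \<bar>k\<bar>)"
    using assms(1) by (subst prod_sum_PiE) auto
  also have "\<dots> \<le> (\<Prod>i\<in>I. 3)"
  proof -
    have "(1/2::real) ^ M \<le> 1" by (simp add: power_le_one)
    then show ?thesis unfolding one by (intro prod_mono) auto
  qed
  also have "\<dots> = 3 ^ card I" by simp
  finally have "real (card S) * (1/2) ^ M * 2 ^ M \<le> 3 ^ card I * 2 ^ M" by (rule mult_right_mono) simp
  moreover have "real (card S) * (1/2) ^ M * 2 ^ M = real (card S)"
    by (simp only: mult.assoc power_mult_distrib[symmetric]) simp
  ultimately have "real (card S) \<le> 3 ^ card I * 2 ^ M" by (simp only:)
  then have "real (card S) \<le> real (2 ^ M * 3 ^ card I)"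
    by (simp only: of_nat_mult of_nat_power of_nat_numeral mult.commute)
  then show "card S \<le> 2 ^ M * 3 ^ card I" by (simp only: of_nat_le_iff)
qed

text \<open>
  The characteristic function of a sum of independent signs is a product of cosines.
\<close>

lemma sum_sign_vectors_cos:
  fixes \<eta> :: "'a \<Rightarrow> real"
  assumes "finite J"
  shows "(\<Sum>y\<in>J \<rightarrow>\<^sub>E {-1, 1}. cos (\<Sum>j\<in>J. y j * \<eta> j)) = 2 ^ card J * (\<Prod>j\<in>J. cos (\<eta> j))"
proof -
  have cis2: "(\<Sum>s\<in>{-1, 1::real}. cis (s * \<eta> j)) = of_real (2 * cos (\<eta> j))" for j
    by (simp add: complex_eq_iff)
  have "(\<Sum>y\<in>J \<rightarrow>\<^sub>E {-1, 1::real}. cis (\<Sum>j\<in>J. y j * \<eta> j))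
      = (\<Sum>y\<in>J \<rightarrow>\<^sub>E {-1, 1::real}. \<Prod>j\<in>J. cis (y j * \<eta> j))"
  proof (intro sum.cong refl)
    show "cis (\<Sum>j\<in>J. y j * \<eta> j) = (\<Prod>j\<in>J. cis (y j * \<eta> j))" for y
      using assms by (induction J rule: finite_induct) (auto simp: cis_mult[symmetric])
  qed
  also have "\<dots> = (\<Prod>j\<in>J. \<Sum>s\<in>{-1, 1::real}. cis (s * \<eta> j))"
    using assms by (subst prod_sum_PiE) auto
  also have "\<dots> = of_real (\<Prod>j\<in>J. 2 * cos (\<eta> j))" unfolding cis2 by simp
  finally have "Re (\<Sum>y\<in>J \<rightarrow>\<^sub>E {-1, 1::real}. cis (\<Sum>j\<in>J. y j * \<eta> j)) = (\<Prod>j\<in>J. 2 * cos (\<eta> j))"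
    by (metis Re_complex_of_real)
  then show ?thesis by (simp add: prod.distrib)
qed

lemma cos_le_exp_quadratic:
  fixes x :: real
  assumes "\<bar>x\<bar> \<le> 2"
  shows "cos x \<le> exp (- x\<^sup>2 / 3)"
proof -
  obtain t where t: "cos x = (\<Sum>m<4. cos_coeff m * x ^ m) + (cos (t + 1/2 * real 4 * pi) / fact 4) * x ^ 4"
    using Maclaurin_cos_expansion[of x 4] by auto
  have "(\<Sum>m<4. cos_coeff m * x ^ m) = 1 - x\<^sup>2 / 2"
  proof -
    have "{..<4} = {0, 1, 2, 3::nat}" by auto
    then show ?thesis by (simp add: cos_coeff_def)
  qed
  moreover have "(cos (t + 1/2 * real 4 * pi) / fact 4) * x ^ 4 \<le> 1 / 24 * x ^ 4"
    by (intro mult_right_mono divide_right_mono[of _ 1 24, simplified]) (auto simp: fact_numeral)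
  moreover have "1 / 24 * x ^ 4 \<le> x\<^sup>2 / 6"
  proof -
    have "x\<^sup>2 \<le> 4" using assms abs_le_square_iff[of x 2] by simp
    then have "x\<^sup>2 * x\<^sup>2 \<le> 4 * x\<^sup>2" by (intro mult_right_mono) auto
    then show ?thesis by (simp add: power2_eq_square eval_nat_numeral)
  qed
  ultimately have "cos x \<le> 1 + (- x\<^sup>2 / 3)" using t by linarith
  also have "\<dots> \<le> exp (- x\<^sup>2 / 3)" by (rule exp_ge_add_one_self)
  finally show ?thesis .
qed

text \<open>
  The factor by which the mean of \<open>exp (cos \<langle>y,\<eta>\<rangle>)\<close> over sign vectors \<open>y\<close> falls below its trivial
  bound \<open>exp 1\<close> when \<open>1/4 \<le> \<bar>\<eta>\<bar> \<le> 5/4\<close>; here \<open>exp (- 1 / 48)\<close> bounds the mean of the cosine.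
\<close>

definition sign_kappa :: real where
  "sign_kappa = 1 - (1 - exp (- 1 / 48)) / 2 * (1 - exp (- 2))"

lemma sign_kappa: "1/2 < sign_kappa" "sign_kappa < 1"
proof -
  have a: "0 < 1 - exp (- 1 / 48 :: real)" "1 - exp (- 1 / 48 :: real) < 1"
    "0 < 1 - exp (- 2 :: real)" "1 - exp (- 2 :: real) < 1" by auto
  then have "0 < (1 - exp (- 1 / 48 :: real)) * (1 - exp (- 2))" by simp
  moreover have "(1 - exp (- 1 / 48 :: real)) * (1 - exp (- 2)) < 1 * 1"
    using a by (intro mult_strict_mono) auto
  ultimately show "1/2 < sign_kappa" "sign_kappa < 1" by (auto simp: sign_kappa_def)
qed

text \<open>
  By convexity \<open>exp\<close> lies below its chord on \<open>[-1,1]\<close>, so the exponential moment is controlled by the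
  mean of the cosine, and the product formula bounds that mean by \<open>exp (- \<bar>\<eta>\<bar>\<^sup>2 / 3)\<close>.
\<close>

lemma sum_sign_vectors_exp_cos:
  fixes \<eta> :: "'a \<Rightarrow> real"
  assumes J: "finite J" and lo: "1/16 \<le> (\<Sum>j\<in>J. (\<eta> j)\<^sup>2)" and hi: "(\<Sum>j\<in>J. (\<eta> j)\<^sup>2) \<le> 25/16"
  shows "(\<Sum>y\<in>J \<rightarrow>\<^sub>E {-1, 1}. exp (cos (\<Sum>j\<in>J. y j * \<eta> j))) \<le> 2 ^ card J * (exp 1 * sign_kappa)"
proof -
  have chord: "exp c \<le> (1 + c) / 2 * exp 1 + (1 - c) / 2 * exp (-1)" if "\<bar>c\<bar> \<le> 1" for c :: real
  proof -
    have "exp ((1 - (1 + c)/2) * (-1) + (1 + c)/2 * 1) \<le> (1 - (1 + c)/2) * exp (-1) + (1 + c)/2 * exp (1::real)"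
      using convex_onD[OF exp_convex, of "(1 + c)/2" "-1" 1] that by auto
    then show ?thesis by (simp add: field_simps)
  qed
  have small: "\<bar>\<eta> j\<bar> \<le> 5/4" if "j \<in> J" for j
  proof -
    have "(\<eta> j)\<^sup>2 \<le> 25/16" using member_le_sum[OF that, of "\<lambda>j. (\<eta> j)\<^sup>2"] hi J by auto
    then show ?thesis using abs_le_square_iff[of "\<eta> j" "5/4"] by (simp add: power2_eq_square)
  qed
  have "(\<Prod>j\<in>J. cos (\<eta> j)) \<le> (\<Prod>j\<in>J. exp (- (\<eta> j)\<^sup>2 / 3))"
  proof (rule prod_mono)
    fix j assume "j \<in> J"
    then have "\<bar>\<eta> j\<bar> \<le> 5/4" using small by blast
    then show "0 \<le> cos (\<eta> j) \<and> cos (\<eta> j) \<le> exp (- (\<eta> j)\<^sup>2 / 3)"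
      using pi_gt3 by (intro conjI cos_ge_zero cos_le_exp_quadratic) auto
  qed
  also have "\<dots> = exp (- (\<Sum>j\<in>J. (\<eta> j)\<^sup>2) / 3)"
    using J by (simp add: exp_sum[symmetric] sum_negf sum_divide_distrib)
  also have "\<dots> \<le> exp (- 1 / 48)" using lo by simp
  finally have m: "(\<Prod>j\<in>J. cos (\<eta> j)) \<le> exp (- 1 / 48)" .
  have "(\<Sum>y\<in>J \<rightarrow>\<^sub>E {-1, 1}. exp (cos (\<Sum>j\<in>J. y j * \<eta> j)))
     \<le> (\<Sum>y\<in>J \<rightarrow>\<^sub>E {-1, 1}. (1 + cos (\<Sum>j\<in>J. y j * \<eta> j)) / 2 * exp 1 + (1 - cos (\<Sum>j\<in>J. y j * \<eta> j)) / 2 * exp (-1))"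
    by (intro sum_mono chord) auto
  also have "\<dots> = real (card (J \<rightarrow>\<^sub>E {-1, 1::real})) * ((exp 1 + exp (-1)) / 2)
      + (\<Sum>y\<in>J \<rightarrow>\<^sub>E {-1, 1}. cos (\<Sum>j\<in>J. y j * \<eta> j)) * ((exp 1 - exp (-1)) / 2)"
    unfolding sum_constant[symmetric] sum_distrib_right sum.distrib[symmetric]
    by (intro sum.cong refl) (simp add: field_simps)
  also have "\<dots> = 2 ^ card J * ((exp 1 + exp (-1)) / 2 + (\<Prod>j\<in>J. cos (\<eta> j)) * ((exp 1 - exp (-1)) / 2))"
    using J by (simp add: sum_sign_vectors_cos card_PiE algebra_simps)
  also have "\<dots> \<le> 2 ^ card J * ((exp 1 + exp (-1)) / 2 + exp (- 1 / 48) * ((exp 1 - exp (-1)) / 2))"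
    using m by (intro mult_left_mono add_left_mono mult_right_mono) auto
  also have "(exp 1 + exp (-1)) / 2 + exp (- 1 / 48) * ((exp 1 - exp (-1)) / 2) = exp 1 * sign_kappa"
  proof -
    have e: "exp (-1::real) = exp 1 * exp (-2)" by (simp only: exp_add[symmetric]) simp
    have gen: "(a + a * b) / 2 + c * ((a - a * b) / 2) = a * (1 - (1 - c) / 2 * (1 - b))" for a b c :: real
      by (simp add: field_simps)
    show ?thesis unfolding sign_kappa_def e by (rule gen)
  qed
  finally show ?thesis .
qed

text \<open>
  A random sign matrix with \<open>B * n\<close> rows works once \<open>B\<close> is a large constant: for a fixed \<open>\<eta>\<close> the
  inequality fails with probability exponentially small in \<open>B * n\<close>. Consider the lattice \<open>h \<int>\<^sup>n\<close> with
  \<open>h\<close> of order \<open>1 / sqrt n\<close>; it has only \<open>exp (O(n))\<close> points of \<open>\<ell>\<^sub>1\<close> norm \<open>O(sqrt n)\<close>, and a union bound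
  gives the inequality at once for those among them whose Euclidean norm is between \<open>1/4\<close> and \<open>5/4\<close>.
  The given \<open>\<eta>\<close> is rounded to such a lattice point so that its inner products with the rows change little in quadratic mean. Rounding by
  \<open>exists_rounding\<close>, rather than to a nearest point of a net, avoids any estimate of the operator
  norm of the matrix.
\<close>

lemma exists_sign_matrix:
  "\<exists>(B::nat) \<delta>::real. B \<ge> 1 \<and> 0 < \<delta> \<and> \<delta> \<le> 1 \<and> (\<forall>n\<ge>1. \<exists>Y :: nat \<Rightarrow> nat \<Rightarrow> real.
     (\<forall>i<B * n. \<forall>j<n. Y i j \<in> {-1, 1}) \<and>
     (\<forall>\<eta>. 1/2 \<le> L2_set \<eta> {..<n} \<and> L2_set \<eta> {..<n} \<le> 1 \<longrightarrow>
        (\<Sum>i<B * n. cos (\<Sum>j<n. Y i j * \<eta> j)) \<le> (1 - \<delta>) * real (B * n)))"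
proof -
  define \<delta> where "\<delta> = - ln sign_kappa / 4"
  have d: "0 < \<delta>" using sign_kappa by (simp add: \<delta>_def)
  have d1: "\<delta> \<le> 1"
  proof -
    have "ln (1/2) \<le> ln sign_kappa" using sign_kappa by (subst ln_le_cancel_iff) auto
    then show ?thesis using ln_2_less_1 by (simp add: \<delta>_def ln_div)
  qed
  obtain K0 :: nat where K0: "1/\<delta> \<le> real K0" "8 \<le> K0"
    by (meson nat_le_linear order_trans real_arch_simple of_nat_mono)
  define C1 :: real where "C1 = 2 ^ (K0 + 1) * 3"
  have C1: "C1 > 0" by (simp add: C1_def)
  have kexp: "sign_kappa = exp (- 4 * \<delta>)" using sign_kappa by (simp add: \<delta>_def)
  \<comment> \<open>\<open>B\<close> is large enough for the exponential moment bound to beat the \<open>C1\<^sup>n\<close> lattice points.\<close>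
  obtain B :: nat where B: "ln C1 / (2 * \<delta>) < real B" "1 \<le> B"
  proof -
    obtain B0 :: nat where "ln C1 / (2 * \<delta>) < real B0" using reals_Archimedean2 by blast
    then show ?thesis by (intro that[of "max 1 B0"]) auto
  qed
  have key: "C1 * exp (- 2 * \<delta>) ^ B < 1"
  proof -
    have "ln C1 < 2 * \<delta> * real B" using B d by (simp add: field_simps)
    then have "exp (ln C1 + real B * (- 2 * \<delta>)) < 1" by (simp add: mult.commute mult.left_commute)
    then show ?thesis by (simp only: exp_add exp_of_nat_mult exp_ln[OF C1])
  qed
  have main: "\<exists>Y :: nat \<Rightarrow> nat \<Rightarrow> real. (\<forall>i<B * n. \<forall>j<n. Y i j \<in> {-1, 1}) \<and>
     (\<forall>\<eta>. 1/2 \<le> L2_set \<eta> {..<n} \<and> L2_set \<eta> {..<n} \<le> 1 \<longrightarrow>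
        (\<Sum>i<B * n. cos (\<Sum>j<n. Y i j * \<eta> j)) \<le> (1 - \<delta>) * real (B * n))" if n: "n \<ge> 1" for n :: nat
  proof -
    define N where "N = B * n"
    define h where "h = 1 / (real K0 * sqrt (real n))"
    have h: "h > 0" using n K0 by (simp add: h_def)
    have nh: "real n * h\<^sup>2 = 1 / (real K0)\<^sup>2" using n by (simp add: h_def power_mult_distrib power_divide)
    define S where "S = {m \<in> {..<n} \<rightarrow>\<^sub>E (UNIV :: int set). (\<Sum>j<n. \<bar>m j\<bar>) \<le> int (n * (K0 + 1))}"
    define T where "T = {m \<in> S. 1/16 \<le> (\<Sum>j<n. (h * of_int (m j))\<^sup>2) \<and> (\<Sum>j<n. (h * of_int (m j))\<^sup>2) \<le> 25/16}"
    have S: "finite S" "card S \<le> 2 ^ (n * (K0 + 1)) * 3 ^ n"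
      using card_int_vectors_l1_bounded[of "{..<n}" "n * (K0 + 1)"] by (auto simp: S_def)
    have T: "finite T" "real (card T) \<le> C1 ^ n"
    proof -
      show "finite T" using S by (simp add: T_def)
      have "card T \<le> card S" using S by (intro card_mono) (auto simp: T_def)
      then have "real (card T) \<le> real (2 ^ (n * (K0 + 1)) * 3 ^ n)" using S(2) by (meson of_nat_mono order_trans)
      also have "\<dots> = 2 ^ ((K0 + 1) * n) * 3 ^ n" by (simp only: of_nat_mult of_nat_power of_nat_numeral mult.commute)
      also have "\<dots> = C1 ^ n" by (simp only: C1_def power_mult_distrib power_mult)
      finally show "real (card T) \<le> C1 ^ n" .
    qed
    define V where "V = {..<n} \<rightarrow>\<^sub>E {-1, 1::real}"
    define G where "G Y m = (\<Sum>i<N. cos (\<Sum>j<n. Y i j * (h * of_int (m j))))" for Y :: "nat \<Rightarrow> nat \<Rightarrow> real" and m :: "nat \<Rightarrow> int"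
    have finV: "finite V" by (auto simp: V_def intro: finite_PiE)
    have "\<exists>Y\<in>{..<N} \<rightarrow>\<^sub>E V. \<forall>m\<in>T. G Y m \<le> (1 - 2 * \<delta>) * real N"
    proof (rule ccontr)
      assume "\<not> ?thesis"
      then have bad: "\<exists>m\<in>T. (1 - 2 * \<delta>) * real N < G Y m" if "Y \<in> {..<N} \<rightarrow>\<^sub>E V" for Y
        using that by force
      have "(2 ^ n) ^ N * exp ((1 - 2 * \<delta>) * real N) = (\<Sum>Y\<in>{..<N} \<rightarrow>\<^sub>E V. exp ((1 - 2 * \<delta>) * real N))"
        by (simp add: V_def card_PiE)
      also have "\<dots> \<le> (\<Sum>Y\<in>{..<N} \<rightarrow>\<^sub>E V. \<Sum>m\<in>T. exp (G Y m))"
      proof (rule sum_mono)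
        fix Y assume "Y \<in> {..<N} \<rightarrow>\<^sub>E V"
        then obtain m where m: "m \<in> T" "(1 - 2 * \<delta>) * real N < G Y m" using bad by blast
        then have "exp ((1 - 2 * \<delta>) * real N) \<le> exp (G Y m)" by simp
        also have "\<dots> \<le> (\<Sum>m\<in>T. exp (G Y m))" using m T by (intro member_le_sum) auto
        finally show "exp ((1 - 2 * \<delta>) * real N) \<le> (\<Sum>m\<in>T. exp (G Y m))" .
      qed
      also have "\<dots> = (\<Sum>m\<in>T. \<Sum>Y\<in>{..<N} \<rightarrow>\<^sub>E V. exp (G Y m))" by (rule sum.swap)
      also have "\<dots> \<le> (\<Sum>m\<in>T. (2 ^ n * (exp 1 * sign_kappa)) ^ N)"
      proof (rule sum_mono)
        fix m assume m: "m \<in> T"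
        have "(\<Sum>Y\<in>{..<N} \<rightarrow>\<^sub>E V. exp (G Y m))
            = (\<Sum>Y\<in>{..<N} \<rightarrow>\<^sub>E V. \<Prod>i<N. exp (cos (\<Sum>j<n. Y i j * (h * of_int (m j)))))"
          by (simp add: G_def exp_sum)
        also have "\<dots> = (\<Prod>i<N. \<Sum>y\<in>V. exp (cos (\<Sum>j<n. y j * (h * of_int (m j)))))"
          using finV by (subst prod_sum_PiE) auto
        also have "\<dots> = (\<Sum>y\<in>V. exp (cos (\<Sum>j<n. y j * (h * of_int (m j))))) ^ N" by simp
        also have "\<dots> \<le> (2 ^ n * (exp 1 * sign_kappa)) ^ N"
          using sum_sign_vectors_exp_cos[of "{..<n}" "\<lambda>j. h * of_int (m j)"] m
          by (intro power_mono) (auto simp: T_def V_def intro: sum_nonneg)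
        finally show "(\<Sum>Y\<in>{..<N} \<rightarrow>\<^sub>E V. exp (G Y m)) \<le> (2 ^ n * (exp 1 * sign_kappa)) ^ N" .
      qed
      also have "\<dots> = real (card T) * (2 ^ n * (exp 1 * sign_kappa)) ^ N" by simp
      also have "\<dots> \<le> C1 ^ n * (2 ^ n * (exp 1 * sign_kappa)) ^ N"
        using T sign_kappa by (intro mult_right_mono) auto
      finally have "(2 ^ n) ^ N * exp ((1 - 2 * \<delta>) * real N) \<le> (2 ^ n) ^ N * (C1 ^ n * (exp 1 * sign_kappa) ^ N)"
        by (simp add: power_mult_distrib mult_ac)
      then have "exp ((1 - 2 * \<delta>) * real N) \<le> C1 ^ n * (exp 1 * sign_kappa) ^ N" by simp
      moreover have "exp 1 * sign_kappa = exp (1 - 2 * \<delta>) * exp (- 2 * \<delta>)"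
        unfolding kexp exp_add[symmetric] by simp
      then have "C1 ^ n * (exp 1 * sign_kappa) ^ N = exp (1 - 2 * \<delta>) ^ N * (C1 ^ n * exp (- 2 * \<delta>) ^ N)"
        by (simp add: power_mult_distrib)
      moreover have "exp ((1 - 2 * \<delta>) * real N) = exp (1 - 2 * \<delta>) ^ N"
        by (metis exp_of_nat2_mult)
      ultimately have "exp (1 - 2 * \<delta>) ^ N * 1 \<le> exp (1 - 2 * \<delta>) ^ N * (C1 ^ n * exp (- 2 * \<delta>) ^ N)"
        by (simp only: mult_1_right)
      then have "1 \<le> C1 ^ n * exp (- 2 * \<delta>) ^ N"
        by (subst (asm) mult_le_cancel_left_pos) auto
      also have "\<dots> = (C1 * exp (- 2 * \<delta>) ^ B) ^ n" by (simp add: N_def power_mult_distrib power_mult)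
      also have "\<dots> < 1" using power_strict_mono[OF key, of n] C1 n by simp
      finally show False by simp
    qed
    then obtain Y where Y: "Y \<in> {..<N} \<rightarrow>\<^sub>E V" "\<And>m. m \<in> T \<Longrightarrow> G Y m \<le> (1 - 2 * \<delta>) * real N" by blast
    have Ysgn: "Y i j \<in> {-1, 1}" if "i < N" "j < n" for i j
      using Y(1) that unfolding V_def by (meson PiE_mem lessThan_iff)
    have "(\<Sum>i<N. cos (\<Sum>j<n. Y i j * \<eta> j)) \<le> (1 - \<delta>) * real N"
      if \<eta>: "1/2 \<le> L2_set \<eta> {..<n}" "L2_set \<eta> {..<n} \<le> 1" for \<eta>
    proof -
      define q where "q j = \<lfloor>\<eta> j / h\<rfloor>" for j
      define f where "f j = \<eta> j / h - of_int (q j)" for j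
      have f: "0 \<le> f j \<and> f j \<le> 1" for j unfolding f_def q_def by linarith
      obtain b :: "nat \<Rightarrow> int" where b: "\<forall>j\<in>{..<n}. b j \<in> {0, 1}"
        "(\<Sum>i<N. (\<Sum>j<n. (of_int (b j) - f j) * (h * Y i j))\<^sup>2) \<le> (\<Sum>j<n. \<Sum>i<N. (h * Y i j)\<^sup>2) / 4"
        using exists_rounding[where J="{..<n}" and f=f and I="{..<N}" and v="\<lambda>j i. h * Y i j"] f by auto
      define m where "m = (\<lambda>j\<in>{..<n}. q j + b j)"
      have dif: "h * of_int (m j) - \<eta> j = h * (of_int (b j) - f j)" if "j < n" for j
        using that h by (simp add: m_def f_def field_simps)
      have bf: "\<bar>of_int (b j) - f j\<bar> \<le> 1" if "j < n" for j
      proof -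
        have "b j = 0 \<or> b j = 1" using b(1) that by auto
        then show ?thesis using f[of j] by (auto simp: abs_le_iff)
      qed
      have Yb: "(\<Sum>i<N. (\<Sum>j<n. Y i j * (h * of_int (m j)) - Y i j * \<eta> j)\<^sup>2) \<le> real N / (real K0)\<^sup>2"
      proof -
        have "(\<Sum>j<n. Y i j * (h * of_int (m j)) - Y i j * \<eta> j) = (\<Sum>j<n. (of_int (b j) - f j) * (h * Y i j))" for i
        proof (intro sum.cong refl)
          fix j assume "j \<in> {..<n}"
          then have "Y i j * (h * of_int (m j) - \<eta> j) = Y i j * (h * (of_int (b j) - f j))" by (simp add: dif)
          then show "Y i j * (h * of_int (m j)) - Y i j * \<eta> j = (of_int (b j) - f j) * (h * Y i j)"
            by (simp add: algebra_simps)
        qed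
        moreover have "(\<Sum>j<n. \<Sum>i<N. (h * Y i j)\<^sup>2) = (\<Sum>j<n. \<Sum>i<N. h\<^sup>2)"
        proof (intro sum.cong refl)
          fix j i assume "j \<in> {..<n}" "i \<in> {..<N}"
          then have "Y i j \<in> {-1, 1}" using Ysgn by auto
          then show "(h * Y i j)\<^sup>2 = h\<^sup>2" by (auto simp: power_mult_distrib)
        qed
        moreover have "(\<Sum>j<n. \<Sum>i<N. h\<^sup>2) = real N * (real n * h\<^sup>2)" by simp
        ultimately have "(\<Sum>i<N. (\<Sum>j<n. Y i j * (h * of_int (m j)) - Y i j * \<eta> j)\<^sup>2) \<le> real N * (real n * h\<^sup>2) / 4"
          using b(2) by (simp add: mult.left_commute)
        also have "\<dots> \<le> real N * (real n * h\<^sup>2)" by simp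
        finally show ?thesis unfolding nh by simp
      qed
      have L2d: "L2_set (\<lambda>j. h * of_int (m j) - \<eta> j) {..<n} \<le> 1/8"
      proof -
        have "(\<Sum>j<n. (h * of_int (m j) - \<eta> j)\<^sup>2) \<le> (\<Sum>j<n. h\<^sup>2)"
        proof (rule sum_mono)
          fix j assume "j \<in> {..<n}"
          then have "(of_int (b j) - f j)\<^sup>2 \<le> 1" using bf[of j] abs_le_square_iff[of "of_int (b j) - f j" 1] by simp
          then show "(h * of_int (m j) - \<eta> j)\<^sup>2 \<le> h\<^sup>2"
            using dif[of j] \<open>j \<in> {..<n}\<close> by (simp add: power_mult_distrib mult_left_le)
        qed
        also have "\<dots> = (1 / real K0)\<^sup>2" using nh by (simp add: power_divide)
        finally have "L2_set (\<lambda>j. h * of_int (m j) - \<eta> j) {..<n} \<le> 1 / real K0"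
          unfolding L2_set_def by (simp add: real_le_lsqrt)
        also have "\<dots> \<le> 1/8" using K0 by (simp add: field_simps)
        finally show ?thesis .
      qed
      have hi: "L2_set (\<lambda>j. h * of_int (m j)) {..<n} \<le> 5/4"
        using L2_set_triangle_ineq[of "\<lambda>j. h * of_int (m j) - \<eta> j" \<eta> "{..<n}"] L2d \<eta> by simp
      have lo: "1/4 \<le> L2_set (\<lambda>j. h * of_int (m j)) {..<n}"
      proof -
        have "L2_set (\<lambda>j. \<eta> j - h * of_int (m j)) {..<n} = L2_set (\<lambda>j. h * of_int (m j) - \<eta> j) {..<n}"
          unfolding L2_set_def by (simp add: power2_commute)
        then show ?thesis
          using L2_set_triangle_ineq[of "\<lambda>j. \<eta> j - h * of_int (m j)" "\<lambda>j. h * of_int (m j)" "{..<n}"] L2d \<eta> by simp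
      qed
      have "m \<in> T"
      proof -
        have sq: "(\<Sum>j<n. (h * of_int (m j))\<^sup>2) = (L2_set (\<lambda>j. h * of_int (m j)) {..<n})\<^sup>2"
          unfolding L2_set_def by (simp add: sum_nonneg)
        have "(L2_set (\<lambda>j. h * of_int (m j)) {..<n})\<^sup>2 \<le> (5/4)\<^sup>2" using hi by (intro power_mono) auto
        moreover have "(1/4)\<^sup>2 \<le> (L2_set (\<lambda>j. h * of_int (m j)) {..<n})\<^sup>2" using lo by (intro power_mono) auto
        moreover have "(\<Sum>j<n. \<bar>m j\<bar>) \<le> int (n * (K0 + 1))"
        proof -
          have "real_of_int (\<Sum>j<n. \<bar>m j\<bar>) = (\<Sum>j<n. \<bar>real_of_int (m j)\<bar>)" by simp
          also have "\<dots> \<le> (\<Sum>j<n. \<bar>\<eta> j\<bar> / h + 1)"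
          proof (rule sum_mono)
            fix j assume "j \<in> {..<n}"
            then have "real_of_int (m j) = \<eta> j / h + (of_int (b j) - f j)" by (simp add: m_def f_def)
            then show "\<bar>real_of_int (m j)\<bar> \<le> \<bar>\<eta> j\<bar> / h + 1"
              using bf[of j] \<open>j \<in> {..<n}\<close> abs_triangle_ineq[of "\<eta> j / h" "of_int (b j) - f j"] h by simp
          qed
          also have "\<dots> = (\<Sum>j<n. \<bar>\<eta> j\<bar> * \<bar>1\<bar>) / h + real n" by (simp add: sum.distrib sum_divide_distrib)
          also have "\<dots> \<le> (L2_set \<eta> {..<n} * L2_set (\<lambda>_. 1) {..<n}) / h + real n"
            using h by (intro add_right_mono divide_right_mono L2_set_mult_ineq) auto
          also have "\<dots> \<le> (1 * L2_set (\<lambda>_. 1) {..<n}) / h + real n"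
            using h \<eta> by (intro add_right_mono divide_right_mono mult_right_mono) auto
          also have "\<dots> = real (n * (K0 + 1))"
            using n K0 by (simp add: L2_set_def h_def algebra_simps)
          finally show ?thesis by linarith
        qed
        moreover have "m \<in> {..<n} \<rightarrow>\<^sub>E UNIV" by (simp add: m_def)
        ultimately show ?thesis unfolding T_def S_def mem_Collect_eq sq
          by (simp only: power_divide) simp
      qed
      then have G: "G Y m \<le> (1 - 2 * \<delta>) * real N" using Y by blast
      have "(\<Sum>i<N. cos (\<Sum>j<n. Y i j * \<eta> j)) - G Y m
          \<le> (\<Sum>i<N. \<bar>\<Sum>j<n. Y i j * (h * of_int (m j)) - Y i j * \<eta> j\<bar> * \<bar>1\<bar>)"
        unfolding G_def sum_subtractf[symmetric]
      proof (rule sum_mono)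
        have lip: "cos x - cos y \<le> \<bar>y - x\<bar>" for x y :: real
        proof -
          have "\<bar>cos x - cos y\<bar> = \<bar>2 * sin ((x + y) / 2) * sin ((y - x) / 2)\<bar>" by (simp add: cos_diff_cos)
          also have "\<dots> = 2 * \<bar>sin ((x + y) / 2)\<bar> * \<bar>sin ((y - x) / 2)\<bar>" by (simp add: abs_mult)
          also have "\<dots> \<le> 2 * 1 * \<bar>(y - x) / 2\<bar>" by (intro mult_mono abs_sin_x_le_abs_x) auto
          finally show ?thesis by simp
        qed
        fix i
        show "cos (\<Sum>j<n. Y i j * \<eta> j) - cos (\<Sum>j<n. Y i j * (h * of_int (m j)))
          \<le> \<bar>\<Sum>j<n. Y i j * (h * of_int (m j)) - Y i j * \<eta> j\<bar> * \<bar>1\<bar>"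
          using lip[of "\<Sum>j<n. Y i j * \<eta> j" "\<Sum>j<n. Y i j * (h * of_int (m j))"] by (simp add: sum_subtractf)
      qed
      also have "\<dots> \<le> L2_set (\<lambda>i. \<Sum>j<n. Y i j * (h * of_int (m j)) - Y i j * \<eta> j) {..<N} * L2_set (\<lambda>_. 1) {..<N}"
        by (rule L2_set_mult_ineq)
      also have "\<dots> \<le> sqrt (real N / (real K0)\<^sup>2) * sqrt (real N)"
        using Yb by (intro mult_mono) (auto simp: L2_set_def)
      also have "\<dots> = real N / real K0" by (simp add: real_sqrt_divide)
      also have "\<dots> \<le> real N * \<delta>"
      proof -
        have "1 / real K0 \<le> \<delta>" using K0 d by (simp add: field_simps)
        then have "real N * (1 / real K0) \<le> real N * \<delta>" by (intro mult_left_mono) auto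
        then show ?thesis by simp
      qed
      finally show ?thesis using G by (simp add: algebra_simps)
    qed
    then show ?thesis using Ysgn unfolding N_def by blast
  qed
  show ?thesis
    by (intro exI[of _ B] exI[of _ \<delta>] conjI allI impI B(2) d d1 main)
qed

section \<open>Smooth convex bodies from even powers of linear forms\<close>

lemma Rn_inner_scale_left: "Rn_inner n (Rn_scale n a x) w = a * Rn_inner n x w"
  unfolding Rn_inner_def Rn_scale_def sum_distrib_left by (intro sum.cong refl) (simp add: mult.assoc)

lemma Rn_inner_add_left: "Rn_inner n (Rn_add n x y) w = Rn_inner n x w + Rn_inner n y w"
  unfolding Rn_inner_def Rn_add_def sum.distrib[symmetric] by (intro sum.cong refl) (simp add: algebra_simps)

lemma Rn_inner_zero_left: "Rn_inner n (Rn_zero n) w = 0"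
  by (simp add: Rn_inner_def Rn_zero_def)

lemma Rn_scale_in_Rn [simp]: "Rn_scale n a x \<in> Rn n"
  by (simp add: Rn_scale_def Rn_def)

lemma Rn_add_in_Rn [simp]: "Rn_add n x y \<in> Rn n"
  by (simp add: Rn_add_def Rn_def)

lemma Rn_zero_in_Rn [simp]: "Rn_zero n \<in> Rn n"
  by (simp add: Rn_zero_def Rn_def)

lemma Rn_scale_1: "x \<in> Rn n \<Longrightarrow> Rn_scale n 1 x = x"
  by (auto simp: Rn_scale_def Rn_def PiE_iff extensional_def)

lemma Rn_scale_scale: "Rn_scale n a (Rn_scale n b x) = Rn_scale n (a * b) x"
  by (auto simp: Rn_scale_def)

lemma Rn_norm_pos: "x \<in> Rn n \<Longrightarrow> x \<noteq> Rn_zero n \<Longrightarrow> 0 < Rn_norm n x"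
proof (rule ccontr)
  assume x: "x \<in> Rn n" "x \<noteq> Rn_zero n" "\<not> 0 < Rn_norm n x"
  then have "Rn_norm n x = 0" unfolding Rn_norm_def by (meson L2_set_nonneg antisym_conv not_le)
  then have "\<forall>i<n. x i = 0" unfolding Rn_norm_def by (simp add: L2_set_eq_0_iff)
  then have "x = Rn_zero n" using x(1) by (auto simp: Rn_zero_def Rn_def PiE_iff extensional_def)
  then show False using x by simp
qed

lemma continuous_map_Rn_coordinate: "i < n \<Longrightarrow> continuous_map (Rn_top n) euclideanreal (\<lambda>x. x i)"
  unfolding Rn_top_def by (rule continuous_map_product_projection) auto

lemma continuous_map_Rn_inner: "continuous_map (Rn_top n) euclideanreal (\<lambda>x. Rn_inner n x w)"
  unfolding Rn_inner_def by (intro continuous_map_sum continuous_map_real_mult_right continuous_map_Rn_coordinate) auto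

text \<open>
  Compactness gives boundedness of a continuous radial function and the existence of the maximum
  over directions.
\<close>

lemma compactin_Rn_sphere: "compactin (Rn_top n) (Rn_sphere n)"
proof -
  define B where "B = {..<n} \<rightarrow>\<^sub>E {-1..1::real}"
  have "compactin (Rn_top n) B"
    unfolding Rn_top_def B_def by (subst compactin_PiE) auto
  moreover have "closedin (Rn_top n) {x \<in> topspace (Rn_top n). (\<Sum>i<n. (x i)\<^sup>2) \<in> {1}}"
    by (intro closedin_continuous_map_preimage[where Y=euclideanreal] continuous_map_sum continuous_map_real_pow continuous_map_Rn_coordinate) auto
  ultimately have "compactin (Rn_top n) (B \<inter> {x \<in> topspace (Rn_top n). (\<Sum>i<n. (x i)\<^sup>2) \<in> {1}})"
    by (rule compact_Int_closedin)
  also have "B \<inter> {x \<in> topspace (Rn_top n). (\<Sum>i<n. (x i)\<^sup>2) \<in> {1}} = Rn_sphere n"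
  proof -
    have "x i \<in> {-1..1}" if "(\<Sum>i<n. (x i)\<^sup>2) = 1" "i < n" for x :: "nat \<Rightarrow> real" and i
    proof -
      have "(x i)\<^sup>2 \<le> 1\<^sup>2" using member_le_sum[of i "{..<n}" "\<lambda>i. (x i)\<^sup>2"] that by simp
      then have "\<bar>x i\<bar> \<le> 1" using abs_le_square_iff[of "x i" 1] by simp
      then show ?thesis by (simp add: abs_le_iff)
    qed
    then show ?thesis
      unfolding B_def Rn_sphere_def Rn_norm_def L2_set_def topspace_Rn_top Rn_def PiE_iff
      by (intro Set.set_eqI) (auto simp: extensional_def)
  qed
  finally show ?thesis .
qed

text \<open>
  An algebra of functions that contains the linear forms and is closed under partial derivatives;
  this closure is what the induction over the order of differentiability needs.
\<close>

inductive poly_fun :: "nat \<Rightarrow> ((nat \<Rightarrow> real) \<Rightarrow> real) \<Rightarrow> bool" for n where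
  const: "poly_fun n (\<lambda>_. c)"
| coord: "i < n \<Longrightarrow> poly_fun n (\<lambda>x. x i)"
| add: "poly_fun n f \<Longrightarrow> poly_fun n g \<Longrightarrow> poly_fun n (\<lambda>x. f x + g x)"
| mult: "poly_fun n f \<Longrightarrow> poly_fun n g \<Longrightarrow> poly_fun n (\<lambda>x. f x * g x)"

lemma poly_fun_sum: "finite A \<Longrightarrow> (\<And>a. a \<in> A \<Longrightarrow> poly_fun n (f a)) \<Longrightarrow> poly_fun n (\<lambda>x. \<Sum>a\<in>A. f a x)"
  by (induction A rule: finite_induct) (auto intro: poly_fun.intros)

lemma poly_fun_power: "poly_fun n f \<Longrightarrow> poly_fun n (\<lambda>x. f x ^ k)"
  by (induction k) (auto intro: poly_fun.intros)

lemma poly_fun_inner: "poly_fun n (\<lambda>x. Rn_inner n x w)"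
  unfolding Rn_inner_def by (intro poly_fun_sum poly_fun.intros) auto

lemma continuous_map_poly_fun: "poly_fun n f \<Longrightarrow> continuous_map (Rn_top n) euclideanreal f"
  by (induction rule: poly_fun.induct)
     (auto intro: continuous_map_Rn_coordinate continuous_map_add continuous_map_real_mult)

lemma poly_fun_partial_derivatives:
  assumes "poly_fun n f"
  shows "\<exists>f'. \<forall>i<n. poly_fun n (f' i) \<and> (\<forall>x. ((\<lambda>s. f (x(i := s))) has_real_derivative f' i x) (at (x i)))"
  using assms
proof (induction rule: poly_fun.induct)
  case (const c)
  show ?case by (rule exI[of _ "\<lambda>_ _. 0"]) (auto intro: poly_fun.intros)
next
  case (coord j)
  have "((\<lambda>s. (x(i := s)) j) has_real_derivative (if i = j then 1 else 0)) (at (x i))" for x :: "nat \<Rightarrow> real" and i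
    by (cases "i = j") auto
  then show ?case
    by (intro exI[of _ "\<lambda>i _. if i = j then 1 else 0"]) (auto intro: poly_fun.intros)
next
  case (add f g)
  then obtain f' g' where
    "\<forall>i<n. poly_fun n (f' i) \<and> (\<forall>x. ((\<lambda>s. f (x(i := s))) has_real_derivative f' i x) (at (x i)))"
    "\<forall>i<n. poly_fun n (g' i) \<and> (\<forall>x. ((\<lambda>s. g (x(i := s))) has_real_derivative g' i x) (at (x i)))"
    by blast
  then show ?case
    by (intro exI[of _ "\<lambda>i x. f' i x + g' i x"] allI impI conjI poly_fun.add DERIV_add) blast+
next
  case (mult f g)
  then obtain f' g' where
    "\<forall>i<n. poly_fun n (f' i) \<and> (\<forall>x. ((\<lambda>s. f (x(i := s))) has_real_derivative f' i x) (at (x i)))"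
    "\<forall>i<n. poly_fun n (g' i) \<and> (\<forall>x. ((\<lambda>s. g (x(i := s))) has_real_derivative g' i x) (at (x i)))"
    by blast
  moreover have "((\<lambda>s. f (x(i := s)) * g (x(i := s))) has_real_derivative f' i x * g x + f x * g' i x) (at (x i))"
    if "((\<lambda>s. f (x(i := s))) has_real_derivative f' i x) (at (x i))"
      "((\<lambda>s. g (x(i := s))) has_real_derivative g' i x) (at (x i))" for x i
    using DERIV_mult'[OF that] by (simp add: add.commute)
  ultimately show ?case using mult(1,2)
    by (intro exI[of _ "\<lambda>i x. f' i x * g x + f x * g' i x"] allI impI conjI poly_fun.add poly_fun.mult) blast+
qed

text \<open>
  Functions of the form \<open>P * N powr a\<close> are closed under partial derivatives as long as \<open>P\<close> and \<open>a\<close>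
  may vary, so one induction yields all orders.
\<close>

lemma Ck_on_poly_fun_times_powr:
  assumes "poly_fun n N" "poly_fun n P"
  shows "Ck_on n k {x \<in> Rn n. 0 < N x} (\<lambda>x. P x * N x powr a)"
  using assms(2)
proof (induction k arbitrary: P a)
  have cont: "continuous_map (subtopology (Rn_top n) {x \<in> Rn n. 0 < N x}) euclideanreal (\<lambda>x. P x * N x powr a)"
    if "poly_fun n P" for P a
  proof -
    have "continuous_map (subtopology (Rn_top n) {x \<in> Rn n. 0 < N x}) (subtopology euclideanreal {0<..}) N"
      by (auto simp: continuous_map_in_subtopology intro!: continuous_map_from_subtopology continuous_map_poly_fun assms)
    moreover have "continuous_map (subtopology euclideanreal {0<..}) euclideanreal (\<lambda>y. y powr a)"
      by (auto simp: continuous_map_iff_continuous intro!: continuous_intros)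
    ultimately have "continuous_map (subtopology (Rn_top n) {x \<in> Rn n. 0 < N x}) euclideanreal ((\<lambda>y. y powr a) \<circ> N)"
      by (rule continuous_map_compose)
    then show ?thesis
      using continuous_map_real_mult[OF continuous_map_from_subtopology[OF continuous_map_poly_fun[OF that]]]
      by (simp add: o_def)
  qed
  {
    case 0
    then show ?case using cont by simp
  next
    case (Suc k)
    obtain N' where N': "\<And>i. i < n \<Longrightarrow> poly_fun n (N' i)"
      "\<And>i x. i < n \<Longrightarrow> ((\<lambda>s. N (x(i := s))) has_real_derivative N' i x) (at (x i))"
      using poly_fun_partial_derivatives[OF assms(1)] by blast
    obtain P' where P': "\<And>i. i < n \<Longrightarrow> poly_fun n (P' i)"
      "\<And>i x. i < n \<Longrightarrow> ((\<lambda>s. P (x(i := s))) has_real_derivative P' i x) (at (x i))"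
      using poly_fun_partial_derivatives[OF Suc.prems] by blast
    \<comment> \<open>The partial derivatives have the same form, with exponent \<open>a - 1\<close>.\<close>
    define Q where "Q i x = P' i x * N x + a * (P x * N' i x)" for i x
    have "poly_fun n (Q i)" if "i < n" for i
      unfolding Q_def using that N' P' assms(1) Suc.prems by (intro poly_fun.intros)
    moreover have "((\<lambda>s. P (x(i := s)) * N (x(i := s)) powr a) has_real_derivative Q i x * N x powr (a - 1)) (at (x i))"
      if "i < n" "x \<in> {x \<in> Rn n. 0 < N x}" for i x
    proof -
      have pos: "0 < N (x(i := x i))" using that by simp
      have "((\<lambda>s. P (x(i := s)) * N (x(i := s)) powr a) has_real_derivative
        P (x(i := x i)) * (a * N (x(i := x i)) powr (a - 1) * N' i x) + P' i x * N (x(i := x i)) powr a) (at (x i))"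
        by (intro DERIV_mult' P'(2) that(1))
          (rule DERIV_fun_powr[OF N'(2)[OF that(1)] pos, THEN DERIV_cong], simp)
      moreover have "N x powr a = N x * N x powr (a - 1)"
        using that by (simp add: powr_diff)
      ultimately show ?thesis by (simp add: Q_def algebra_simps)
    qed
    ultimately show ?case
      unfolding Ck_on.simps
      by (intro conjI cont[OF Suc.prems] exI[of _ "\<lambda>i x. Q i x * N x powr (a - 1)"] allI impI ballI Suc.IH)
  }
qed

text \<open>
  The \<open>2p\<close>-th power of a norm induced by an \<open>\<ell>\<^sub>2\<^sub>p\<close> norm. For large \<open>p\<close> its unit ball is close to the
  polytope \<open>\<bar>\<langle>x,w\<rangle>\<bar> \<le> 1\<close> (\<open>w \<in> W\<close>), but its radial function is smooth.
\<close>

definition power_sum :: "nat \<Rightarrow> nat \<Rightarrow> (nat \<Rightarrow> real) set \<Rightarrow> (nat \<Rightarrow> real) \<Rightarrow> real" where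
  "power_sum n p W x = (\<Sum>w\<in>W. Rn_inner n x w ^ (2 * p))"

lemma power_sum_scale: "power_sum n p W (Rn_scale n a x) = a ^ (2 * p) * power_sum n p W x"
  unfolding power_sum_def Rn_inner_scale_left power_mult_distrib sum_distrib_left ..

lemma power_sum_zero: "0 < p \<Longrightarrow> power_sum n p W (Rn_zero n) = 0"
  unfolding power_sum_def Rn_inner_zero_left by simp

lemma poly_fun_power_sum: "finite W \<Longrightarrow> poly_fun n (power_sum n p W)"
  unfolding power_sum_def by (intro poly_fun_sum poly_fun_power poly_fun_inner)

text \<open>
  The radial function of the sublevel set is \<open>R powr (1 / (2 * p)) * power_sum powr (- 1 / (2 * p))\<close>,
  by homogeneity; convexity holds because an even power of a linear form is convex.
\<close>

lemma power_sum_sublevel_smooth_convex_body: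
  assumes W: "finite W" and p: "0 < p" and R: "0 < R"
    and pos: "\<And>x. x \<in> Rn n \<Longrightarrow> x \<noteq> Rn_zero n \<Longrightarrow> 0 < power_sum n p W x"
  defines "D \<equiv> {x \<in> Rn n. power_sum n p W x \<le> R}"
  shows "convex_body n D" "infinitely_smooth n D" "Rn_symmetric n D"
proof -
  let ?N = "power_sum n p W"
  define c where "c = R powr (1 / (2 * p))"
  define \<rho> where "\<rho> x = c * ?N x powr (- 1 / (2 * p))" for x
  let ?U = "{x \<in> Rn n. 0 < ?N x}"
  have U: "openin (Rn_top n) ?U"
  proof -
    have "openin (Rn_top n) {x \<in> topspace (Rn_top n). ?N x \<in> {0<..}}"
      by (rule openin_continuous_map_preimage[OF continuous_map_poly_fun[OF poly_fun_power_sum[OF W]]]) auto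
    then show ?thesis by simp
  qed
  have sph: "Rn_sphere n \<subseteq> ?U"
  proof
    fix x assume x: "x \<in> Rn_sphere n"
    have "Rn_norm n (Rn_zero n) = 0" by (simp add: Rn_norm_def Rn_zero_def L2_set_def)
    then show "x \<in> ?U" using x pos by (force simp: Rn_sphere_def)
  qed
  have Ck: "Ck_on n k ?U \<rho>" for k
    unfolding \<rho>_def by (intro Ck_on_poly_fun_times_powr poly_fun_power_sum W poly_fun.intros)
  then have "continuous_map (subtopology (Rn_top n) ?U) euclideanreal \<rho>" using Ck[of 0] by simp
  then have contS: "continuous_map (subtopology (Rn_top n) (Rn_sphere n)) euclideanreal \<rho>"
    using sph by (rule continuous_map_from_subtopology_mono)
  have bdd: "bounded (\<rho> ` Rn_sphere n)"
  proof -
    have "compactin (subtopology (Rn_top n) (Rn_sphere n)) (Rn_sphere n)"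
      using compactin_Rn_sphere by (simp add: compactin_subtopology)
    from image_compactin[OF this contS] show ?thesis
      by (simp add: compact_imp_bounded)
  qed
  have \<rho>: "0 < \<rho> x" if "0 < ?N x" for x using that R by (simp add: \<rho>_def c_def)
  have mem: "?N x \<le> R \<longleftrightarrow> Rn_norm n x \<le> \<rho> (Rn_scale n (1 / Rn_norm n x) x)"
    if x: "x \<in> Rn n" "x \<noteq> Rn_zero n" for x
  proof -
    have nx: "0 < Rn_norm n x" and Nx: "0 < ?N x" using Rn_norm_pos pos x by auto
    have "\<rho> (Rn_scale n (1 / Rn_norm n x) x) = c * (?N x / Rn_norm n x ^ (2 * p)) powr (- 1 / (2 * p))"
      by (simp add: \<rho>_def power_sum_scale power_divide)
    also have "\<dots> = c * ?N x powr (- 1 / (2 * p)) * (Rn_norm n x ^ (2 * p)) powr (1 / (2 * p))"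
      using nx Nx by (simp add: powr_divide powr_minus_divide field_simps)
    also have "(Rn_norm n x ^ (2 * p)) powr (1 / (2 * p)) = Rn_norm n x"
      using nx p by (simp add: powr_realpow[symmetric] powr_powr)
    finally have "Rn_norm n x \<le> \<rho> (Rn_scale n (1 / Rn_norm n x) x) \<longleftrightarrow> 1 \<le> c * ?N x powr (- 1 / (2 * p))"
      using nx by (simp add: mult_le_cancel_right1)
    also have "\<dots> \<longleftrightarrow> ?N x powr (1 / (2 * p)) \<le> c"
      using Nx by (simp add: powr_minus_divide field_simps)
    also have "\<dots> \<longleftrightarrow> ?N x \<le> R"
      unfolding c_def
      using powr_mono2[of "1 / (2 * p)" "?N x" R] powr_less_mono2[of "1 / (2 * p)" R "?N x"] Nx R p
      by (cases "?N x \<le> R") (simp_all add: not_le)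
    finally show ?thesis by simp
  qed
  have rad: "radial_function n D \<rho>"
    unfolding radial_function_def
  proof (intro conjI contS bdd)
    show "\<forall>\<theta>\<in>Rn_sphere n. 0 < \<rho> \<theta>" using \<rho> sph by auto
    show "D = {Rn_zero n} \<union> {x \<in> Rn n - {Rn_zero n}. Rn_norm n x \<le> \<rho> (Rn_scale n (1 / Rn_norm n x) x)}"
      unfolding D_def using mem R p by (auto simp: power_sum_zero)
  qed
  have "Rn_convex n D"
    unfolding Rn_convex_def
  proof (intro ballI)
    fix x y u assume xy: "x \<in> D" "y \<in> D" "u \<in> {0..1::real}"
    let ?w = "Rn_add n (Rn_scale n (1 - u) x) (Rn_scale n u y)"
    have "?N ?w \<le> (\<Sum>w\<in>W. (1 - u) * Rn_inner n x w ^ (2 * p) + u * Rn_inner n y w ^ (2 * p))"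
      unfolding power_sum_def Rn_inner_add_left Rn_inner_scale_left
      using convex_onD[OF convex_power_even[of "2 * p"], where t=u] xy by (intro sum_mono) auto
    also have "\<dots> = (1 - u) * ?N x + u * ?N y"
      by (simp add: power_sum_def sum.distrib sum_distrib_left)
    also have "\<dots> \<le> R"
      using xy by (intro convex_bound_le) (auto simp: D_def)
    finally show "?w \<in> D" by (simp add: D_def)
  qed
  then show "convex_body n D" using rad by (auto simp: convex_body_def star_body_def)
  show "infinitely_smooth n D"
    unfolding infinitely_smooth_def smooth_on_sphere_def
    using rad U sph Ck by blast
  have inv: "Rn_scale n (-1) x \<in> D" if "x \<in> D" for x
    using that by (simp add: D_def power_sum_scale)
  show "Rn_symmetric n D"
    unfolding Rn_symmetric_def
  proof (intro Set.set_eqI iffI)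
    fix x assume "x \<in> D"
    moreover then have "x = Rn_scale n (-1) (Rn_scale n (-1) x)" by (simp add: D_def Rn_scale_scale Rn_scale_1)
    ultimately show "x \<in> Rn_scale n (-1) ` D" using inv by blast
  qed (use inv in auto)
qed

section \<open>Volume of the hull of few points\<close>

interpretation Rn_prod: product_sigma_finite "\<lambda>_ :: nat. lborel :: real measure"
  by (rule product_sigma_finite.intro) (rule sigma_finite_lborel)

lemma measurable_Rn_coordinate [measurable (raw)]:
  "i < n \<Longrightarrow> (\<lambda>x. x i) \<in> borel_measurable (Rn_lebesgue n)"
  unfolding Rn_lebesgue_def using measurable_component_singleton[of i "{..<n}" "\<lambda>_. lborel"] by simp

lemma nn_integral_normal_density:
  "0 < \<sigma> \<Longrightarrow> (\<integral>\<^sup>+ x. ennreal (normal_density \<mu> \<sigma> x) \<partial>lborel) = 1"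
  by (subst nn_integral_eq_integral) (auto simp: integral_normal_density integrable_normal_density)

text \<open>
  The indicator function of the ball is dominated by \<open>exp (a * n - \<bar>x - c\<bar>\<^sup>2)\<close>, which is a product of
  one-dimensional Gaussians. For a ball of radius of order \<open>sqrt n\<close> this has the correct
  exponential order.
\<close>

lemma emeasure_Rn_ball_le:
  "emeasure (Rn_lebesgue n) {x \<in> Rn n. (\<Sum>j<n. (x j - c j)\<^sup>2) \<le> a * real n} \<le> ennreal ((exp a * sqrt pi) ^ n)"
proof -
  let ?B = "{x \<in> Rn n. (\<Sum>j<n. (x j - c j)\<^sup>2) \<le> a * real n}"
  let ?f = "\<lambda>j t. ennreal (exp a * sqrt pi) * ennreal (normal_density (c j) (1 / sqrt 2) t)"
  have B: "?B \<in> sets (Rn_lebesgue n)"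
  proof -
    have "{x \<in> space (Rn_lebesgue n). (\<Sum>j<n. (x j - c j)\<^sup>2) \<le> a * real n} \<in> sets (Rn_lebesgue n)"
      by measurable
    then show ?thesis by simp
  qed
  have "emeasure (Rn_lebesgue n) ?B = (\<integral>\<^sup>+ x. indicator ?B x \<partial>Rn_lebesgue n)"
    using B by simp
  also have "\<dots> \<le> (\<integral>\<^sup>+ x. (\<Prod>j<n. ?f j (x j)) \<partial>Rn_lebesgue n)"
  proof (rule nn_integral_mono)
    fix x
    have e: "?f j t = ennreal (exp (a - (t - c j)\<^sup>2))" for j t
    proof -
      have "exp a * sqrt pi * normal_density (c j) (1 / sqrt 2) t = exp (a - (t - c j)\<^sup>2)"
        by (simp add: normal_density_def power_divide exp_diff exp_minus field_simps)
      then show ?thesis by (simp flip: ennreal_mult)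
    qed
    have "(\<Prod>j<n. ?f j (x j)) = ennreal (exp (a * real n - (\<Sum>j<n. (x j - c j)\<^sup>2)))"
      unfolding e by (subst prod_ennreal) (simp_all add: exp_sum[symmetric] sum_subtractf mult.commute)
    then show "indicator ?B x \<le> (\<Prod>j<n. ?f j (x j))"
      by (auto simp: indicator_def ennreal_1[symmetric] simp del: ennreal_1 intro!: ennreal_leI)
  qed
  also have "\<dots> = (\<Prod>j<n. \<integral>\<^sup>+ t. ?f j t \<partial>lborel)"
    unfolding Rn_lebesgue_def by (rule Rn_prod.product_nn_integral_prod) auto
  also have "\<dots> = (\<Prod>j<n. ennreal (exp a * sqrt pi))"
    by (simp add: nn_integral_cmult nn_integral_normal_density)
  also have "\<dots> = ennreal ((exp a * sqrt pi) ^ n)" by (simp add: ennreal_power)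
  finally show ?thesis .
qed

lemma measurable_Rn_scale [measurable]: "Rn_scale n a \<in> measurable (Rn_lebesgue n) (Rn_lebesgue n)"
proof -
  have "(\<lambda>x. \<lambda>i\<in>{..<n}. a * x i) \<in> measurable (Rn_lebesgue n) (Pi\<^sub>M {..<n} (\<lambda>_. lborel))"
    by (rule measurable_restrict) simp
  then show ?thesis unfolding Rn_lebesgue_def Rn_scale_def[abs_def] .
qed

text \<open>
  Needed to give the body volume exactly \<open>1\<close>.
\<close>

lemma emeasure_Rn_scale_vimage:
  assumes "0 < c" and S: "S \<in> sets (Rn_lebesgue n)"
  shows "emeasure (Rn_lebesgue n) {x \<in> Rn n. Rn_scale n (1 / c) x \<in> S} = ennreal (c ^ n) * emeasure (Rn_lebesgue n) S"
proof -
  let ?M = "Rn_lebesgue n"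
  let ?P = "scale_measure (ennreal ((1 / c) ^ n)) (distr ?M ?M (Rn_scale n (1 / c)))"
  have vim: "emeasure lborel {t. (1 / c) * t \<in> A} = ennreal c * emeasure lborel A" if "A \<in> sets borel" for A
  proof -
    have "emeasure (distr lborel borel ((*) (1 / c))) A = emeasure lborel {t. (1 / c) * t \<in> A}"
      using that by (subst emeasure_distr) (auto simp: vimage_def)
    also have "distr lborel borel ((*) (1 / c)) = density lborel (\<lambda>_. inverse \<bar>1 / c\<bar>)"
      using assms by (intro lborel_distr_mult) auto
    finally show ?thesis using assms that by (simp add: emeasure_density_const)
  qed
  have "?P = Pi\<^sub>M {..<n} (\<lambda>_. lborel)"
  proof (rule Rn_prod.PiM_eqI)
    show "sets ?P = sets (Pi\<^sub>M {..<n} (\<lambda>_. lborel))" by (simp add: Rn_lebesgue_def)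
    fix A :: "nat \<Rightarrow> real set"
    assume A: "\<And>i. i \<in> {..<n} \<Longrightarrow> A i \<in> sets lborel"
    have PA: "Pi\<^sub>E {..<n} A \<in> sets ?M" unfolding Rn_lebesgue_def using A by (intro sets_PiM_I_finite) auto
    have "emeasure (distr ?M ?M (Rn_scale n (1 / c))) (Pi\<^sub>E {..<n} A)
        = emeasure ?M (Pi\<^sub>E {..<n} (\<lambda>i. {t. (1 / c) * t \<in> A i}))"
      using PA by (subst emeasure_distr)
        (auto simp: Rn_scale_def PiE_iff Rn_def vimage_def intro!: arg_cong[where f="emeasure ?M"])
    also have "\<dots> = (\<Prod>i<n. emeasure lborel {t. (1 / c) * t \<in> A i})"
      unfolding Rn_lebesgue_def
    proof (rule Rn_prod.emeasure_PiM)
      fix i assume "i \<in> {..<n}"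
      then have "(*) (1 / c) -` A i \<inter> space borel \<in> sets borel"
        using A by (intro measurable_sets[where A=borel]) auto
      then show "{t. (1 / c) * t \<in> A i} \<in> sets lborel" by (simp add: vimage_def)
    qed simp
    also have "\<dots> = (\<Prod>i<n. ennreal c * emeasure lborel (A i))"
      using A by (intro prod.cong refl vim) auto
    also have "\<dots> = ennreal (c ^ n) * (\<Prod>i<n. emeasure lborel (A i))"
      using assms by (simp add: prod.distrib ennreal_power)
    finally have "emeasure ?P (Pi\<^sub>E {..<n} A) = ennreal ((1 / c) ^ n) * (ennreal (c ^ n) * (\<Prod>i<n. emeasure lborel (A i)))"
      by simp
    also have "\<dots> = (ennreal ((1 / c) ^ n) * ennreal (c ^ n)) * (\<Prod>i<n. emeasure lborel (A i))"
      by (simp add: mult.assoc)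
    also have "ennreal ((1 / c) ^ n) * ennreal (c ^ n) = 1"
      using assms by (simp add: power_divide flip: ennreal_mult)
    finally show "emeasure ?P (Pi\<^sub>E {..<n} A) = (\<Prod>i<n. emeasure lborel (A i))" by simp
  qed simp
  then have "emeasure ?M S = emeasure ?P S" by (simp add: Rn_lebesgue_def)
  also have "\<dots> = ennreal ((1 / c) ^ n) * emeasure ?M {x \<in> Rn n. Rn_scale n (1 / c) x \<in> S}"
    using S by (simp add: emeasure_distr vimage_def Int_def conj_commute)
  finally have "ennreal (c ^ n) * emeasure ?M S
      = (ennreal (c ^ n) * ennreal ((1 / c) ^ n)) * emeasure ?M {x \<in> Rn n. Rn_scale n (1 / c) x \<in> S}"
    by (simp add: mult.assoc)
  also have "ennreal (c ^ n) * ennreal ((1 / c) ^ n) = 1"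
    using assms by (simp add: power_divide flip: ennreal_mult)
  finally show ?thesis by simp
qed

text \<open>
  The support function of the convex hull of the points \<open>\<plusminus> Y i\<close>.
\<close>

definition max_inner :: "nat \<Rightarrow> nat \<Rightarrow> (nat \<Rightarrow> nat \<Rightarrow> real) \<Rightarrow> (nat \<Rightarrow> real) \<Rightarrow> real" where
  "max_inner n N Y z = Max ((\<lambda>i. \<bar>\<Sum>j<n. Y i j * z j\<bar>) ` {..<N})"

lemma max_inner_ge: "i < N \<Longrightarrow> \<bar>\<Sum>j<n. Y i j * z j\<bar> \<le> max_inner n N Y z"
  unfolding max_inner_def by (intro Max_ge) auto

lemma max_inner_attained:
  assumes "0 < N" shows "\<exists>i<N. max_inner n N Y z = \<bar>\<Sum>j<n. Y i j * z j\<bar>"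
proof -
  have "max_inner n N Y z \<in> (\<lambda>i. \<bar>\<Sum>j<n. Y i j * z j\<bar>) ` {..<N}"
    unfolding max_inner_def using assms by (intro Max_in) auto
  then show ?thesis by auto
qed

lemma max_inner_nonneg: "0 < N \<Longrightarrow> 0 \<le> max_inner n N Y z"
  using max_inner_attained[of N n Y z] by auto

text \<open>
  The greedy proof of Maurey's approximation lemma. Put \<open>h z = s * max_inner n N Y z + r * \<bar>z\<bar>\<close>, the
  support function of the convex hull of the points \<open>\<plusminus> s * Y i\<close> enlarged by a ball of radius \<open>r\<close>.
  If the error after \<open>t\<close> steps is \<open>R\<close>, one adds the vertex that maximises the inner product with
  \<open>R\<close>; the hypothesis on \<open>x\<close> then says that the cross term in the new squared error is at most
  \<open>2 * r * \<bar>R\<bar>\<close>. No separation theorem is involved: the hypothesis is used only for the integer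
  vectors \<open>R\<close> that occur as errors, which is why a finite set of slabs is enough to define the body.
\<close>

lemma greedy_approximation:
  fixes x :: "nat \<Rightarrow> real" and Y :: "nat \<Rightarrow> nat \<Rightarrow> real" and s :: nat
  assumes N: "0 < N" and Y: "\<And>i j. i < N \<Longrightarrow> j < n \<Longrightarrow> Y i j \<in> {-1, 1}"
    and x: "\<And>j. j < n \<Longrightarrow> x j \<in> \<int>" "\<And>j. j < n \<Longrightarrow> \<bar>x j\<bar> + real s \<le> b"
    and dual: "\<And>z. (\<And>j. j < n \<Longrightarrow> z j \<in> \<int> \<and> \<bar>z j\<bar> \<le> real T * b) \<Longrightarrow>
       (\<Sum>j<n. z j * x j) \<le> real s * max_inner n N Y z + r * L2_set z {..<n}"
    and r: "0 \<le> r"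
  shows "t \<le> T \<Longrightarrow> \<exists>m :: nat \<Rightarrow> int. (\<Sum>i<N. \<bar>m i\<bar>) \<le> int t \<and>
     L2_set (\<lambda>j. real t * x j - real s * (\<Sum>i<N. of_int (m i) * Y i j)) {..<n} \<le> r * real t + sqrt (real n * real t) * b"
proof (induction t)
  case 0
  show ?case by (intro exI[of _ "\<lambda>_. 0"]) (auto simp: L2_set_def)
next
  case (Suc t)
  then obtain m :: "nat \<Rightarrow> int" where m: "(\<Sum>i<N. \<bar>m i\<bar>) \<le> int t"
    "L2_set (\<lambda>j. real t * x j - real s * (\<Sum>i<N. of_int (m i) * Y i j)) {..<n} \<le> r * real t + sqrt (real n * real t) * b"
    by auto
  define R where "R j = real t * x j - real s * (\<Sum>i<N. of_int (m i) * Y i j)" for j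
  have b: "0 \<le> b" if "0 < n" using x(2)[OF that] by linarith
  have Rb: "R j \<in> \<int> \<and> \<bar>R j\<bar> \<le> real T * b" if j: "j < n" for j
  proof
    have "Y i j \<in> \<int>" if "i < N" for i using Y[OF that j] by auto
    then show "R j \<in> \<int>" unfolding R_def using x(1)[OF j]
      by (intro Ints_diff Ints_mult Ints_sum) auto
    have Y1: "\<bar>Y i j\<bar> = 1" if "i < N" for i using Y[OF that j] by auto
    have "\<bar>\<Sum>i<N. of_int (m i) * Y i j\<bar> \<le> (\<Sum>i<N. \<bar>of_int (m i) * Y i j\<bar>)" by (rule sum_abs)
    also have "\<dots> = of_int (\<Sum>i<N. \<bar>m i\<bar>)" by (simp add: abs_mult Y1)
    also have "\<dots> \<le> real t" using m(1) by linarith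
    finally have "real s * \<bar>\<Sum>i<N. of_int (m i) * Y i j\<bar> \<le> real s * real t" by (intro mult_left_mono) auto
    then have "\<bar>R j\<bar> \<le> real t * \<bar>x j\<bar> + real s * real t"
      unfolding R_def using abs_triangle_ineq4[of "real t * x j" "real s * (\<Sum>i<N. of_int (m i) * Y i j)"]
      by (simp add: abs_mult)
    also have "\<dots> = real t * (\<bar>x j\<bar> + real s)" by (simp add: algebra_simps)
    also have "\<dots> \<le> real T * b" using x(2)[OF j] b j Suc.prems by (intro mult_mono) auto
    finally show "\<bar>R j\<bar> \<le> real T * b" .
  qed
  obtain i where i: "i < N" "max_inner n N Y R = \<bar>\<Sum>j<n. Y i j * R j\<bar>"
    using max_inner_attained[OF N] by blast
  define e :: int where "e = (if 0 \<le> (\<Sum>j<n. Y i j * R j) then 1 else -1)"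
  have e: "\<bar>e\<bar> = 1" "of_int e * (\<Sum>j<n. Y i j * R j) = max_inner n N Y R" by (auto simp: e_def i(2))
  define w where "w j = x j - real s * (of_int e * Y i j)" for j
  define m' where "m' = m(i := m i + e)"
  have new: "real (Suc t) * x j - real s * (\<Sum>i<N. of_int (m' i) * Y i j) = R j + w j" for j
  proof -
    have "(\<Sum>k<N. of_int (m' k) * Y k j) = (\<Sum>k<N. of_int (m k) * Y k j + (if k = i then of_int e * Y i j else 0))"
      by (intro sum.cong) (auto simp: m'_def algebra_simps)
    also have "\<dots> = (\<Sum>k<N. of_int (m k) * Y k j) + of_int e * Y i j"
      using i(1) by (simp add: sum.distrib)
    finally show ?thesis by (simp add: R_def w_def algebra_simps)
  qed
  have "(\<Sum>k<N. \<bar>m' k\<bar>) \<le> (\<Sum>k<N. \<bar>m k\<bar> + (if k = i then 1 else 0))"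
    using e(1) by (intro sum_mono) (auto simp: m'_def)
  also have "\<dots> = (\<Sum>k<N. \<bar>m k\<bar>) + 1" using i(1) by (simp add: sum.distrib)
  finally have m'1: "(\<Sum>k<N. \<bar>m' k\<bar>) \<le> int (Suc t)" using m(1) by simp
  let ?R = "L2_set R {..<n}"
  have cross: "(\<Sum>j<n. R j * w j) \<le> r * ?R"
  proof -
    have "(\<Sum>j<n. R j * w j) = (\<Sum>j<n. R j * x j) - real s * (of_int e * (\<Sum>j<n. Y i j * R j))"
      by (simp add: w_def algebra_simps sum_subtractf sum_distrib_left)
    also have "\<dots> \<le> r * ?R" unfolding e(2) using dual[of R] Rb by simp
    finally show ?thesis .
  qed
  have w2: "(\<Sum>j<n. (w j)\<^sup>2) \<le> real n * b\<^sup>2"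
  proof -
    have "(w j)\<^sup>2 \<le> b\<^sup>2" if j: "j < n" for j
    proof -
      have "\<bar>real s * (of_int e * Y i j)\<bar> = real s" using Y[OF i(1) j] by (auto simp: e_def abs_mult)
      then have "\<bar>w j\<bar> \<le> \<bar>b\<bar>" unfolding w_def using x(2)[OF j] by linarith
      then show ?thesis by (simp add: abs_le_square_iff)
    qed
    then have "(\<Sum>j<n. (w j)\<^sup>2) \<le> (\<Sum>j<n. b\<^sup>2)" by (intro sum_mono) auto
    then show ?thesis by simp
  qed
  have "L2_set (\<lambda>j. R j + w j) {..<n} \<le> r * real (Suc t) + sqrt (real n * real (Suc t)) * b"
  proof -
    let ?q = "sqrt (real n * real t) * b" and ?q' = "sqrt (real n * real (Suc t)) * b"
    have nb: "0 \<le> real n * b" using b by (cases n) auto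
    have q: "0 \<le> ?q" "?q \<le> ?q'"
    proof -
      show "0 \<le> ?q" using b by (cases n) auto
      show "?q \<le> ?q'" using b by (cases n) (auto intro!: mult_right_mono mult_left_mono)
    qed
    have qq: "?q\<^sup>2 + real n * b\<^sup>2 = ?q'\<^sup>2" by (simp add: power_mult_distrib algebra_simps)
    have R: "0 \<le> ?R" "?R \<le> r * real t + ?q" using m(2) unfolding R_def[abs_def] by (auto simp: L2_set_nonneg)
    have "(\<Sum>j<n. (R j + w j)\<^sup>2) = ?R\<^sup>2 + 2 * (\<Sum>j<n. R j * w j) + (\<Sum>j<n. (w j)\<^sup>2)"
      by (simp add: L2_set_def sum_nonneg power2_sum sum.distrib sum_distrib_left algebra_simps)
    also have "\<dots> \<le> ?R\<^sup>2 + 2 * (r * ?R) + real n * b\<^sup>2" using cross w2 by simp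
    also have "\<dots> \<le> (?R + r)\<^sup>2 + real n * b\<^sup>2" by (simp add: power2_sum)
    also have "\<dots> \<le> (r * real (Suc t) + ?q)\<^sup>2 + real n * b\<^sup>2"
      using R r by (intro add_right_mono power_mono) (auto simp: algebra_simps)
    also have "\<dots> = (r * real (Suc t))\<^sup>2 + 2 * (r * real (Suc t)) * ?q + ?q'\<^sup>2"
      unfolding qq[symmetric] by (simp add: power2_sum)
    also have "\<dots> \<le> (r * real (Suc t))\<^sup>2 + 2 * (r * real (Suc t)) * ?q' + ?q'\<^sup>2"
      using q r by (intro add_right_mono add_left_mono mult_left_mono) auto
    also have "\<dots> = (r * real (Suc t) + ?q')\<^sup>2" by (simp add: power2_sum)
    finally have "sqrt (\<Sum>j<n. (R j + w j)\<^sup>2) \<le> sqrt ((r * real (Suc t) + ?q')\<^sup>2)"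
      by (rule real_sqrt_le_mono)
    moreover have "0 \<le> r * real (Suc t) + ?q'" using q r by (intro add_nonneg_nonneg) auto
    ultimately show ?thesis unfolding L2_set_def by simp
  qed
  then show ?case using m'1 by (intro exI[of _ m']) (simp only: new simp_thms)
qed

text \<open>
  A point of the intersection of slabs is within \<open>9 * sqrt n\<close> of a point
  \<open>(s / n) * (\<Sum>i. m i * Y i)\<close> with integers \<open>m i\<close> satisfying \<open>(\<Sum>i. \<bar>m i\<bar>) \<le> n\<close>: round it to an
  integer point, which costs \<open>sqrt n\<close>, and run \<open>n\<close> greedy steps. Each step moves by at most
  \<open>6 * n\<close>, so after division by \<open>n\<close> the error is \<open>2 * sqrt n + 6 * sqrt n\<close>. The order of the greedy
  choices does not matter, hence there are only exponentially many centres, and balls of radius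
  \<open>9 * sqrt n\<close> have exponentially bounded volume.
\<close>

lemma slab_body_emeasure_le:
  fixes Y :: "nat \<Rightarrow> nat \<Rightarrow> real" and n B :: nat
  assumes n: "1 \<le> n" and B: "1 \<le> B" and Y: "\<And>i j. i < B * n \<Longrightarrow> j < n \<Longrightarrow> Y i j \<in> {-1, 1}"
  defines "s \<equiv> nat \<lceil>sqrt (real n)\<rceil>"
  defines "Z \<equiv> {..<n} \<rightarrow>\<^sub>E real_of_int ` {- int (6 * n\<^sup>2)..int (6 * n\<^sup>2)}"
  assumes A: "A \<subseteq> {x \<in> Rn n. \<forall>z\<in>Z. Rn_inner n x z \<le> real s * max_inner n (B * n) Y z + sqrt (real n) * Rn_norm n z}"
  shows "emeasure (Rn_lebesgue n) A \<le> ennreal ((2 * 3 ^ B * exp 81 * sqrt pi) ^ n)"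
proof -
  define N where "N = B * n"
  define r where "r = sqrt (real n)"
  have N: "0 < N" using n B by (simp add: N_def)
  have r: "1 \<le> r" "r\<^sup>2 = real n" using n by (auto simp: r_def)
  have s: "r \<le> real s" "real s \<le> r + 1" using r unfolding s_def r_def[symmetric] by linarith+
  have rn: "r \<le> real n" using r self_le_power[of r 2] by simp
  define Q where "Q = {m \<in> {..<N} \<rightarrow>\<^sub>E (UNIV :: int set). (\<Sum>i<N. \<bar>m i\<bar>) \<le> int n}"
  define ctr where "ctr m j = real s / real n * (\<Sum>i<N. of_int (m i) * Y i j)" for m :: "nat \<Rightarrow> int" and j
  define Bl where "Bl m = {x \<in> Rn n. (\<Sum>j<n. (x j - ctr m j)\<^sup>2) \<le> 81 * real n}" for m
  have cover: "A \<subseteq> (\<Union>m\<in>Q. Bl m)"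
  proof
    fix x assume xA: "x \<in> A"
    then have xR: "x \<in> Rn n" and xZ: "\<And>z. z \<in> Z \<Longrightarrow> Rn_inner n x z \<le> real s * max_inner n N Y z + r * Rn_norm n z"
      using A by (auto simp: N_def r_def)
    define y where "y j = real_of_int \<lfloor>x j\<rfloor>" for j
    have xy: "\<bar>x j - y j\<bar> \<le> 1" for j unfolding y_def by linarith
    have L2xy: "L2_set (\<lambda>j. x j - y j) {..<n} \<le> r"
    proof -
      have "(\<Sum>j<n. (x j - y j)\<^sup>2) \<le> (\<Sum>j<n. 1)"
        using xy by (intro sum_mono) (simp add: abs_square_le_1)
      then show ?thesis unfolding L2_set_def r_def by simp
    qed
    \<comment> \<open>Testing against the coordinate vectors bounds the coordinates of \<open>x\<close>.\<close>
    have xb: "\<bar>x j\<bar> \<le> real s + r" if j: "j < n" for j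
    proof -
      have "\<sigma> * x j \<le> real s + r" if \<sigma>: "\<sigma> \<in> {-1, 1::real}" for \<sigma>
      proof -
        define z where "z = (\<lambda>k\<in>{..<n}. if k = j then \<sigma> else 0)"
        have eq: "(\<Sum>k<n. f k * z k) = f j * \<sigma>" for f :: "nat \<Rightarrow> real"
        proof -
          have "(\<Sum>k<n. f k * z k) = (\<Sum>k<n. if k = j then f j * \<sigma> else 0)"
            by (intro sum.cong) (auto simp: z_def)
          then show ?thesis using j by simp
        qed
        have "1 \<le> n\<^sup>2" using n by (rule one_le_power)
        then have six: "int (6 * n\<^sup>2) \<ge> 1" by linarith
        have "z \<in> Z"
          unfolding Z_def z_def
        proof (intro restrict_PiE_iff[THEN iffD2] ballI)
          fix k
          have "(if k = j then \<sigma> else 0) = real_of_int (if k = j then (if \<sigma> = 1 then 1 else -1) else 0)" using \<sigma> by auto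
          then show "(if k = j then \<sigma> else 0) \<in> real_of_int ` {- int (6 * n\<^sup>2)..int (6 * n\<^sup>2)}"
            by (rule image_eqI) (use six in auto)
        qed
        then have "Rn_inner n x z \<le> real s * max_inner n N Y z + r * Rn_norm n z" by (rule xZ)
        moreover have "Rn_inner n x z = \<sigma> * x j" by (simp add: Rn_inner_def eq)
        moreover have "max_inner n N Y z = 1"
        proof -
          obtain i where "i < N" "max_inner n N Y z = \<bar>\<Sum>k<n. Y i k * z k\<bar>" using max_inner_attained[OF N] by blast
          then show ?thesis using Y[of i j] j \<sigma> by (auto simp: eq N_def)
        qed
        moreover have "Rn_norm n z = 1"
        proof -
          have "(\<Sum>k<n. (z k)\<^sup>2) = (\<Sum>k<n. z k * z k)" by (simp add: power2_eq_square)
          also have "\<dots> = 1" unfolding eq using j \<sigma> by (auto simp: z_def)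
          finally show ?thesis by (simp add: Rn_norm_def L2_set_def)
        qed
        ultimately show ?thesis by simp
      qed
      from this[of 1] this[of "-1"] show ?thesis by (simp add: abs_le_iff)
    qed
    have yb: "\<bar>y j\<bar> + real s \<le> 6 * r" if j: "j < n" for j
      using xb[OF j] xy[of j] s r by linarith
    have "\<exists>m :: nat \<Rightarrow> int. (\<Sum>i<N. \<bar>m i\<bar>) \<le> int n \<and>
       L2_set (\<lambda>j. real n * y j - real s * (\<Sum>i<N. of_int (m i) * Y i j)) {..<n} \<le> (2 * r) * real n + sqrt (real n * real n) * (6 * r)"
    proof (rule greedy_approximation[where T=n])
      show "0 < N" by (rule N)
      show "Y i j \<in> {-1, 1}" if "i < N" "j < n" for i j using Y that by (simp add: N_def)
      show "y j \<in> \<int>" for j by (simp add: y_def)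
      show "\<bar>y j\<bar> + real s \<le> 6 * r" if "j < n" for j by (rule yb[OF that])
      fix z assume z: "\<And>j. j < n \<Longrightarrow> z j \<in> \<int> \<and> \<bar>z j\<bar> \<le> real n * (6 * r)"
      let ?z = "restrict z {..<n}"
      have nr: "real n * r \<le> real n * real n"
        using rn by (intro mult_left_mono) auto
      have zb: "\<bar>z j\<bar> \<le> real (6 * n\<^sup>2)" if "j < n" for j
      proof -
        have "\<bar>z j\<bar> \<le> 6 * (real n * r)" using z[OF that] by simp
        also have "\<dots> \<le> 6 * (real n * real n)" using nr by simp
        finally show ?thesis by (simp add: power2_eq_square)
      qed
      have "?z \<in> Z"
        unfolding Z_def
      proof (intro restrict_PiE_iff[THEN iffD2] ballI)
        fix j assume j: "j \<in> {..<n}"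
        then obtain k where k: "z j = of_int k" using z by (auto elim: Ints_cases)
        then have "\<bar>real_of_int k\<bar> \<le> real_of_int (int (6 * n\<^sup>2))" using zb[of j] j by simp
        then have "\<bar>k\<bar> \<le> int (6 * n\<^sup>2)" by linarith
        then show "z j \<in> real_of_int ` {- int (6 * n\<^sup>2)..int (6 * n\<^sup>2)}" using k by (auto simp: abs_le_iff)
      qed
      then have *: "Rn_inner n x ?z \<le> real s * max_inner n N Y ?z + r * Rn_norm n ?z" by (rule xZ)
      have mz: "max_inner n N Y ?z = max_inner n N Y z"
        unfolding max_inner_def by (intro arg_cong[where f=Max] image_cong) auto
      have nz: "Rn_norm n ?z = L2_set z {..<n}" unfolding Rn_norm_def by (rule L2_set_cong) auto
      have "(\<Sum>j<n. z j * y j) = Rn_inner n x ?z - (\<Sum>j<n. (x j - y j) * z j)"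
        by (simp add: Rn_inner_def sum_subtractf[symmetric] algebra_simps)
      moreover have "- (\<Sum>j<n. (x j - y j) * z j) \<le> (\<Sum>j<n. \<bar>x j - y j\<bar> * \<bar>z j\<bar>)"
        unfolding sum_negf[symmetric] by (intro sum_mono) (metis abs_ge_minus_self abs_mult)
      moreover have "\<dots> \<le> L2_set (\<lambda>j. x j - y j) {..<n} * L2_set z {..<n}" by (rule L2_set_mult_ineq)
      moreover have "\<dots> \<le> r * L2_set z {..<n}" using L2xy by (intro mult_right_mono) (auto simp: L2_set_nonneg)
      ultimately have "(\<Sum>j<n. z j * y j) \<le> Rn_inner n x ?z + r * L2_set z {..<n}" by linarith
      then show "(\<Sum>j<n. z j * y j) \<le> real s * max_inner n N Y z + (2 * r) * L2_set z {..<n}"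
        using * unfolding mz nz by linarith
    qed (use r in auto)
    then obtain m0 :: "nat \<Rightarrow> int" where m0: "(\<Sum>i<N. \<bar>m0 i\<bar>) \<le> int n"
       "L2_set (\<lambda>j. real n * y j - real s * (\<Sum>i<N. of_int (m0 i) * Y i j)) {..<n} \<le> 8 * r * real n" by (auto simp: algebra_simps)
    define m where "m = restrict m0 {..<N}"
    have mQ: "m \<in> Q" using m0 by (simp add: Q_def m_def)
    have cm: "ctr m j = real s / real n * (\<Sum>i<N. of_int (m0 i) * Y i j)" for j
      unfolding ctr_def m_def by (intro arg_cong2[where f="(*)"] sum.cong) auto
    have "real n * L2_set (\<lambda>j. y j - ctr m j) {..<n} = L2_set (\<lambda>j. real n * (y j - ctr m j)) {..<n}"
      by (rule L2_set_right_distrib) simp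
    also have "\<dots> \<le> 8 * r * real n"
      using m0(2) n unfolding cm by (simp add: right_diff_distrib)
    finally have "L2_set (\<lambda>j. y j - ctr m j) {..<n} \<le> 8 * r" using n by simp
    then have "L2_set (\<lambda>j. x j - ctr m j) {..<n} \<le> 9 * r"
      using L2_set_triangle_ineq[of "\<lambda>j. x j - y j" "\<lambda>j. y j - ctr m j" "{..<n}"] L2xy by simp
    then have "(L2_set (\<lambda>j. x j - ctr m j) {..<n})\<^sup>2 \<le> (9 * r)\<^sup>2" by (intro power_mono) (auto simp: L2_set_nonneg)
    then have "(\<Sum>j<n. (x j - ctr m j)\<^sup>2) \<le> 81 * real n"
      using r(2) by (simp add: L2_set_def sum_nonneg power_mult_distrib)
    then show "x \<in> (\<Union>m\<in>Q. Bl m)" using mQ xR by (auto simp: Bl_def)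
  qed
  have Q: "finite Q" "card Q \<le> 2 ^ n * 3 ^ N"
    using card_int_vectors_l1_bounded[of "{..<N}" n] by (auto simp: Q_def)
  have Bl: "Bl m \<in> sets (Rn_lebesgue n)" for m
  proof -
    have "{x \<in> space (Rn_lebesgue n). (\<Sum>j<n. (x j - ctr m j)\<^sup>2) \<le> 81 * real n} \<in> sets (Rn_lebesgue n)"
      by measurable
    then show ?thesis by (simp add: Bl_def)
  qed
  have "emeasure (Rn_lebesgue n) A \<le> emeasure (Rn_lebesgue n) (\<Union>m\<in>Q. Bl m)"
    using cover Q Bl by (intro emeasure_mono) auto
  also have "\<dots> \<le> (\<Sum>m\<in>Q. emeasure (Rn_lebesgue n) (Bl m))"
    using Q Bl by (intro emeasure_subadditive_finite) auto
  also have "\<dots> \<le> (\<Sum>m\<in>Q. ennreal ((exp 81 * sqrt pi) ^ n))"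
    unfolding Bl_def by (intro sum_mono emeasure_Rn_ball_le)
  also have "\<dots> = ennreal (real (card Q) * (exp 81 * sqrt pi) ^ n)"
    by (simp add: ennreal_mult ennreal_of_nat_eq_real_of_nat)
  also have "\<dots> \<le> ennreal ((2 * 3 ^ B * exp 81 * sqrt pi) ^ n)"
  proof (rule ennreal_leI)
    have "real (card Q) \<le> real (2 ^ n * 3 ^ N)" using Q(2) by (rule of_nat_mono)
    also have "\<dots> = (2 * 3 ^ B) ^ n" by (simp add: N_def power_mult power_mult_distrib)
    finally have "real (card Q) * (exp 81 * sqrt pi) ^ n \<le> (2 * 3 ^ B) ^ n * (exp 81 * sqrt pi) ^ n"
      by (intro mult_right_mono) auto
    then show "real (card Q) * (exp 81 * sqrt pi) ^ n \<le> (2 * 3 ^ B * exp 81 * sqrt pi) ^ n"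
      by (simp add: power_mult_distrib mult.assoc)
  qed
  finally show ?thesis .
qed

text \<open>
  The \<open>n\<close>-th root of the volume bound for the intersection of slabs.
\<close>

definition body_const :: "nat \<Rightarrow> real" where
  "body_const B = 2 * 3 ^ B * exp 81 * sqrt pi"

lemma body_const_ge_1: "1 \<le> body_const B"
proof -
  have "1 \<le> sqrt pi" using pi_gt3 by simp
  moreover have "(1::real) \<le> 2 * 3 ^ B"
  proof -
    have "(1::real) \<le> 3 ^ B" by (rule one_le_power) simp
    then show ?thesis by linarith
  qed
  moreover have "(1::real) \<le> exp 81" by simp
  ultimately have "1 * 1 * 1 \<le> (2 * 3 ^ B) * exp 81 * sqrt pi"
    by (intro mult_mono) auto
  then show ?thesis by (simp add: body_const_def)
qed

lemma Rn_inner_scale_right: "Rn_inner n x (Rn_scale n a w) = a * Rn_inner n x w"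
  unfolding Rn_inner_def Rn_scale_def sum_distrib_left by (intro sum.cong refl) (simp add: mult_ac)

lemma abs_Rn_inner_le: "\<bar>Rn_inner n x z\<bar> \<le> Rn_norm n x * Rn_norm n z"
  unfolding Rn_inner_def Rn_norm_def
  by (rule order_trans[OF sum_abs]) (unfold abs_mult, rule L2_set_mult_ineq)

text \<open>
  The body is an \<open>\<ell>\<^sub>2\<^sub>p\<close> rounding of the intersection of slabs, rescaled to volume \<open>1\<close>. It lies inside
  the slabs, which bounds its volume from above and hence the scaling factor \<open>l\<close> from below by
  \<open>1 / body_const B\<close>. With \<open>p\<close> the number of slabs it contains half of their intersection, since
  \<open>p \<le> 4 ^ p\<close>; and that half contains all points whose support function estimates are half those
  of the hull of the \<open>\<plusminus> sqrt n * Y i\<close> plus a ball of radius \<open>sqrt n\<close>.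
\<close>

lemma exists_smooth_body:
  fixes Y :: "nat \<Rightarrow> nat \<Rightarrow> real" and n B :: nat
  assumes n: "1 \<le> n" and B: "1 \<le> B" and Y: "\<And>i j. i < B * n \<Longrightarrow> j < n \<Longrightarrow> Y i j \<in> {-1, 1}"
  shows "\<exists>D. convex_body n D \<and> infinitely_smooth n D \<and> Rn_symmetric n D \<and>
    D \<in> sets (Rn_lebesgue n) \<and> measure (Rn_lebesgue n) D = 1 \<and>
    (\<forall>x\<in>Rn n. (\<forall>z. \<bar>Rn_inner n x z\<bar> \<le> 1 / (2 * body_const B) * sqrt (real n) * (max_inner n (B * n) Y z + Rn_norm n z)) \<longrightarrow> x \<in> D)"
proof -
  define N where "N = B * n"
  define s where "s = nat \<lceil>sqrt (real n)\<rceil>"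
  define Z where "Z = {..<n} \<rightarrow>\<^sub>E real_of_int ` {- int (6 * n\<^sup>2)..int (6 * n\<^sup>2)}"
  define h where "h z = real s * max_inner n N Y z + sqrt (real n) * Rn_norm n z" for z
  have N: "0 < N" using n B by (simp add: N_def)
  have s: "sqrt (real n) \<le> real s" unfolding s_def by (rule of_nat_ceiling)
  have rn: "0 < sqrt (real n)" using n by simp
  have ZR: "z \<in> Rn n" if "z \<in> Z" for z using that by (auto simp: Z_def Rn_def PiE_iff)
  have finZ: "finite Z" unfolding Z_def by (intro finite_PiE) auto
  have Mz: "0 \<le> max_inner n N Y z" for z by (rule max_inner_nonneg[OF N])
  have hpos: "0 < h z" if "z \<in> Z" "z \<noteq> Rn_zero n" for z
    unfolding h_def using Rn_norm_pos[OF ZR[OF that(1)] that(2)] rn Mz[of z]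
    by (intro add_nonneg_pos mult_nonneg_nonneg mult_pos_pos) auto
  define W where "W = (\<lambda>z. Rn_scale n (1 / h z) z) ` (Z - {Rn_zero n})"
  have finW: "finite W" using finZ by (simp add: W_def)
  \<comment> \<open>The coordinate vectors belong to \<open>Z\<close>, so that \<open>W\<close> spans.\<close>
  have unit: "(\<lambda>k\<in>{..<n}. if k = j then 1 else 0) \<in> Z - {Rn_zero n}" if "j < n" for j
  proof
    have "1 \<le> n\<^sup>2" using n by (rule one_le_power)
    then have six: "1 \<le> int (6 * n\<^sup>2)" by linarith
    show "(\<lambda>k\<in>{..<n}. if k = j then 1 else 0) \<in> Z"
      unfolding Z_def
    proof (intro restrict_PiE_iff[THEN iffD2] ballI)
      fix k
      have "(if k = j then 1 else 0::real) = real_of_int (if k = j then 1 else 0)" by simp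
      then show "(if k = j then 1 else 0) \<in> real_of_int ` {- int (6 * n\<^sup>2)..int (6 * n\<^sup>2)}"
        by (rule image_eqI) (use six in auto)
    qed
    show "(\<lambda>k\<in>{..<n}. if k = j then 1 else 0) \<notin> {Rn_zero n}"
    proof
      assume "(\<lambda>k\<in>{..<n}. if k = j then 1 else 0) \<in> {Rn_zero n}"
      then have "(\<lambda>k\<in>{..<n}. if k = j then 1 else 0) j = Rn_zero n j" by (simp only: singleton_iff)
      then show False using that by (simp add: Rn_zero_def)
    qed
  qed
  define p where "p = card W"
  have p: "0 < p" using unit[of 0] n finW by (auto simp: p_def card_gt_0_iff W_def)
  let ?N = "power_sum n p W"
  have term_le: "\<bar>Rn_inner n x w\<bar> ^ (2 * p) \<le> ?N x" if "w \<in> W" for x w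
    using member_le_sum[OF that, of "\<lambda>w. Rn_inner n x w ^ (2 * p)"] finW
    by (simp add: power_sum_def power_even_abs)
  have pos: "0 < ?N x" if x: "x \<in> Rn n" "x \<noteq> Rn_zero n" for x
  proof -
    have "\<exists>j<n. x j \<noteq> 0"
    proof (rule ccontr)
      assume "\<not> ?thesis"
      then have "x = Rn_zero n" using x(1) by (auto simp: Rn_zero_def Rn_def PiE_iff extensional_def)
      then show False using x by simp
    qed
    then obtain j where j: "j < n" "x j \<noteq> 0" by blast
    let ?z = "\<lambda>k\<in>{..<n}. if k = j then 1 else (0::real)"
    have "Rn_inner n x ?z = (\<Sum>k<n. if k = j then x j else 0)"
      unfolding Rn_inner_def by (intro sum.cong refl) auto
    then have "Rn_inner n x ?z = x j" using j by simp
    moreover have "0 < h ?z" using unit[OF j(1)] by (intro hpos) (simp_all only: Diff_iff singleton_iff not_False_eq_True simp_thms)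
    ultimately have "Rn_inner n x (Rn_scale n (1 / h ?z) ?z) \<noteq> 0"
      using j by (simp add: Rn_inner_scale_right)
    moreover have "Rn_scale n (1 / h ?z) ?z \<in> W" unfolding W_def by (rule imageI[OF unit[OF j(1)]])
    moreover from calculation have "0 < \<bar>Rn_inner n x (Rn_scale n (1 / h ?z) ?z)\<bar> ^ (2 * p)" by (intro zero_less_power) simp
    ultimately show ?thesis using term_le[of "Rn_scale n (1 / h ?z) ?z" x] by linarith
  qed
  define D1 where "D1 = {x \<in> Rn n. ?N x \<le> 1}"
  have meas: "{x \<in> Rn n. ?N x \<le> a} \<in> sets (Rn_lebesgue n)" for a
  proof -
    have "{x \<in> space (Rn_lebesgue n). ?N x \<le> a} \<in> sets (Rn_lebesgue n)"
      unfolding power_sum_def Rn_inner_def by measurable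
    then show ?thesis by simp
  qed
  have small_in: "?N x \<le> \<mu> ^ (2 * p)"
    if \<mu>: "0 \<le> \<mu>" and x: "\<And>z. \<bar>Rn_inner n x z\<bar> \<le> \<mu> / 2 * h z" for x \<mu>
  proof -
    have "?N x \<le> (\<Sum>w\<in>W. (\<mu> / 2) ^ (2 * p))"
      unfolding power_sum_def
    proof (rule sum_mono)
      fix w assume "w \<in> W"
      then obtain z where z: "z \<in> Z" "z \<noteq> Rn_zero n" "w = Rn_scale n (1 / h z) z" by (auto simp: W_def)
      have hz: "0 < h z" by (rule hpos[OF z(1,2)])
      have "\<bar>Rn_inner n x w\<bar> = \<bar>Rn_inner n x z\<bar> / h z" using hz by (simp add: z(3) Rn_inner_scale_right)
      also have "\<dots> \<le> \<mu> / 2" using x[of z] hz by (simp add: pos_divide_le_eq)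
      finally have "\<bar>Rn_inner n x w\<bar> ^ (2 * p) \<le> (\<mu> / 2) ^ (2 * p)" by (intro power_mono) auto
      then show "Rn_inner n x w ^ (2 * p) \<le> (\<mu> / 2) ^ (2 * p)" by (simp add: power_even_abs)
    qed
    also have "\<dots> = \<mu> ^ (2 * p) * (real p / 4 ^ p)"
      by (simp add: p_def power_divide power_mult)
    also have "\<dots> \<le> \<mu> ^ (2 * p) * 1"
    proof (rule mult_left_mono)
      have "p < 4 ^ p" by (rule power_gt_expt) simp
      then have "real p < real (4 ^ p)" by (simp only: of_nat_less_iff)
      then show "real p / 4 ^ p \<le> 1" by simp
    qed (use \<mu> in simp)
    finally show ?thesis by simp
  qed
  have upper: "emeasure (Rn_lebesgue n) D1 \<le> ennreal (body_const B ^ n)"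
    unfolding body_const_def
  proof (rule slab_body_emeasure_le[OF n B Y])
    show "D1 \<subseteq> {x \<in> Rn n. \<forall>z\<in>{..<n} \<rightarrow>\<^sub>E real_of_int ` {- int (6 * n\<^sup>2)..int (6 * n\<^sup>2)}.
       Rn_inner n x z \<le> real (nat \<lceil>sqrt (real n)\<rceil>) * max_inner n (B * n) Y z + sqrt (real n) * Rn_norm n z}"
      unfolding Z_def[symmetric] s_def[symmetric] N_def[symmetric] h_def[symmetric]
    proof (intro subsetI CollectI conjI ballI)
      fix x assume x: "x \<in> D1"
      then show "x \<in> Rn n" by (simp add: D1_def)
      fix z assume z: "z \<in> Z"
      show "Rn_inner n x z \<le> h z"
      proof (cases "z = Rn_zero n")
        case True
        have "Rn_inner n x (Rn_zero n) = 0" by (simp add: Rn_inner_def Rn_zero_def)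
        moreover have "0 \<le> h z" using Mz[of z] by (simp add: h_def Rn_norm_def)
        ultimately show ?thesis using True by simp
      next
        case False
        have hz: "0 < h z" by (rule hpos[OF z False])
        have "\<bar>Rn_inner n x (Rn_scale n (1 / h z) z)\<bar> ^ (2 * p) \<le> 1"
          using term_le[of "Rn_scale n (1 / h z) z" x] x z False by (auto simp: W_def D1_def)
        then have "\<bar>Rn_inner n x (Rn_scale n (1 / h z) z)\<bar> \<le> 1"
          using power_le_one_iff[of "\<bar>Rn_inner n x (Rn_scale n (1 / h z) z)\<bar>" "2 * p"] p by simp
        then show ?thesis using hz by (simp add: Rn_inner_scale_right abs_le_iff pos_divide_le_eq)
      qed
    qed
  qed
  have lower: "1 \<le> emeasure (Rn_lebesgue n) D1"
  proof -
    let ?Q = "{..<n} \<rightarrow>\<^sub>E {-1/2..1/2::real}"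
    have "emeasure (Rn_lebesgue n) ?Q = (\<Prod>i<n. emeasure lborel {-1/2..1/2::real})"
      unfolding Rn_lebesgue_def by (rule Rn_prod.emeasure_PiM) auto
    also have "\<dots> = 1" by simp
    finally have "1 = emeasure (Rn_lebesgue n) ?Q" ..
    also have "\<dots> \<le> emeasure (Rn_lebesgue n) D1"
    proof (rule emeasure_mono)
      show "D1 \<in> sets (Rn_lebesgue n)" unfolding D1_def by (rule meas)
      show "?Q \<subseteq> D1"
      proof
        fix x assume x: "x \<in> ?Q"
        have "(x i)\<^sup>2 \<le> (1/2)\<^sup>2" if "i < n" for i
        proof -
          have "x i \<in> {-1/2..1/2}" using x that by (auto simp: PiE_iff)
          then have "\<bar>x i\<bar> \<le> \<bar>1/2\<bar>" by (auto simp: abs_le_iff)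
          then show ?thesis by (simp only: abs_le_square_iff)
        qed
        then have "(\<Sum>i<n. (x i)\<^sup>2) \<le> (\<Sum>i<n. (1/2)\<^sup>2)" by (intro sum_mono) auto
        also have "\<dots> = (sqrt (real n) / 2)\<^sup>2" by (simp add: power_divide)
        finally have nx: "Rn_norm n x \<le> sqrt (real n) / 2"
          unfolding Rn_norm_def L2_set_def by (intro real_le_lsqrt) (auto intro: sum_nonneg)
        have "\<bar>Rn_inner n x z\<bar> \<le> 1 / 2 * h z" for z
        proof -
          have "\<bar>Rn_inner n x z\<bar> \<le> Rn_norm n x * Rn_norm n z" by (rule abs_Rn_inner_le)
          also have "\<dots> \<le> sqrt (real n) / 2 * Rn_norm n z" using nx by (intro mult_right_mono) (auto simp: Rn_norm_def)
          also have "\<dots> \<le> 1 / 2 * h z" using Mz[of z] by (simp add: h_def)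
          finally show ?thesis .
        qed
        then have "?N x \<le> 1 ^ (2 * p)" by (intro small_in) auto
        then show "x \<in> D1" using x by (auto simp: D1_def Rn_def PiE_iff)
      qed
    qed
    finally show ?thesis .
  qed
  define v where "v = measure (Rn_lebesgue n) D1"
  have fin: "emeasure (Rn_lebesgue n) D1 \<noteq> \<infinity>" using upper by (auto simp: top_unique)
  have ev: "emeasure (Rn_lebesgue n) D1 = ennreal v"
    unfolding v_def by (rule emeasure_eq_ennreal_measure) (use fin in auto)
  have v: "1 \<le> v" "v \<le> body_const B ^ n"
  proof -
    have "0 \<le> v" by (simp add: v_def)
    then show "1 \<le> v" using lower unfolding ev ennreal_1[symmetric] by (simp only: ennreal_le_iff)
    show "v \<le> body_const B ^ n" using upper body_const_ge_1[of B] unfolding ev by (simp add: ennreal_le_iff)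
  qed
  define l where "l = 1 / root n v"
  have l: "0 < l" "l ^ n = 1 / v" using v n by (auto simp: l_def power_one_over)
  have l1: "1 / body_const B \<le> l"
  proof -
    have "root n v \<le> root n (body_const B ^ n)" using v n by (intro real_root_le_mono) auto
    also have "\<dots> = body_const B" using n body_const_ge_1[of B] by (intro real_root_power_cancel) auto
    finally show ?thesis unfolding l_def using v n body_const_ge_1[of B] by (intro divide_left_mono mult_pos_pos) auto
  qed
  define D where "D = {x \<in> Rn n. ?N x \<le> l ^ (2 * p)}"
  have D_eq: "D = {x \<in> Rn n. Rn_scale n (1 / l) x \<in> D1}"
    using l by (auto simp: D_def D1_def power_sum_scale power_divide pos_divide_le_eq)
  have "emeasure (Rn_lebesgue n) D = ennreal (l ^ n) * ennreal v"
    unfolding D_eq ev[symmetric] by (rule emeasure_Rn_scale_vimage[OF l(1)]) (unfold D1_def, rule meas)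
  also have "\<dots> = 1" using l v by (simp flip: ennreal_mult)
  finally have m1: "measure (Rn_lebesgue n) D = 1" by (simp add: measure_def)
  show ?thesis
  proof (intro exI[of _ D] conjI ballI impI)
    have "0 < l ^ (2 * p)" using l by simp
    from power_sum_sublevel_smooth_convex_body[OF finW p this pos]
    show "convex_body n D" "infinitely_smooth n D" "Rn_symmetric n D" by (simp_all add: D_def)
    show "D \<in> sets (Rn_lebesgue n)" unfolding D_def by (rule meas)
    show "measure (Rn_lebesgue n) D = 1" by (rule m1)
    fix x assume x: "x \<in> Rn n" and *: "\<forall>z. \<bar>Rn_inner n x z\<bar> \<le> 1 / (2 * body_const B) * sqrt (real n) * (max_inner n (B * n) Y z + Rn_norm n z)"
    have "\<bar>Rn_inner n x z\<bar> \<le> l / 2 * h z" for z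
    proof -
      have nn: "0 \<le> Rn_norm n z" by (simp add: Rn_norm_def)
      have "\<bar>Rn_inner n x z\<bar> \<le> (1 / body_const B) / 2 * (sqrt (real n) * max_inner n N Y z + sqrt (real n) * Rn_norm n z)"
        using *[rule_format, of z] by (simp add: N_def distrib_left)
      also have "\<dots> \<le> l / 2 * (sqrt (real n) * max_inner n N Y z + sqrt (real n) * Rn_norm n z)"
        using l1 Mz[of z] nn by (intro mult_right_mono divide_right_mono) auto
      also have "\<dots> \<le> l / 2 * h z"
        unfolding h_def using l s Mz[of z] by (intro mult_left_mono add_right_mono mult_right_mono) auto
      finally show ?thesis .
    qed
    then have "?N x \<le> l ^ (2 * p)" using l by (intro small_in) auto
    then show "x \<in> D" using x by (simp add: D_def)
  qed
qed

section \<open>Mellin transforms\<close>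

lemma has_bochner_integral_Gamma_scaled:
  fixes p c :: real
  assumes p: "0 < p" and c: "0 < c"
  shows "has_bochner_integral lborel (\<lambda>t. indicator {0<..} t *\<^sub>R (t powr (p - 1) * exp (- c * t))) (Gamma p * c powr (- p))"
proof -
  let ?f = "\<lambda>t::real. indicator {0<..} t *\<^sub>R (t powr (p - 1) * exp (- t))"
  have "((\<lambda>t. t powr (p - 1) / exp t) has_integral Gamma p) {0..}" by (rule Gamma_integral_real[OF p])
  then have "((\<lambda>t. if t \<in> {0..} then t powr (p - 1) / exp t else 0) has_integral Gamma p) UNIV"
    by (simp only: has_integral_restrict_UNIV)
  moreover have "(\<lambda>t. if t \<in> {0..} then t powr (p - 1) / exp t else 0) = ?f"
    by (auto simp: fun_eq_iff indicator_def exp_minus divide_inverse)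
  ultimately have hi: "(?f has_integral Gamma p) UNIV" by simp
  have "integral\<^sup>N lborel ?f = Gamma p"
    by (rule nn_integral_has_integral_lborel[OF _ _ hi]) (auto simp: indicator_def)
  then have "has_bochner_integral lborel ?f (Gamma p)"
    using p by (intro has_bochner_integral_nn_integral) (auto simp: indicator_def)
  then have "has_bochner_integral lborel (\<lambda>t. ?f (0 + c * t)) (Gamma p /\<^sub>R \<bar>c\<bar>)"
    using c by (subst (asm) lborel_has_bochner_integral_real_affine_iff[of c _ _ 0]) auto
  then have "has_bochner_integral lborel (\<lambda>t. c powr (1 - p) * ?f (0 + c * t)) (c powr (1 - p) * (Gamma p /\<^sub>R \<bar>c\<bar>))"
    by (rule has_bochner_integral_mult_right)
  moreover have "c powr (1 - p) * (Gamma p /\<^sub>R \<bar>c\<bar>) = Gamma p * c powr (- p)"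
  proof -
    have "c powr (1 - p) = c * c powr (- p)" using c powr_add[of c 1 "- p"] by simp
    then show ?thesis using c by simp
  qed
  moreover have "c powr (1 - p) * ?f (0 + c * t) = indicator {0<..} t *\<^sub>R (t powr (p - 1) * exp (- c * t))" for t
  proof (cases "0 < t")
    case True
    then have "c powr (1 - p) * (c * t) powr (p - 1) = t powr (p - 1)"
      using c by (simp add: powr_mult powr_add[symmetric] flip: mult.assoc)
    then show ?thesis using True c by (simp flip: mult.assoc)
  next
    case False
    then show ?thesis using c by (simp add: zero_less_mult_iff)
  qed
  ultimately show ?thesis by (simp only:)
qed

lemma Gamma_scaled_set_integral:
  fixes p c :: real
  assumes "0 < p" "0 < c"
  shows "set_integrable lborel {0<..} (\<lambda>t. t powr (p - 1) * exp (- c * t))"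
    "(LINT t:{0<..}|lborel. t powr (p - 1) * exp (- c * t)) = Gamma p * c powr (- p)"
  using has_bochner_integral_Gamma_scaled[OF assms]
  unfolding set_integrable_def set_lebesgue_integral_def
  by (auto simp: has_bochner_integral_iff)

lemma measurable_on_positive:
  assumes "continuous_on {0<..} (f :: real \<Rightarrow> 'a :: real_normed_vector)"
  shows "(\<lambda>t. indicator {0<..} t *\<^sub>R f t) \<in> borel_measurable lborel"
  using borel_measurable_continuous_on_indicator[OF _ assms] by simp

text \<open>
  Exponential decay is the one growth condition that both Mellin integrals below satisfy: it covers
  Gaussian weights on the frequency side and Gaussian densities on the side of the sections.
\<close>

lemma set_integrable_powr_times_exp_decay:
  fixes f :: "real \<Rightarrow> real"
  assumes f: "continuous_on {0<..} f" "\<And>t. 0 < t \<Longrightarrow> \<bar>f t\<bar> \<le> C * exp (- t)" and p: "-1 < p"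
  shows "set_integrable lborel {0<..} (\<lambda>t. t powr p * f t)"
proof (rule set_integrable_bound)
  show "set_integrable lborel {0<..} (\<lambda>t. C * (t powr p * exp (- t)))"
    using Gamma_scaled_set_integral(1)[of "p + 1" 1] p by (intro set_integrable_mult_right) simp
  show "set_borel_measurable lborel {0<..} (\<lambda>t. t powr p * f t)"
    unfolding set_borel_measurable_def
    by (intro measurable_on_positive continuous_intros f) auto
  show "AE t in lborel. t \<in> {0<..} \<longrightarrow> norm (t powr p * f t) \<le> norm (C * (t powr p * exp (- t)))"
  proof (intro AE_I2 impI)
    fix t :: real assume "t \<in> {0<..}"
    then have "t powr p * \<bar>f t\<bar> \<le> t powr p * (C * exp (- t))" by (intro mult_left_mono f) auto
    also have "\<dots> \<le> norm (C * (t powr p * exp (- t)))"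
      by (simp only: mult.left_commute[of C] real_norm_def abs_ge_self)
    finally show "norm (t powr p * f t) \<le> norm (C * (t powr p * exp (- t)))"
      by (simp add: abs_mult)
  qed
qed

text \<open>
  The Mellin transform, with its argument shifted by one.
\<close>

definition mellin :: "(real \<Rightarrow> real) \<Rightarrow> complex \<Rightarrow> complex" where
  "mellin f z = (LINT t:{0<..}|lborel. of_real t powr z * of_real (f t))"

lemma of_real_powr_eq_exp: "0 < t \<Longrightarrow> of_real t powr z = exp (z * of_real (ln t) :: complex)"
  by (simp add: powr_def Ln_of_real)

lemma norm_of_real_powr: "0 < t \<Longrightarrow> norm (of_real t powr z :: complex) = t powr Re z"
  by (simp add: of_real_powr_eq_exp powr_def)

lemma continuous_on_of_real_powr: "continuous_on {0<..} (\<lambda>t. of_real t powr z :: complex)"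
  by (rule continuous_on_cong[THEN iffD1, OF refl, of _ "\<lambda>t. exp (z * of_real (ln t))"])
     (auto simp: of_real_powr_eq_exp intro!: continuous_intros)

lemma set_integrable_mellin:
  fixes f :: "real \<Rightarrow> real"
  assumes f: "continuous_on {0<..} f" "\<And>t. 0 < t \<Longrightarrow> \<bar>f t\<bar> \<le> C * exp (- t)" and z: "-1 < Re z"
  shows "set_integrable lborel {0<..} (\<lambda>t. of_real t powr z * of_real (f t) :: complex)"
proof (rule set_integrable_bound)
  show "set_integrable lborel {0<..} (\<lambda>t. t powr Re z * f t)"
    by (rule set_integrable_powr_times_exp_decay[OF f z])
  show "set_borel_measurable lborel {0<..} (\<lambda>t. of_real t powr z * of_real (f t) :: complex)"
    unfolding set_borel_measurable_def
    by (intro measurable_on_positive continuous_intros continuous_on_of_real_powr f)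
  show "AE t in lborel. t \<in> {0<..} \<longrightarrow> norm (of_real t powr z * of_real (f t) :: complex) \<le> norm (t powr Re z * f t)"
    by (intro AE_I2 impI) (simp add: norm_mult norm_of_real_powr abs_mult)
qed

text \<open>
  The truncated integrals over \<open>[1/(k+2), k+2]\<close> are holomorphic by differentiation under the
  integral sign on a compact interval, and they converge locally uniformly, because the tail is
  dominated by the two real powers \<open>x1\<close> and \<open>x2\<close> that bound the exponents in a small disc.
\<close>

lemma holomorphic_on_mellin:
  fixes f :: "real \<Rightarrow> real"
  assumes f: "continuous_on {0<..} f" "\<And>t. 0 < t \<Longrightarrow> \<bar>f t\<bar> \<le> C * exp (- t)"
  shows "mellin f holomorphic_on {z. -1 < Re z}"
proof (rule holomorphic_uniform_sequence)
  let ?S = "{z. -1 < Re z}"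
  show "open ?S" by (rule open_halfspace_Re_gt)
  define a where "a k = 1 / real (k + 2)" for k
  define b where "b k = real (k + 2)" for k
  define h where "h z t = exp (z * of_real (ln t)) * of_real (f t)" for z :: complex and t :: real
  define M where "M k z = integral (cbox (a k) (b k)) (h z)" for k z
  have ab: "0 < a k" "a k < b k" for k
  proof -
    show "0 < a k" by (simp add: a_def)
    have "a k < 1" by (simp add: a_def)
    then show "a k < b k" by (simp add: b_def)
  qed
  have fcont: "continuous_on (cbox (a k) (b k)) f" for k
    using ab[of k] by (intro continuous_on_subset[OF f(1)]) auto
  have lncont: "continuous_on (cbox (a k) (b k)) ln" for k
    using ab[of k] by (intro continuous_intros) auto
  have hcont: "continuous_on (cbox (a k) (b k)) (h z)" for k z
    unfolding h_def by (intro continuous_intros fcont lncont)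
  show "M k holomorphic_on ?S" for k
    unfolding M_def
  proof (rule leibniz_rule_holomorphic)
    show "((\<lambda>z. h z t) has_field_derivative h z t * of_real (ln t)) (at z within ?S)" for z t
      unfolding h_def by (auto intro!: derivative_eq_intros)
    show "h z integrable_on cbox (a k) (b k)" for z by (rule integrable_continuous[OF hcont])
    have "continuous_on (?S \<times> cbox (a k) (b k)) (\<lambda>x. f (snd x))"
      by (rule continuous_on_compose2[OF fcont]) (auto intro: continuous_intros)
    moreover have "continuous_on (?S \<times> cbox (a k) (b k)) (\<lambda>x. ln (snd x))"
      by (rule continuous_on_compose2[OF lncont]) (auto intro: continuous_intros)
    ultimately show "continuous_on (?S \<times> cbox (a k) (b k)) (\<lambda>(z, t). h z t * of_real (ln t))"
      unfolding h_def case_prod_beta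
      by - (assumption | rule continuous_on_mult continuous_on_exp continuous_on_of_real continuous_on_fst continuous_on_id)+
    show "convex ?S" by (rule convex_halfspace_Re_gt)
  qed
  fix z0 assume z0: "z0 \<in> ?S"
  define d where "d = (Re z0 + 1) / 2"
  define x1 where "x1 = Re z0 - d"
  define x2 where "x2 = Re z0 + d"
  have d: "0 < d" "-1 < x1" "-1 < x2" using z0 by (auto simp: d_def x1_def x2_def field_simps)
  have Rez: "x1 \<le> Re z" "Re z \<le> x2" if "z \<in> cball z0 d" for z
    using that abs_Re_le_cmod[of "z0 - z"] by (auto simp: dist_norm x1_def x2_def)
  define H where "H t = t powr x1 * \<bar>f t\<bar> + t powr x2 * \<bar>f t\<bar>" for t
  define tail where "tail k = (LINT t|lborel. indicator ({0<..} - cbox (a k) (b k)) t *\<^sub>R H t)" for k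
  have Hint: "set_integrable lborel {0<..} H"
    unfolding H_def using d f
    by (intro set_integral_add set_integrable_powr_times_exp_decay[where C=C] continuous_intros) auto
  have "tail \<longlonglongrightarrow> (LINT t|(lborel :: real measure). 0::real)"
    unfolding tail_def
  proof (rule integral_dominated_convergence[where w="\<lambda>t. indicator {0<..} t *\<^sub>R H t"
        and s="\<lambda>k t. indicator ({0<..} - cbox (a k) (b k)) t *\<^sub>R H t" and f="\<lambda>_. 0"])
    show "integrable lborel (\<lambda>t. indicator {0<..} t *\<^sub>R H t)" using Hint by (simp add: set_integrable_def)
    show "(\<lambda>t. indicator ({0<..} - cbox (a k) (b k)) t *\<^sub>R H t) \<in> borel_measurable lborel" for k
    proof -
      have "set_integrable lborel ({0<..} - cbox (a k) (b k)) H"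
        by (rule set_integrable_subset[OF Hint]) auto
      then show ?thesis unfolding set_integrable_def by (rule borel_measurable_integrable)
    qed
    show "AE t in lborel. norm (indicator ({0<..} - cbox (a k) (b k)) t *\<^sub>R H t) \<le> indicator {0<..} t *\<^sub>R H t" for k
      by (intro AE_I2) (auto simp: indicator_def H_def)
    show "AE t in lborel. (\<lambda>k. indicator ({0<..} - cbox (a k) (b k)) t *\<^sub>R H t) \<longlonglongrightarrow> 0"
    proof (intro AE_I2 tendsto_eventually)
      fix t :: real
      show "\<forall>\<^sub>F k in sequentially. indicator ({0<..} - cbox (a k) (b k)) t *\<^sub>R H t = 0"
      proof (cases "0 < t")
        case True
        obtain K :: nat where K: "max t (1 / t) \<le> real K" using real_arch_simple by blast
        show ?thesis
          unfolding eventually_sequentially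
        proof (intro exI[of _ K] allI impI)
          fix k assume "K \<le> k"
          then have "t \<le> b k" "1 / t \<le> b k" using K by (auto simp: b_def)
          moreover have "a k = 1 / b k" by (simp add: a_def b_def)
          moreover have "0 < b k" by (simp add: b_def)
          moreover have "1 / b k \<le> t"
          proof -
            have "1 \<le> b k * t" using \<open>1 / t \<le> b k\<close> True by (simp add: pos_divide_le_eq)
            then show ?thesis using \<open>0 < b k\<close> by (simp add: pos_divide_le_eq mult.commute)
          qed
          ultimately have "t \<in> cbox (a k) (b k)" by auto
          then show "indicator ({0<..} - cbox (a k) (b k)) t *\<^sub>R H t = 0" by simp
        qed
      qed simp
    qed
  qed simp
  then have tail: "tail \<longlonglongrightarrow> 0" by simp
  have est: "dist (M k z) (mellin f z) \<le> tail k" if z: "z \<in> cball z0 d" for k z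
  proof -
    let ?g = "\<lambda>t. of_real t powr z * of_real (f t) :: complex"
    let ?I = "cbox (a k) (b k)"
    have sub: "?I \<subseteq> {0<..}" using ab[of k] by auto
    have gi: "set_integrable lborel {0<..} ?g"
      using Rez[OF z] d by (intro set_integrable_mellin[OF f]) auto
    have gI: "set_integrable lborel ?I ?g" by (rule set_integrable_subset[OF gi _ sub]) auto
    have "M k z = integral ?I ?g"
      unfolding M_def by (rule Henstock_Kurzweil_Integration.integral_cong) (use sub in \<open>auto simp: h_def of_real_powr_eq_exp\<close>)
    also have "\<dots> = (LINT t:?I|lborel. ?g t)" by (rule set_borel_integral_eq_integral(2)[symmetric, OF gI])
    finally have "mellin f z - M k z = (LINT t:{0<..}|lborel. ?g t) - (LINT t:?I|lborel. ?g t)"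
      by (simp add: mellin_def)
    also have "\<dots> = (LINT t|lborel. indicator {0<..} t *\<^sub>R ?g t - indicator ?I t *\<^sub>R ?g t)"
      using gi gI unfolding set_lebesgue_integral_def set_integrable_def by (rule Bochner_Integration.integral_diff[symmetric])
    also have "\<dots> = (LINT t|lborel. indicator ({0<..} - ?I) t *\<^sub>R ?g t)"
      using sub by (intro Bochner_Integration.integral_cong) (auto simp: indicator_def)
    finally have "norm (mellin f z - M k z) \<le> (LINT t|lborel. norm (indicator ({0<..} - ?I) t *\<^sub>R ?g t))"
      by (simp only: integral_norm_bound)
    also have "\<dots> \<le> tail k"
      unfolding tail_def
    proof (rule integral_mono)
      have "set_integrable lborel ({0<..} - ?I) ?g" by (rule set_integrable_subset[OF gi]) auto
      then show "integrable lborel (\<lambda>t. norm (indicator ({0<..} - ?I) t *\<^sub>R ?g t))"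
        unfolding set_integrable_def by (rule integrable_norm)
      have "set_integrable lborel ({0<..} - ?I) H" by (rule set_integrable_subset[OF Hint]) auto
      then show "integrable lborel (\<lambda>t. indicator ({0<..} - ?I) t *\<^sub>R H t)"
        unfolding set_integrable_def .
      fix t
      show "norm (indicator ({0<..} - ?I) t *\<^sub>R ?g t) \<le> indicator ({0<..} - ?I) t *\<^sub>R H t"
      proof (cases "t \<in> {0<..} - ?I")
        case True
        then have t: "0 < t" by simp
        have "t powr Re z \<le> t powr x1 + t powr x2"
        proof (cases "t \<le> 1")
          case True
          then have "t powr Re z \<le> t powr x1" using Rez[OF z] t by (intro powr_mono') auto
          then show ?thesis by (simp add: add_increasing2)
        next
          case False
          then have "t powr Re z \<le> t powr x2" using Rez[OF z] by (intro powr_mono) auto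
          then show ?thesis by (simp add: add_increasing)
        qed
        then have "t powr Re z * \<bar>f t\<bar> \<le> (t powr x1 + t powr x2) * \<bar>f t\<bar>" by (rule mult_right_mono) simp
        then show ?thesis using True t by (simp add: norm_mult norm_of_real_powr H_def distrib_right)
      qed simp
    qed
    finally show ?thesis by (simp add: dist_norm norm_minus_commute)
  qed
  show "\<exists>d>0. cball z0 d \<subseteq> ?S \<and> uniform_limit (cball z0 d) M (mellin f) sequentially"
  proof (intro exI[of _ d] conjI d(1))
    show "cball z0 d \<subseteq> ?S" using Rez(1) d by fastforce
    show "uniform_limit (cball z0 d) M (mellin f) sequentially"
    proof (rule uniform_limitI)
      fix e :: real assume "0 < e"
      then have "\<forall>\<^sub>F k in sequentially. tail k < e" using order_tendstoD(2)[OF tail] by blast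
      then show "\<forall>\<^sub>F k in sequentially. \<forall>z\<in>cball z0 d. dist (M k z) (mellin f z) < e"
        by eventually_elim (intro ballI, rule le_less_trans[OF est])
    qed
  qed
qed

lemma mellin_of_real:
  "mellin f (of_real p) = of_real (LINT t:{0<..}|lborel. t powr p * f t)"
proof -
  have "mellin f (of_real p) = (LINT t:{0<..}|lborel. complex_of_real (t powr p * f t))"
    unfolding mellin_def by (rule set_lebesgue_integral_cong) (auto simp: powr_of_real)
  then show ?thesis by (simp only: set_integral_complex_of_real)
qed

section \<open>Fractional derivatives of normal densities\<close>

text \<open>
  Write \<open>t powr (- y)\<close> as a superposition of Gaussians \<open>exp (- (t\<^sup>2) * v)\<close> by means of the Gamma integral
  and exchange the order of integration. It is applied on both sides of the Fourier transform,
  where the inner integrals are explicit.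
\<close>

lemma subordination_integral:
  fixes f :: "real \<Rightarrow> real"
  assumes f: "continuous_on {0<..} f" "\<And>t. 0 < t \<Longrightarrow> \<bar>f t\<bar> \<le> C * exp (- t)" and y: "0 < y" "y < 1"
  shows "Gamma (y / 2) * (LINT t:{0<..}|lborel. t powr (- y) * f t)
      = (LINT v:{0<..}|lborel. v powr (y / 2 - 1) * (LINT t:{0<..}|lborel. exp (- (t\<^sup>2) * v) * f t))"
    and "set_integrable lborel {0<..} (\<lambda>v. v powr (y / 2 - 1) * (LINT t:{0<..}|lborel. exp (- (t\<^sup>2) * v) * f t))"
proof -
  define g where "g t = indicator {0<..} t *\<^sub>R f t" for t
  define k where "k t v = indicator {0<..} v *\<^sub>R (v powr (y / 2 - 1) * exp (- (t\<^sup>2) * v))" for t v :: real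
  define F where "F t v = g t * k t v" for t v
  have g [measurable]: "g \<in> borel_measurable lborel"
    unfolding g_def by (rule measurable_on_positive[OF f(1)])
  have inner: "has_bochner_integral lborel (k t) (Gamma (y / 2) * (t\<^sup>2) powr (- (y / 2)))" if "0 < t" for t
    using has_bochner_integral_Gamma_scaled[of "y / 2" "t\<^sup>2"] y that unfolding k_def by simp
  have knn: "0 \<le> k t v" for t v by (simp add: k_def)
  have tp: "(t\<^sup>2) powr (- (y / 2)) = t powr (- y)" if "0 < t" for t :: real
    using that by (simp add: powr_powr flip: powr_numeral)
  have gk: "(LINT v|lborel. k t v) * g t = Gamma (y / 2) * (indicator {0<..} t *\<^sub>R (t powr (- y) * f t))" for t
    using inner[of t] tp[of t] by (cases "0 < t") (auto simp: g_def has_bochner_integral_iff)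
  have int: "integrable (lborel \<Otimes>\<^sub>M lborel) (\<lambda>(t, v). F t v)"
  proof (rule lborel_pair.Fubini_integrable)
    show "(\<lambda>(t, v). F t v) \<in> borel_measurable (lborel \<Otimes>\<^sub>M lborel)"
      unfolding F_def k_def by measurable
    have "(LINT v|lborel. norm (case (t, v) of (t, v) \<Rightarrow> F t v)) = \<bar>Gamma (y / 2) * (indicator {0<..} t *\<^sub>R (t powr (- y) * f t))\<bar>" for t
    proof -
      have "(LINT v|lborel. norm (case (t, v) of (t, v) \<Rightarrow> F t v)) = (LINT v|lborel. \<bar>g t\<bar> * k t v)"
        by (simp add: F_def abs_mult knn)
      also have "\<dots> = \<bar>(LINT v|lborel. k t v) * g t\<bar>"
        by (simp add: abs_mult knn mult.commute)
      finally show ?thesis unfolding gk .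
    qed
    moreover have "integrable lborel (\<lambda>t. \<bar>Gamma (y / 2) * (indicator {0<..} t *\<^sub>R (t powr (- y) * f t))\<bar>)"
      using set_integrable_powr_times_exp_decay[OF f, of "- y"] y
      unfolding set_integrable_def by (intro integrable_abs integrable_mult_right) auto
    ultimately show "integrable lborel (\<lambda>t. LINT v|lborel. norm (case (t, v) of (t, v) \<Rightarrow> F t v))" by simp
    show "AE t in lborel. integrable lborel (\<lambda>v. case (t, v) of (t, v) \<Rightarrow> F t v)"
    proof (intro AE_I2)
      fix t :: real
      show "integrable lborel (\<lambda>v. case (t, v) of (t, v) \<Rightarrow> F t v)"
        using inner[of t] by (cases "0 < t") (auto simp: F_def g_def has_bochner_integral_iff)
    qed
  qed
  have inner2: "(LINT t|lborel. F t v) = indicator {0<..} v *\<^sub>R (v powr (y / 2 - 1) * (LINT t:{0<..}|lborel. exp (- (t\<^sup>2) * v) * f t))" for v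
  proof -
    have "(LINT t|lborel. F t v)
       = (LINT t|lborel. (indicator {0<..} v * v powr (y / 2 - 1)) * (indicator {0<..} t *\<^sub>R (exp (- (t\<^sup>2) * v) * f t)))"
      by (simp add: F_def g_def k_def mult_ac)
    then show ?thesis by (simp add: set_lebesgue_integral_def)
  qed
  have "(LINT v|lborel. LINT t|lborel. F t v) = (LINT t|lborel. LINT v|lborel. F t v)"
    by (rule lborel_pair.Fubini_integral[OF int])
  also have "\<dots> = (LINT t|lborel. (LINT v|lborel. k t v) * g t)"
    by (simp add: F_def mult.commute)
  also have "\<dots> = Gamma (y / 2) * (LINT t:{0<..}|lborel. t powr (- y) * f t)"
    unfolding gk set_lebesgue_integral_def by simp
  finally show "Gamma (y / 2) * (LINT t:{0<..}|lborel. t powr (- y) * f t)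
      = (LINT v:{0<..}|lborel. v powr (y / 2 - 1) * (LINT t:{0<..}|lborel. exp (- (t\<^sup>2) * v) * f t))"
    unfolding inner2 by (simp add: set_lebesgue_integral_def)
  have "integrable lborel (\<lambda>v. LINT t|lborel. F t v)" by (rule lborel_pair.integrable_snd[OF int])
  then show "set_integrable lborel {0<..} (\<lambda>v. v powr (y / 2 - 1) * (LINT t:{0<..}|lborel. exp (- (t\<^sup>2) * v) * f t))"
    unfolding inner2 set_integrable_def .
qed

lemma integral_half_line:
  fixes g :: "real \<Rightarrow> real"
  assumes g: "integrable lborel g"
  shows "(LINT x:{0<..}|lborel. g x + g (- x)) = (LINT x|lborel. g x)"
    "set_integrable lborel {0<..} (\<lambda>x. g x + g (- x))"
proof -
  have g': "integrable lborel (\<lambda>x. g (- x))"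
    using lborel_integrable_real_affine[OF g, of "-1" 0] by simp
  have i: "integrable lborel (\<lambda>x. indicator {0<..} x *\<^sub>R g x)" "integrable lborel (\<lambda>x. indicator {0<..} x *\<^sub>R g (- x))"
    "integrable lborel (\<lambda>x. indicator {0<..} (- x) *\<^sub>R g x)"
  proof -
    show "integrable lborel (\<lambda>x. indicator {0<..} x *\<^sub>R g x)"
      using g by (intro integrable_mult_indicator) auto
    show *: "integrable lborel (\<lambda>x. indicator {0<..} x *\<^sub>R g (- x))"
      using g' by (intro integrable_mult_indicator) auto
    show "integrable lborel (\<lambda>x. indicator {0<..} (- x) *\<^sub>R g x)"
      using lborel_integrable_real_affine[OF *, of "-1" 0] by simp
  qed
  show "set_integrable lborel {0<..} (\<lambda>x. g x + g (- x))"
    using Bochner_Integration.integrable_add[OF i(1,2)] unfolding set_integrable_def by (simp add: distrib_left)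
  have "(LINT x:{0<..}|lborel. g x + g (- x))
      = (LINT x|lborel. indicator {0<..} x *\<^sub>R g x) + (LINT x|lborel. indicator {0<..} x *\<^sub>R g (- x))"
    unfolding set_lebesgue_integral_def scaleR_add_right by (rule Bochner_Integration.integral_add[OF i(1,2)])
  also have "(LINT x|lborel. indicator {0<..} x *\<^sub>R g (- x)) = (LINT x|lborel. indicator {0<..} (- x) *\<^sub>R g x)"
    using lborel_integral_real_affine[of "-1" "\<lambda>x. indicator {0<..} x *\<^sub>R g (- x)" 0] by simp
  also have "(LINT x|lborel. indicator {0<..} x *\<^sub>R g x) + \<dots>
      = (LINT x|lborel. indicator {0<..} x *\<^sub>R g x + indicator {0<..} (- x) *\<^sub>R g x)"
    using i by simp
  also have "\<dots> = (LINT x|lborel. g x)"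
  proof (rule integral_cong_AE)
    have "AE x in lborel. x \<noteq> (0::real)" by (rule AE_lborel_singleton)
    then show "AE x in lborel. indicator {0<..} x *\<^sub>R g x + indicator {0<..} (- x) *\<^sub>R g x = g x"
      by eventually_elim (auto simp: indicator_def)
  qed (use i g in auto)
  finally show "(LINT x:{0<..}|lborel. g x + g (- x)) = (LINT x|lborel. g x)" .
qed

lemma integral_cos_std_normal:
  "(LINT x|lborel. std_normal_density x * cos (s * x)) = exp (- s\<^sup>2 / 2)"
  "integrable lborel (\<lambda>x. std_normal_density x * cos (s * x))"
proof -
  have int: "integrable lborel (\<lambda>x. std_normal_density x *\<^sub>R iexp (s * x))"
  proof (rule Bochner_Integration.integrable_bound)
    show "integrable lborel std_normal_density" by (rule integrable_normal_density) simp
    show "AE x in lborel. norm (std_normal_density x *\<^sub>R iexp (s * x)) \<le> norm (std_normal_density x)"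
      by (intro AE_I2) (simp add: norm_mult)
  qed simp
  have char: "char std_normal_distribution s = (CLINT x|lborel. std_normal_density x *\<^sub>R iexp (s * x))"
    unfolding char_def by (subst integral_density) auto
  have "exp (- s\<^sup>2 / 2) = Re (char std_normal_distribution s)"
    by (simp add: char_std_normal_distribution)
  also have "\<dots> = Re (CLINT x|lborel. std_normal_density x *\<^sub>R iexp (s * x))" unfolding char ..
  also have "\<dots> = (LINT x|lborel. Re (std_normal_density x *\<^sub>R iexp (s * x)))" by (rule integral_Re[symmetric, OF int])
  finally show "(LINT x|lborel. std_normal_density x * cos (s * x)) = exp (- s\<^sup>2 / 2)"
    by (simp add: Re_exp)
  show "integrable lborel (\<lambda>x. std_normal_density x * cos (s * x))"
    using integrable_Re[OF int] by (simp add: Re_exp)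
qed

lemma integral_gaussian_cos:
  assumes a: "0 < a"
  shows "(LINT r:{0<..}|lborel. exp (- a * r\<^sup>2) * cos (r * u)) = sqrt (pi / a) / 2 * exp (- u\<^sup>2 / (4 * a))"
proof -
  define c where "c = sqrt (2 * a)"
  have c: "0 < c" "c\<^sup>2 = 2 * a" using a by (auto simp: c_def)
  let ?h = "\<lambda>x. std_normal_density x * cos (u / c * x)"
  have eq: "?h (0 + c * r) = exp (- a * r\<^sup>2) * cos (r * u) / sqrt (2 * pi)" for r
    using c by (simp add: std_normal_density_def power_mult_distrib mult.commute)
  have int: "integrable lborel (\<lambda>r. exp (- a * r\<^sup>2) * cos (r * u) / sqrt (2 * pi))"
    using lborel_integrable_real_affine[OF integral_cos_std_normal(2)[of "u / c"], of c 0] c unfolding eq by simp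
  have int': "integrable lborel (\<lambda>r. exp (- a * r\<^sup>2) * cos (r * u))"
    using integrable_mult_right[OF int, of "sqrt (2 * pi)"] by simp
  have "exp (- (u / c)\<^sup>2 / 2) = c * (LINT r|lborel. exp (- a * r\<^sup>2) * cos (r * u) / sqrt (2 * pi))"
    using lborel_integral_real_affine[of c ?h 0] integral_cos_std_normal(1)[of "u / c"] c unfolding eq by simp
  then have I: "(LINT r|lborel. exp (- a * r\<^sup>2) * cos (r * u)) = sqrt (2 * pi) / c * exp (- (u / c)\<^sup>2 / 2)"
    using c by (simp add: field_simps)
  have "2 * (LINT r:{0<..}|lborel. exp (- a * r\<^sup>2) * cos (r * u))
      = (LINT r:{0<..}|lborel. exp (- a * r\<^sup>2) * cos (r * u) + exp (- a * (- r)\<^sup>2) * cos (- r * u))"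
    unfolding set_integral_mult_right[symmetric] by (simp add: mult.commute)
  also have "\<dots> = (LINT r|lborel. exp (- a * r\<^sup>2) * cos (r * u))"
    by (rule integral_half_line(1)[OF int'])
  finally have "2 * (LINT r:{0<..}|lborel. exp (- a * r\<^sup>2) * cos (r * u)) = (LINT r|lborel. exp (- a * r\<^sup>2) * cos (r * u))" .
  moreover have "sqrt (2 * pi) / c = sqrt (pi / a)" using a by (simp add: c_def real_sqrt_divide real_sqrt_mult)
  moreover have "- (u / c)\<^sup>2 / 2 = - u\<^sup>2 / (4 * a)" using c by (simp add: power_divide)
  ultimately show ?thesis using I by simp
qed

text \<open>
  The even part of a normal density; the sections of the symmetrised Gaussian mixture are averages
  of such functions.
\<close>

definition normal_sym :: "real \<Rightarrow> real \<Rightarrow> real \<Rightarrow> real" where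
  "normal_sym \<sigma> u t = (normal_density u \<sigma> t + normal_density (- u) \<sigma> t) / 2"

lemma normal_density_minus: "normal_density (- u) \<sigma> t = normal_density u \<sigma> (- t)"
proof -
  have "(t - (- u))\<^sup>2 = (- t - u)\<^sup>2" by (simp add: power2_eq_square algebra_simps)
  then show ?thesis unfolding normal_density_def by simp
qed

text \<open>
  Completing the square turns the product into a multiple of another normal density.
\<close>

lemma integral_gaussian_normal_sym:
  assumes s: "0 < \<sigma>" and w: "0 < w"
  shows "(LINT t:{0<..}|lborel. exp (- (t\<^sup>2) * w) * normal_sym \<sigma> u t)
    = 1 / (2 * sqrt (1 + 2 * \<sigma>\<^sup>2 * w)) * exp (- u\<^sup>2 * w / (1 + 2 * \<sigma>\<^sup>2 * w))"
proof -
  define b where "b = 1 + 2 * \<sigma>\<^sup>2 * w"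
  have b: "1 < b" "0 < b" using s w by (auto simp: b_def add_pos_pos)
  define K where "K = 1 / sqrt b * exp (- u\<^sup>2 * w / b)"
  have sq: "exp (- (t\<^sup>2) * w) * normal_density u \<sigma> t = K * normal_density (u / b) (\<sigma> / sqrt b) t" for t
  proof -
    have w': "w = (b - 1) / (2 * \<sigma>\<^sup>2)" using s by (simp add: b_def)
    have ex: "- (t\<^sup>2) * w + - (t - u)\<^sup>2 / (2 * \<sigma>\<^sup>2) = - u\<^sup>2 * w / b + - (t - u / b)\<^sup>2 / (2 * (\<sigma> / sqrt b)\<^sup>2)"
    proof -
      have num: "t\<^sup>2 * (b - 1) + (t - u)\<^sup>2 = u\<^sup>2 * (b - 1) / b + b * (t - u / b)\<^sup>2"
        using b by (simp add: power2_eq_square field_simps)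
      have gen: "- x / y + - x' / y = - (x + x') / y" for x x' y :: real by (cases "y = 0") (simp_all add: field_simps)
      have "- (t\<^sup>2) * w = - (t\<^sup>2 * (b - 1)) / (2 * \<sigma>\<^sup>2)" "- u\<^sup>2 * w / b = - (u\<^sup>2 * (b - 1) / b) / (2 * \<sigma>\<^sup>2)"
        unfolding w' by simp_all
      moreover have "- (t - u / b)\<^sup>2 / (2 * (\<sigma> / sqrt b)\<^sup>2) = - (b * (t - u / b)\<^sup>2) / (2 * \<sigma>\<^sup>2)"
        using b by (simp add: power_divide)
      ultimately show ?thesis by (simp only: gen num)
    qed
    have co: "sqrt (2 * pi * (\<sigma> / sqrt b)\<^sup>2) * sqrt b = sqrt (2 * pi * \<sigma>\<^sup>2)"
      using b by (simp add: power_divide real_sqrt_mult[symmetric])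
    have "exp (- (t\<^sup>2) * w) * normal_density u \<sigma> t = exp (- (t\<^sup>2) * w + - (t - u)\<^sup>2 / (2 * \<sigma>\<^sup>2)) / sqrt (2 * pi * \<sigma>\<^sup>2)"
      unfolding normal_density_def exp_add by simp
    also have "\<dots> = K * normal_density (u / b) (\<sigma> / sqrt b) t"
      unfolding ex exp_add K_def normal_density_def co[symmetric] by simp
    finally show ?thesis .
  qed
  have pos: "0 < \<sigma> / sqrt b" using s b by simp
  let ?g = "\<lambda>t. exp (- (t\<^sup>2) * w) * normal_density u \<sigma> t / 2"
  have int: "integrable lborel ?g"
    unfolding sq by (intro integrable_divide_zero integrable_mult_right integrable_normal_density pos)
  have "(LINT t:{0<..}|lborel. exp (- (t\<^sup>2) * w) * normal_sym \<sigma> u t) = (LINT t:{0<..}|lborel. ?g t + ?g (- t))"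
    by (simp add: normal_sym_def normal_density_minus algebra_simps add_divide_distrib)
  also have "\<dots> = (LINT t|lborel. ?g t)" by (rule integral_half_line(1)[OF int])
  also have "\<dots> = K / 2"
    unfolding sq using integral_normal_density[OF pos, of "u / b"] by simp
  finally show ?thesis by (simp add: K_def b_def)
qed

text \<open>
  The Fourier transform of \<open>exp (- (t\<^sup>2) * w)\<close> is a Gaussian with parameter \<open>v = 1 / (4 * w)\<close>, so this
  substitution matches the subordination integrals of a function and of its Fourier transform.
\<close>

lemma integral_inversion_substitution:
  fixes F :: "real \<Rightarrow> real"
  assumes F: "set_integrable lborel {0<..} F" and G: "set_integrable lborel {0<..} (\<lambda>v. F (1 / (4 * v)) / (4 * v\<^sup>2))"
  shows "(LINT w:{0<..}|lborel. F w) = (LINT v:{0<..}|lborel. F (1 / (4 * v)) / (4 * v\<^sup>2))"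
proof -
  let ?g = "\<lambda>v::real. 1 / (4 * v)" and ?g' = "\<lambda>v::real. - 1 / (4 * v\<^sup>2)"
  have img: "?g ` {0<..} = {0<..}"
  proof (intro Set.set_eqI iffI)
    fix w :: real assume "w \<in> {0<..}"
    then show "w \<in> ?g ` {0<..}" by (intro image_eqI[of _ _ "1 / (4 * w)"]) auto
  qed auto
  have "F absolutely_integrable_on {0<..}"
  proof -
    have "(\<lambda>t. indicator {0<..} t *\<^sub>R F t) \<in> borel_measurable lborel"
      using F unfolding set_integrable_def by (rule borel_measurable_integrable)
    then show ?thesis
      using F unfolding set_integrable_def by (simp add: integrable_completion)
  qed
  then have "F absolutely_integrable_on ?g ` {0<..} \<and> integral (?g ` {0<..}) F = integral {0<..} F"
    unfolding img by simp
  moreover have "(?g has_field_derivative ?g' v) (at v within {0<..})" if "v \<in> {0<..}" for v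
    using that by (auto intro!: derivative_eq_intros simp: power2_eq_square)
  moreover have "inj_on ?g {0<..}" by (auto simp: inj_on_def)
  ultimately have "integral {0<..} (\<lambda>v. \<bar>?g' v\<bar> * F (?g v)) = integral {0<..} F"
    using has_absolute_integral_change_of_variables_1'[of "{0<..}" ?g ?g' F "integral {0<..} F"] by auto
  then show ?thesis
    unfolding set_borel_integral_eq_integral(2)[OF F] set_borel_integral_eq_integral(2)[OF G] by simp
qed

lemma exp_decay_gaussian_cos:
  fixes \<sigma> r u :: real
  assumes "0 < \<sigma>"
  shows "\<bar>exp (- (\<sigma>\<^sup>2 * r\<^sup>2 / 2)) * cos (r * u)\<bar> \<le> exp (1 / (2 * \<sigma>\<^sup>2)) * exp (- r)"
proof -
  have "- (\<sigma>\<^sup>2 * r\<^sup>2 / 2) \<le> 1 / (2 * \<sigma>\<^sup>2) + - r"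
    using zero_le_power2[of "\<sigma> * r - 1 / \<sigma>"] assms by (simp add: power2_diff power_mult_distrib power_divide)
  then have "exp (- (\<sigma>\<^sup>2 * r\<^sup>2 / 2)) * \<bar>cos (r * u)\<bar> \<le> exp (1 / (2 * \<sigma>\<^sup>2) + - r) * 1"
    by (intro mult_mono) auto
  then show ?thesis by (simp only: abs_mult abs_exp_cancel exp_add mult_1_right)
qed

lemma normal_density_exp_decay:
  assumes "0 < \<sigma>"
  shows "normal_density u \<sigma> t \<le> 1 / sqrt (2 * pi * \<sigma>\<^sup>2) * exp (u + \<sigma>\<^sup>2 / 2) * exp (- t)"
proof -
  have "0 \<le> (t - u - \<sigma>\<^sup>2)\<^sup>2 / (2 * \<sigma>\<^sup>2)" by simp
  also have "\<dots> = (t - u)\<^sup>2 / (2 * \<sigma>\<^sup>2) - (t - u) + \<sigma>\<^sup>2 / 2"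
  proof -
    have "(d - S)\<^sup>2 / (2 * S) = d\<^sup>2 / (2 * S) - d + S / 2" if "S \<noteq> 0" for d S :: real
      using that by (simp add: power2_eq_square field_simps)
    then show ?thesis using assms by simp
  qed
  finally have "- (t - u)\<^sup>2 / (2 * \<sigma>\<^sup>2) \<le> u + \<sigma>\<^sup>2 / 2 + - t" by simp
  then have "exp (- (t - u)\<^sup>2 / (2 * \<sigma>\<^sup>2)) \<le> exp (u + \<sigma>\<^sup>2 / 2) * exp (- t)" by (simp flip: exp_add)
  then show ?thesis unfolding normal_density_def mult.assoc by (rule mult_left_mono) simp
qed

lemma normal_sym_exp_decay:
  assumes "0 < \<sigma>" shows "\<exists>C. \<forall>t. \<bar>normal_sym \<sigma> u t\<bar> \<le> C * exp (- t)"
proof -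
  let ?K = "1 / sqrt (2 * pi * \<sigma>\<^sup>2)"
  have "\<bar>normal_sym \<sigma> u t\<bar> \<le> (?K * exp (u + \<sigma>\<^sup>2 / 2) + ?K * exp (- u + \<sigma>\<^sup>2 / 2)) / 2 * exp (- t)" for t
  proof -
    have "(?K * exp (u + \<sigma>\<^sup>2 / 2) + ?K * exp (- u + \<sigma>\<^sup>2 / 2)) / 2 * exp (- t)
        = (?K * exp (u + \<sigma>\<^sup>2 / 2) * exp (- t) + ?K * exp (- u + \<sigma>\<^sup>2 / 2) * exp (- t)) / 2"
      by (simp only: distrib_right times_divide_eq_left)
    moreover have "0 \<le> normal_density u \<sigma> t" "0 \<le> normal_density (- u) \<sigma> t" by simp_all
    moreover have "\<bar>(a + b) / 2\<bar> \<le> X" if "X = (A + B) / 2" "0 \<le> a" "0 \<le> b" "a \<le> A" "b \<le> B" for a b A B X :: real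
      using that by simp
    ultimately show ?thesis
      using normal_density_exp_decay[OF assms, of u t] normal_density_exp_decay[OF assms, of "- u" t]
      unfolding normal_sym_def by blast
  qed
  then show ?thesis by blast
qed

lemma continuous_on_normal_sym: "continuous_on S (normal_sym \<sigma> u)"
proof (cases "\<sigma> = 0")
  case True
  then show ?thesis by (simp add: normal_sym_def[abs_def] normal_density_def)
next
  case False
  then show ?thesis unfolding normal_sym_def[abs_def] normal_density_def by (intro continuous_intros) auto
qed

text \<open>
  The fractional derivative of order \<open>- x\<close> computed on the Fourier side. Both integrals are
  subordinated to Gaussians; the two resulting integrals correspond under \<open>w = 1 / (4 * v)\<close>, and the
  Gamma factors combine by the duplication and reflection formulas.
\<close>

lemma normal_sym_mellin_real:
  assumes s: "0 < \<sigma>" and x: "0 < x" "x < 1"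
  shows "cos (pi * x / 2) / pi * (LINT r:{0<..}|lborel. r powr (- x) * (exp (- (\<sigma>\<^sup>2 * r\<^sup>2 / 2)) * cos (r * u)))
    = (LINT t:{0<..}|lborel. t powr (x - 1) * normal_sym \<sigma> u t) / Gamma x" (is "_ * ?M = ?A / _")
proof -
  let ?f = "\<lambda>r. exp (- (\<sigma>\<^sup>2 * r\<^sup>2 / 2)) * cos (r * u)"
  have fc: "continuous_on {0<..} ?f" by (intro continuous_intros) auto
  obtain C where C: "\<And>t. \<bar>normal_sym \<sigma> u t\<bar> \<le> C * exp (- t)" using normal_sym_exp_decay[OF s] by blast
  let ?H = "\<lambda>w. LINT t:{0<..}|lborel. exp (- (t\<^sup>2) * w) * normal_sym \<sigma> u t"
  let ?J = "\<lambda>v. LINT r:{0<..}|lborel. exp (- (r\<^sup>2) * v) * ?f r"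
  let ?F = "\<lambda>w. w powr ((1 - x) / 2 - 1) * ?H w"
  let ?K = "\<lambda>v. v powr (x / 2 - 1) * ?J v"
  define c where "c = 2 powr (x - 1) / sqrt pi"
  have A: "Gamma ((1 - x) / 2) * ?A = (LINT w:{0<..}|lborel. ?F w)" "set_integrable lborel {0<..} ?F"
    using subordination_integral[OF continuous_on_normal_sym[of "{0<..}" \<sigma> u] C, of "1 - x"] x by simp_all
  have M: "Gamma (x / 2) * ?M = (LINT v:{0<..}|lborel. ?K v)" "set_integrable lborel {0<..} ?K"
    using subordination_integral[OF fc exp_decay_gaussian_cos[OF s] x] by simp_all
  have FK: "?F (1 / (4 * v)) / (4 * v\<^sup>2) = c * ?K v" if v: "v \<in> {0<..}" for v
  proof -
    define a where "a = \<sigma>\<^sup>2 / 2 + v"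
    have v0: "0 < v" using v by simp
    have a: "0 < a" using s v0 by (simp add: a_def add_nonneg_pos)
    have J: "?J v = sqrt (pi / a) / 2 * exp (- u\<^sup>2 / (4 * a))"
    proof -
      have "exp (- (r\<^sup>2) * v) * ?f r = exp (- a * r\<^sup>2) * cos (r * u)" for r
      proof -
        have "exp (- (r\<^sup>2) * v) * ?f r = exp (- (r\<^sup>2) * v + - (\<sigma>\<^sup>2 * r\<^sup>2 / 2)) * cos (r * u)"
          by (simp only: mult.assoc exp_add)
        also have "- (r\<^sup>2) * v + - (\<sigma>\<^sup>2 * r\<^sup>2 / 2) = - a * r\<^sup>2"
          by (simp add: a_def algebra_simps)
        finally show ?thesis .
      qed
      then show ?thesis by (simp only: integral_gaussian_cos[OF a])
    qed
    have av: "1 + 2 * \<sigma>\<^sup>2 * (1 / (4 * v)) = a / v" using v0 by (simp add: a_def field_simps)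
    have H: "?H (1 / (4 * v)) = 1 / (2 * sqrt (a / v)) * exp (- u\<^sup>2 / (4 * a))"
    proof -
      have "- u\<^sup>2 * (1 / (4 * v)) / (a / v) = - u\<^sup>2 / (4 * a)" using v0 a by (simp add: field_simps)
      then show ?thesis
        using integral_gaussian_normal_sym[OF s, of "1 / (4 * v)" u] v0 unfolding av by simp
    qed
    have pw: "(1 / (4 * v)) powr ((1 - x) / 2 - 1) / (4 * v\<^sup>2) * (1 / (2 * sqrt (a / v))) = c * (v powr (x / 2 - 1) * (sqrt (pi / a) / 2))"
    proof -
      have e: "(1 - x) / 2 - 1 = - ((x + 1) / 2)" by (simp add: field_simps)
      have "(1 / (4 * v)) powr ((1 - x) / 2 - 1) = (4 * v) powr ((x + 1) / 2)"
        unfolding e using v0 by (simp add: powr_divide powr_minus_divide powr_mult)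
      also have "\<dots> = 4 powr ((x + 1) / 2) * v powr ((x + 1) / 2)" using v0 by (simp add: powr_mult)
      also have "(4::real) powr ((x + 1) / 2) = 2 powr (x + 1)"
      proof -
        have "(4::real) = 2 powr 2" by simp
        then have "(4::real) powr ((x + 1) / 2) = (2 powr 2) powr ((x + 1) / 2)" by simp
        then show ?thesis by (simp only: powr_powr) simp
      qed
      also have "(2::real) powr (x + 1) = 2 powr (x - 1) * 4"
      proof -
        have "(2::real) powr (x + 1) = 2 powr ((x - 1) + 2)" by (simp add: algebra_simps)
        then show ?thesis by (simp only: powr_add) simp
      qed
      finally have 1: "(1 / (4 * v)) powr ((1 - x) / 2 - 1) = 2 powr (x - 1) * 4 * v powr ((x + 1) / 2)" .
      have 2: "v powr ((x + 1) / 2) * sqrt v = v powr (x / 2 - 1) * v\<^sup>2"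
      proof -
        have "v powr ((x + 1) / 2) * v powr (1 / 2) = v powr (x / 2 - 1) * v powr 2"
          unfolding powr_add[symmetric] by (simp add: field_simps)
        then show ?thesis using v0 by (simp add: powr_half_sqrt)
      qed
      have "(1 / (4 * v)) powr ((1 - x) / 2 - 1) / (4 * v\<^sup>2) * (1 / (2 * sqrt (a / v)))
        = 2 powr (x - 1) * (v powr ((x + 1) / 2) * sqrt v) / (v\<^sup>2 * 2 * sqrt a)"
        unfolding 1 by (simp add: real_sqrt_divide)
      also have "\<dots> = 2 powr (x - 1) * v powr (x / 2 - 1) / (2 * sqrt a)"
        unfolding 2 using v0 by simp
      also have "\<dots> = c * (v powr (x / 2 - 1) * (sqrt (pi / a) / 2))"
        by (simp add: c_def real_sqrt_divide)
      finally show ?thesis .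
    qed
    have "?F (1 / (4 * v)) / (4 * v\<^sup>2)
      = (1 / (4 * v)) powr ((1 - x) / 2 - 1) / (4 * v\<^sup>2) * (1 / (2 * sqrt (a / v))) * exp (- u\<^sup>2 / (4 * a))"
      unfolding H by simp
    also have "\<dots> = c * ?K v" unfolding pw J by simp
    finally show ?thesis .
  qed
  have G: "set_integrable lborel {0<..} (\<lambda>v. ?F (1 / (4 * v)) / (4 * v\<^sup>2))"
    using set_integrable_mult_right[OF M(2), of c] by (rule set_integrable_cong[THEN iffD2, rotated 3]) (use FK in auto)
  have "Gamma ((1 - x) / 2) * ?A = (LINT v:{0<..}|lborel. ?F (1 / (4 * v)) / (4 * v\<^sup>2))"
    unfolding A(1) by (rule integral_inversion_substitution[OF A(2) G])
  also have "\<dots> = (LINT v:{0<..}|lborel. c * ?K v)"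
    by (rule set_lebesgue_integral_cong) (use FK in auto)
  also have "\<dots> = c * (Gamma (x / 2) * ?M)" unfolding M(1) by (rule set_integral_mult_right)
  finally have AM: "Gamma ((1 - x) / 2) * ?A = c * (Gamma (x / 2) * ?M)" .
  have dup: "Gamma (x / 2) * Gamma ((1 + x) / 2) = 2 powr (1 - x) * sqrt pi * Gamma x"
  proof -
    have "complex_of_real (x / 2) \<notin> \<int>\<^sub>\<le>\<^sub>0" "complex_of_real (x / 2) + 1 / 2 \<notin> \<int>\<^sub>\<le>\<^sub>0"
      using x by (auto dest!: plus_of_nat_eq_0_imp elim!: nonpos_Ints_cases simp: complex_eq_iff)
    from Gamma_legendre_duplication[OF this]
    have "complex_of_real (Gamma (x / 2)) * complex_of_real (Gamma ((1 + x) / 2))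
       = complex_of_real (2 powr (1 - x) * sqrt pi * Gamma x)"
      by (simp add: Gamma_complex_of_real[symmetric] powr_def exp_of_real[symmetric] add_divide_distrib add.commute)
    then show ?thesis by (simp only: of_real_mult[symmetric] of_real_eq_iff)
  qed
  have refl: "Gamma ((1 + x) / 2) * Gamma ((1 - x) / 2) * cos (pi * x / 2) = pi"
  proof -
    have "complex_of_real (Gamma ((1 + x) / 2)) * complex_of_real (Gamma ((1 - x) / 2))
       = complex_of_real (pi / sin (pi * ((1 + x) / 2)))"
    proof -
      have "1 - complex_of_real ((1 + x) / 2) = of_real (1 - (1 + x) / 2)" by simp
      also have "1 - (1 + x) / 2 = (1 - x) / 2" by (simp add: field_simps)
      finally have "Gamma (complex_of_real ((1 + x) / 2)) * Gamma (complex_of_real ((1 - x) / 2))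
          = of_real pi / sin (of_real pi * of_real ((1 + x) / 2))"
        using Gamma_reflection_complex[of "complex_of_real ((1 + x) / 2)"] by (simp only:)
      then show ?thesis
        by (simp only: Gamma_complex_of_real of_real_mult[symmetric] sin_of_real of_real_divide[symmetric])
    qed
    then have "Gamma ((1 + x) / 2) * Gamma ((1 - x) / 2) = pi / sin (pi * ((1 + x) / 2))"
      by (simp only: of_real_mult[symmetric] of_real_eq_iff)
    moreover have "sin (pi * ((1 + x) / 2)) = cos (pi * x / 2)"
    proof -
      have "pi / 2 - pi * ((1 + x) / 2) = - (pi * x / 2)" by (simp add: field_simps)
      then show ?thesis using sin_cos_eq[of "pi * ((1 + x) / 2)"] by simp
    qed
    moreover have "0 < cos (pi * x / 2)" 
    proof (rule cos_gt_zero_pi)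
      have "0 < pi * x" "pi * x < pi" using x by simp_all
      then show "- (pi / 2) < pi * x / 2" "pi * x / 2 < pi / 2" by linarith+
    qed
    ultimately show ?thesis by simp
  qed
  have G0: "0 < Gamma (x / 2)" "0 < Gamma ((1 + x) / 2)" "0 < Gamma ((1 - x) / 2)" "0 < Gamma x"
    using x by (auto intro!: Gamma_real_pos)
  have cc: "c * (2 powr (1 - x) * sqrt pi) = 1"
    by (simp add: c_def powr_add[symmetric] flip: powr_add)
  have "cos (pi * x / 2) / pi * ?M * Gamma x = ?A"
  proof -
    have "cos (pi * x / 2) * ?M * Gamma x = cos (pi * x / 2) * ?M * Gamma x * (c * (2 powr (1 - x) * sqrt pi))"
      unfolding cc by simp
    also have "\<dots> = cos (pi * x / 2) * c * ?M * (2 powr (1 - x) * sqrt pi * Gamma x)" by (simp only: mult_ac)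
    also have "\<dots> = cos (pi * x / 2) * Gamma ((1 + x) / 2) * (c * (Gamma (x / 2) * ?M))"
      unfolding dup[symmetric] by (simp only: mult_ac)
    also have "\<dots> = (Gamma ((1 + x) / 2) * Gamma ((1 - x) / 2) * cos (pi * x / 2)) * ?A"
      unfolding AM[symmetric] by (simp only: mult_ac)
    also have "\<dots> = pi * ?A" unfolding refl ..
    finally show ?thesis by simp
  qed
  then show ?thesis using G0 by (simp add: field_simps)
qed

text \<open>
  The right-hand side of the formula is holomorphic for \<open>Re z > -1\<close>, hence it is the analytic
  continuation. On the strip \<open>-1 < Re z < 0\<close> it suffices to compare both sides on the real segment.
\<close>

lemma has_frac_deriv_0_normal_sym:
  assumes s: "0 < \<sigma>" and q: "-1 < q"
  shows "has_frac_deriv_0 (normal_sym \<sigma> u) q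
    (cos (pi * q / 2) / pi * (LINT r:{0<..}|lborel. r powr q * (exp (- (\<sigma>\<^sup>2 * r\<^sup>2 / 2)) * cos (r * u))))"
proof -
  let ?f = "\<lambda>r. exp (- (\<sigma>\<^sup>2 * r\<^sup>2 / 2)) * cos (r * u)"
  let ?\<phi> = "normal_sym \<sigma> u"
  have fc: "continuous_on {0<..} ?f" by (intro continuous_intros) auto
  obtain C where C: "\<And>t. \<bar>?\<phi> t\<bar> \<le> C * exp (- t)" using normal_sym_exp_decay[OF s] by blast
  define F where "F z = cos (of_real pi * z / 2) / of_real pi * mellin ?f z" for z
  define G where "G z = rGamma (- z) * mellin ?\<phi> (- 1 - z)" for z
  let ?S = "{z. -1 < Re z} \<inter> {z. Re z < 0}"
  have Fh: "F holomorphic_on {z. -1 < Re z}"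
    unfolding F_def
    by (intro holomorphic_intros holomorphic_on_mellin[OF fc exp_decay_gaussian_cos[OF s]]) auto
  have Gh: "G holomorphic_on ?S"
  proof -
    have "mellin ?\<phi> holomorphic_on {z. -1 < Re z}"
      by (rule holomorphic_on_mellin[OF continuous_on_normal_sym C])
    moreover have "(\<lambda>z. - 1 - z) holomorphic_on ?S" by (intro holomorphic_intros)
    moreover have "(\<lambda>z. - 1 - z) ` ?S \<subseteq> {z. -1 < Re z}" by (rule image_subsetI) simp
    ultimately have "(mellin ?\<phi> \<circ> (\<lambda>z. - 1 - z)) holomorphic_on ?S"
      by (metis holomorphic_on_compose_gen)
    then show ?thesis unfolding G_def by (intro holomorphic_intros) (auto simp: o_def)
  qed
  have FG: "F z = G z" if z: "z \<in> ?S" for z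
  proof -
    let ?U = "complex_of_real ` {-1<..<0}"
    have "F z - G z = 0"
    proof (rule analytic_continuation[of "\<lambda>z. F z - G z" ?S ?U "of_real (-1/2)"])
      show "(\<lambda>z. F z - G z) holomorphic_on ?S"
        by (intro holomorphic_intros holomorphic_on_subset[OF Fh] Gh) auto
      show "open ?S" by (intro open_Int open_halfspace_Re_gt open_halfspace_Re_lt)
      show "connected ?S" by (intro convex_connected convex_Int convex_halfspace_Re_gt convex_halfspace_Re_lt)
      show "?U \<subseteq> ?S" by auto
      show "of_real (-1/2) \<in> ?S" by simp
      show "of_real (-1/2) islimpt ?U"
      proof (rule connected_imp_perfect)
        show "connected ?U" by (intro connected_continuous_image continuous_intros) auto
        show "complex_of_real (-1/2) \<in> ?U" by (rule imageI) simp
        fix w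
        have mem: "complex_of_real (-1/2) \<in> ?U" "complex_of_real (-1/4) \<in> ?U" by (auto intro!: imageI simp del: of_real_divide)
        show "?U \<noteq> {w}"
        proof
          assume "?U = {w}"
          then have "complex_of_real (-1/2) = w" "complex_of_real (-1/4) = w" using mem by blast+
          then have "complex_of_real (-1/2) = complex_of_real (-1/4)" by (simp only:)
          then show False by (simp only: of_real_eq_iff)
        qed
      qed
      show "F w - G w = 0" if w: "w \<in> ?U" for w
      proof -
        obtain y where y: "w = of_real y" "-1 < y" "y < 0" using w by auto
        define x where "x = - y"
        have x: "0 < x" "x < 1" "w = of_real (- x)" using y by (auto simp: x_def)
        have m: "- 1 - complex_of_real (- x) = of_real (x - 1)" by simp
        have "F w = of_real (cos (pi * x / 2) / pi * (LINT r:{0<..}|lborel. r powr (- x) * ?f r))"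
        proof -
          have "cos (complex_of_real pi * of_real (- x) / 2) = of_real (cos (pi * x / 2))"
            by (simp add: cos_of_real[symmetric])
          then show ?thesis unfolding F_def x(3) mellin_of_real by simp
        qed
        also have "\<dots> = of_real ((LINT t:{0<..}|lborel. t powr (x - 1) * ?\<phi> t) / Gamma x)"
          unfolding normal_sym_mellin_real[OF s x(1,2)] ..
        also have "\<dots> = G w"
        proof -
          have "rGamma (complex_of_real x) = of_real (inverse (Gamma x))"
            by (simp add: rGamma_inverse_Gamma Gamma_complex_of_real)
          then show ?thesis unfolding G_def x(3) m mellin_of_real by (simp add: divide_inverse)
        qed
        finally show ?thesis by simp
      qed
      show "z \<in> ?S" by (rule z)
    qed
    then show ?thesis by simp
  qed
  show ?thesis
    unfolding has_frac_deriv_0_def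
  proof (intro conjI q exI[of _ F] exI[of _ "q + 1"] allI impI)
    show "q < q + 1" by simp
    show "F holomorphic_on {z. - 1 < Re z \<and> Re z < q + 1}" by (rule holomorphic_on_subset[OF Fh]) auto
    show "set_integrable lborel {0<..} (\<lambda>t. of_real t powr (-1 - z) * of_real (?\<phi> t) :: complex)"
      if "- 1 < Re z \<and> Re z < 0" for z
      using that by (intro set_integrable_mellin[OF continuous_on_normal_sym C]) auto
    show "F z = 1 / Gamma (- z) * (LINT t:{0<..}|lborel. of_real t powr (-1 - z) * of_real (?\<phi> t))"
      if "- 1 < Re z \<and> Re z < 0" for z
    proof -
      have "F z = G z" using that by (intro FG) auto
      then show ?thesis by (simp add: G_def rGamma_inverse_Gamma mellin_def divide_inverse)
    qed
    have "cos (complex_of_real pi * of_real q / 2) = of_real (cos (pi * q / 2))"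
      by (simp add: cos_of_real[symmetric])
    then show "F (of_real q) = of_real (cos (pi * q / 2) / pi * (LINT r:{0<..}|lborel. r powr q * ?f r))"
      unfolding F_def mellin_of_real by simp
  qed
qed

section \<open>Radon transforms of Gaussians\<close>

lemma Rn_inner_commute: "Rn_inner n x y = Rn_inner n y x"
  by (simp add: Rn_inner_def mult.commute)

text \<open>
  A square matrix with a right inverse has the same left inverse, so orthonormal rows force
  orthonormal columns. The orthonormal basis of the hyperplane is an arbitrary one, hence its
  completeness has to come from this count of dimensions.
\<close>

lemma orthonormal_parseval:
  fixes f :: "nat \<Rightarrow> nat \<Rightarrow> real"
  assumes "\<And>j k. j < n \<Longrightarrow> k < n \<Longrightarrow> Rn_inner n (f j) (f k) = (if j = k then 1 else 0)"
  shows "(\<Sum>j<n. (Rn_inner n v (f j))\<^sup>2) = (\<Sum>i<n. (v i)\<^sup>2)"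
proof -
  define A where "A = mat n n (\<lambda>(j, i). f j i)"
  have A: "A \<in> carrier_mat n n" "transpose_mat A \<in> carrier_mat n n" by (simp_all add: A_def)
  have "A * transpose_mat A = 1\<^sub>m n"
  proof (rule eq_matI)
    fix j k assume "j < dim_row (1\<^sub>m n :: real mat)" "k < dim_col (1\<^sub>m n :: real mat)"
    then have jk: "j < n" "k < n" by auto
    then have "(A * transpose_mat A) $$ (j, k) = Rn_inner n (f j) (f k)"
      by (simp add: A_def scalar_prod_def Rn_inner_def atLeast0LessThan)
    then show "(A * transpose_mat A) $$ (j, k) = 1\<^sub>m n $$ (j, k)" using assms jk by simp
  qed (auto simp: A_def)
  then have inv: "transpose_mat A * A = 1\<^sub>m n" by (rule mat_mult_left_right_inverse[OF A])
  have col: "(\<Sum>j<n. f j i * f j k) = (if i = k then 1 else 0)" if "i < n" "k < n" for i k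
  proof -
    have "(transpose_mat A * A) $$ (i, k) = (\<Sum>j<n. f j i * f j k)"
      using that by (simp add: A_def scalar_prod_def atLeast0LessThan)
    then show ?thesis unfolding inv using that by simp
  qed
  have "(\<Sum>j<n. (Rn_inner n v (f j))\<^sup>2) = (\<Sum>j<n. \<Sum>i<n. \<Sum>k<n. (v i * v k) * (f j i * f j k))"
    by (simp add: Rn_inner_def power2_eq_square sum_product mult_ac)
  also have "\<dots> = (\<Sum>i<n. \<Sum>k<n. \<Sum>j<n. (v i * v k) * (f j i * f j k))"
    by (subst sum.swap, rule sum.cong[OF refl], subst sum.swap) (rule refl)
  also have "\<dots> = (\<Sum>i<n. \<Sum>k<n. (v i * v k) * (if i = k then 1 else 0))"
    by (intro sum.cong refl) (simp add: sum_distrib_left[symmetric] col)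
  also have "\<dots> = (\<Sum>i<n. (v i)\<^sup>2)"
    by (intro sum.cong refl) (simp add: power2_eq_square if_distrib cong: if_cong)
  finally show ?thesis .
qed

text \<open>
  The images of the coordinate vectors other than the first one under the Householder reflection
  that maps the first coordinate vector to \<open>\<xi>\<close>.
\<close>

lemma exists_orthonormal_basis_perp:
  assumes \<xi>: "\<xi> \<in> Rn_sphere n" and n: "1 \<le> n"
  shows "\<exists>e. orthonormal_basis_perp n \<xi> e"
proof -
  define c where "c = 1 / (1 - \<xi> 0)"
  define d where "d i = \<xi> i - (if i = 0 then 1 else 0)" for i
  define e where "e j = (\<lambda>i\<in>{..<n}. (if i = Suc j then 1 else 0) - c * \<xi> (Suc j) * d i)" for j
  have n1: "(\<Sum>i<n. (\<xi> i)\<^sup>2) = 1"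
    using \<xi> by (simp add: Rn_sphere_def Rn_norm_def L2_set_def)
  \<comment> \<open>If \<open>\<xi>\<close> is the first coordinate vector then \<open>c = 0\<close> and the \<open>e j\<close> are the other ones.\<close>
  have c: "c * \<xi> (Suc j) * (1 - \<xi> 0) = \<xi> (Suc j)" if "Suc j < n" for j
  proof (cases "\<xi> 0 = 1")
    case True
    have "(\<Sum>i\<in>{0, Suc j}. (\<xi> i)\<^sup>2) \<le> (\<Sum>i<n. (\<xi> i)\<^sup>2)"
      using that n by (intro sum_mono2) auto
    then have "(\<xi> (Suc j))\<^sup>2 \<le> 0" using True n1 by simp
    then show ?thesis by simp
  qed (simp add: c_def)
  have inner_e: "Rn_inner n (e j) v = v (Suc j) - c * \<xi> (Suc j) * (\<Sum>i<n. d i * v i)" if "Suc j < n" for j v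
  proof -
    have "Rn_inner n (e j) v = (\<Sum>i<n. (if i = Suc j then v (Suc j) else 0) - c * \<xi> (Suc j) * (d i * v i))"
      unfolding Rn_inner_def by (intro sum.cong refl) (auto simp: e_def algebra_simps)
    then show ?thesis using that by (simp add: sum_subtractf sum_distrib_left)
  qed
  have d\<xi>: "(\<Sum>i<n. d i * \<xi> i) = 1 - \<xi> 0"
  proof -
    have "(\<Sum>i<n. d i * \<xi> i) = (\<Sum>i<n. (\<xi> i)\<^sup>2 - (if i = 0 then \<xi> 0 else 0))"
      by (intro sum.cong refl) (auto simp: d_def power2_eq_square algebra_simps)
    then show ?thesis using n n1 by (simp add: sum_subtractf)
  qed
  have dd: "(\<Sum>i<n. d i * d i) = 2 * (1 - \<xi> 0)"
  proof -
    have "(\<Sum>i<n. d i * d i) = (\<Sum>i<n. d i * \<xi> i - (if i = 0 then d 0 else 0))"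
      by (intro sum.cong refl) (auto simp: d_def algebra_simps)
    then show ?thesis using n by (simp add: sum_subtractf d\<xi>) (simp add: d_def)
  qed
  have de: "(\<Sum>i<n. d i * e k i) = - \<xi> (Suc k)" if "Suc k < n" for k
  proof -
    have "(\<Sum>i<n. d i * e k i) = Rn_inner n (e k) d" by (simp add: Rn_inner_def mult.commute)
    also have "\<dots> = d (Suc k) - 2 * (c * \<xi> (Suc k) * (1 - \<xi> 0))" unfolding inner_e[OF that] dd by simp
    finally show ?thesis unfolding c[OF that] by (simp add: d_def)
  qed
  have "orthonormal_basis_perp n \<xi> e"
    unfolding orthonormal_basis_perp_def
  proof (intro conjI allI impI)
    fix j assume "j < n - 1"
    then have j: "Suc j < n" by simp
    show "e j \<in> Rn n" by (simp add: e_def Rn_def)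
    show "Rn_inner n (e j) \<xi> = 0" unfolding inner_e[OF j] d\<xi> c[OF j] by simp
    fix k assume "k < n - 1"
    then have k: "Suc k < n" by simp
    show "Rn_inner n (e j) (e k) = (if j = k then 1 else 0)"
      unfolding inner_e[OF j] de[OF k] using j by (auto simp: e_def d_def)
  qed
  then show ?thesis by blast
qed

definition gauss :: "nat \<Rightarrow> real \<Rightarrow> (nat \<Rightarrow> real) \<Rightarrow> (nat \<Rightarrow> real) \<Rightarrow> real" where
  "gauss n \<sigma> c x = (\<Prod>i<n. normal_density (c i) \<sigma> (x i))"

lemma gauss_nonneg: "0 \<le> gauss n \<sigma> c x"
  unfolding gauss_def by (intro prod_nonneg) simp

lemma gauss_eq_exp:
  "gauss n \<sigma> c x = (1 / sqrt (2 * pi * \<sigma>\<^sup>2)) ^ n * exp (- (\<Sum>i<n. (x i - c i)\<^sup>2) / (2 * \<sigma>\<^sup>2))"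
proof -
  have "(\<Sum>i<n. - (x i - c i)\<^sup>2 / (2 * \<sigma>\<^sup>2)) = - (\<Sum>i<n. (x i - c i)\<^sup>2) / (2 * \<sigma>\<^sup>2)"
    by (simp add: sum_negf sum_divide_distrib)
  then show ?thesis
    unfolding gauss_def normal_density_def
    by (simp only: prod.distrib prod_constant card_lessThan exp_sum[OF finite_lessThan, symmetric])
qed

lemma gauss_integral:
  assumes "0 < \<sigma>"
  shows "integrable (Rn_lebesgue n) (gauss n \<sigma> c)" "(LINT x|Rn_lebesgue n. gauss n \<sigma> c x) = 1"
  unfolding Rn_lebesgue_def gauss_def[abs_def]
  using assms Rn_prod.product_integrable_prod[of "{..<n}" "\<lambda>i. normal_density (c i) \<sigma>"]
    Rn_prod.product_integral_prod[of "{..<n}" "\<lambda>i. normal_density (c i) \<sigma>"]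
  by (simp_all add: integrable_normal_density integral_normal_density)

text \<open>
  By rotation invariance a Gaussian is the product of its marginal in direction \<open>\<xi>\<close> and a Gaussian
  on the hyperplane.
\<close>

lemma gauss_on_hyperplane:
  assumes e: "orthonormal_basis_perp n \<xi> e" and \<xi>: "\<xi> \<in> Rn_sphere n" and n: "1 \<le> n"
  shows "gauss n \<sigma> c (\<lambda>i\<in>{..<n}. (\<Sum>j<n-1. y j * e j i) + t * \<xi> i)
    = normal_density (Rn_inner n c \<xi>) \<sigma> t * gauss (n - 1) \<sigma> (\<lambda>j. Rn_inner n c (e j)) y"
proof -
  define f where "f j = (if j < n - 1 then e j else \<xi>)" for j
  have xx: "Rn_inner n \<xi> \<xi> = 1"
    using \<xi> by (simp add: Rn_sphere_def Rn_norm_def L2_set_def Rn_inner_def power2_eq_square)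
  have ex: "Rn_inner n (e j) \<xi> = 0" "Rn_inner n \<xi> (e j) = 0" if "j < n - 1" for j
    using e that by (auto simp: orthonormal_basis_perp_def Rn_inner_commute)
  have ee: "Rn_inner n (e j) (e k) = (if j = k then 1 else 0)" if "j < n - 1" "k < n - 1" for j k
    using e that by (auto simp: orthonormal_basis_perp_def)
  have f: "Rn_inner n (f j) (f k) = (if j = k then 1 else 0)" if "j < n" "k < n" for j k
    using that ex ee xx by (auto simp: f_def)
  define v where "v i = (\<Sum>j<n-1. y j * e j i) + t * \<xi> i - c i" for i
  have vi: "Rn_inner n v w = (\<Sum>j<n-1. y j * Rn_inner n (e j) w) + t * Rn_inner n \<xi> w - Rn_inner n c w" for w
  proof -
    have "Rn_inner n v w = (\<Sum>i<n. (\<Sum>j<n-1. y j * (e j i * w i)) + t * (\<xi> i * w i) - c i * w i)"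
      unfolding Rn_inner_def v_def by (intro sum.cong refl) (simp add: algebra_simps sum_distrib_left sum_distrib_right)
    also have "\<dots> = (\<Sum>i<n. \<Sum>j<n-1. y j * (e j i * w i)) + t * Rn_inner n \<xi> w - Rn_inner n c w"
      by (simp add: sum.distrib sum_subtractf Rn_inner_def sum_distrib_left)
    also have "(\<Sum>i<n. \<Sum>j<n-1. y j * (e j i * w i)) = (\<Sum>j<n-1. y j * Rn_inner n (e j) w)"
      unfolding Rn_inner_def sum_distrib_left by (rule sum.swap)
    finally show ?thesis .
  qed
  have ve: "Rn_inner n v (e k) = y k - Rn_inner n c (e k)" if k: "k < n - 1" for k
  proof -
    have "(\<Sum>j<n-1. y j * Rn_inner n (e j) (e k)) = (\<Sum>j<n-1. if j = k then y k else 0)"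
      by (intro sum.cong refl) (use ee k in auto)
    then show ?thesis unfolding vi using ex k by simp
  qed
  have v\<xi>: "Rn_inner n v \<xi> = t - Rn_inner n c \<xi>" unfolding vi using ex xx by simp
  have "(\<Sum>i<n. (v i)\<^sup>2) = (\<Sum>j<n. (Rn_inner n v (f j))\<^sup>2)" by (rule orthonormal_parseval[OF f, symmetric])
  also have "\<dots> = (\<Sum>j<Suc (n - 1). (Rn_inner n v (f j))\<^sup>2)" using n by simp
  also have "\<dots> = (\<Sum>j<n-1. (Rn_inner n v (e j))\<^sup>2) + (Rn_inner n v \<xi>)\<^sup>2"
    by (simp add: f_def)
  also have "\<dots> = (\<Sum>j<n-1. (y j - Rn_inner n c (e j))\<^sup>2) + (t - Rn_inner n c \<xi>)\<^sup>2"
    by (simp add: ve v\<xi>)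
  finally have sq: "(\<Sum>i<n. (v i)\<^sup>2) = (\<Sum>j<n-1. (y j - Rn_inner n c (e j))\<^sup>2) + (t - Rn_inner n c \<xi>)\<^sup>2" .
  have "(\<Sum>i<n. ((\<lambda>i\<in>{..<n}. (\<Sum>j<n-1. y j * e j i) + t * \<xi> i) i - c i)\<^sup>2) = (\<Sum>i<n. (v i)\<^sup>2)"
    by (intro sum.cong refl) (simp add: v_def)
  moreover have "(1 / sqrt (2 * pi * \<sigma>\<^sup>2)) ^ n = (1 / sqrt (2 * pi * \<sigma>\<^sup>2)) ^ (n - 1) * (1 / sqrt (2 * pi * \<sigma>\<^sup>2))"
    using n power_Suc2[of "1 / sqrt (2 * pi * \<sigma>\<^sup>2)" "n - 1"] by simp
  moreover have "exp (- (a + b) / w) = exp (- b / w) * exp (- a / w)" for a b w :: real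
    by (simp add: add_divide_distrib exp_add[symmetric] diff_divide_distrib)
  ultimately show ?thesis
    unfolding gauss_eq_exp normal_density_def by (simp only: sq mult_ac)
qed

lemma hyperplane_lebesgue_gauss:
  assumes \<xi>: "\<xi> \<in> Rn_sphere n" and n: "1 \<le> n" and s: "0 < \<sigma>"
  shows "integrable (hyperplane_lebesgue n \<xi> t) (gauss n \<sigma> c)"
    "radon n (gauss n \<sigma> c) \<xi> t = normal_density (Rn_inner n c \<xi>) \<sigma> t"
proof -
  define e where "e = (SOME e. orthonormal_basis_perp n \<xi> e)"
  have e: "orthonormal_basis_perp n \<xi> e"
    unfolding e_def by (rule someI_ex[OF exists_orthonormal_basis_perp[OF \<xi> n]])
  define T where "T y = (\<lambda>i\<in>{..<n}. (\<Sum>j<n-1. y j * e j i) + t * \<xi> i)" for y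
  have H: "hyperplane_lebesgue n \<xi> t = distr (Rn_lebesgue (n - 1)) (Rn_lebesgue n) T"
    unfolding hyperplane_lebesgue_def e_def[symmetric] T_def Let_def ..
  have T: "T \<in> measurable (Rn_lebesgue (n - 1)) (Rn_lebesgue n)"
  proof -
    have "T \<in> measurable (Rn_lebesgue (n - 1)) (Pi\<^sub>M {..<n} (\<lambda>_. lborel))"
      unfolding T_def by (rule measurable_restrict) simp
    then show ?thesis by (simp add: Rn_lebesgue_def)
  qed
  have g: "gauss n \<sigma> c \<in> borel_measurable (Rn_lebesgue n)"
    using gauss_integral(1)[OF s] by (rule borel_measurable_integrable)
  have gT: "gauss n \<sigma> c (T y) = normal_density (Rn_inner n c \<xi>) \<sigma> t * gauss (n - 1) \<sigma> (\<lambda>j. Rn_inner n c (e j)) y" for y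
    unfolding T_def by (rule gauss_on_hyperplane[OF e \<xi> n])
  show "integrable (hyperplane_lebesgue n \<xi> t) (gauss n \<sigma> c)"
    unfolding H integrable_distr_eq[OF T g] gT by (intro integrable_mult_right gauss_integral s)
  show "radon n (gauss n \<sigma> c) \<xi> t = normal_density (Rn_inner n c \<xi>) \<sigma> t"
    unfolding radon_def H integral_distr[OF T g] gT using gauss_integral(2)[OF s] by simp
qed

section \<open>A random vector with decaying characteristic function\<close>

text \<open>
  The characteristic function at \<open>\<rho> \<xi>\<close> of the uniform distribution on the points \<open>\<plusminus> Y i\<close>.
\<close>

definition sign_char :: "nat \<Rightarrow> nat \<Rightarrow> (nat \<Rightarrow> nat \<Rightarrow> real) \<Rightarrow> (nat \<Rightarrow> real) \<Rightarrow> real \<Rightarrow> real" where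
  "sign_char n N Y \<xi> \<rho> = (\<Sum>i<N. cos (\<rho> * (\<Sum>j<n. Y i j * \<xi> j))) / real N"

lemma abs_sign_char_le_1: "\<bar>sign_char n N Y \<xi> \<rho>\<bar> \<le> 1"
proof -
  have "\<bar>\<Sum>i<N. cos (\<rho> * (\<Sum>j<n. Y i j * \<xi> j))\<bar> \<le> (\<Sum>i<N. 1)"
    by (rule order_trans[OF sum_abs]) (intro sum_mono, simp)
  then show ?thesis by (cases "N = 0") (auto simp: sign_char_def)
qed

text \<open>
  The mean of \<open>cos\<^sup>2\<close> is controlled by the mean of the cosine at the doubled argument, which has norm
  between \<open>1/2\<close> and \<open>1\<close>. Passing through squares bounds the absolute value.
\<close>

lemma sign_char_bound:
  assumes N: "0 < N"
    and Y: "\<And>\<eta>. 1/2 \<le> L2_set \<eta> {..<n} \<Longrightarrow> L2_set \<eta> {..<n} \<le> 1 \<Longrightarrow>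
      (\<Sum>i<N. cos (\<Sum>j<n. Y i j * \<eta> j)) \<le> (1 - \<delta>) * real N"
    and \<xi>: "L2_set \<xi> {..<n} = 1" and \<rho>: "1/4 \<le> \<rho>" "\<rho> \<le> 1/2"
  shows "\<bar>sign_char n N Y \<xi> \<rho>\<bar> \<le> sqrt (1 - \<delta> / 2)"
proof -
  let ?c = "\<lambda>i. cos (\<rho> * (\<Sum>j<n. Y i j * \<xi> j))"
  have L: "L2_set (\<lambda>j. 2 * \<rho> * \<xi> j) {..<n} = 2 * \<rho>"
    using L2_set_right_distrib[of "2 * \<rho>" \<xi> "{..<n}"] \<rho> \<xi> by simp
  have dbl: "cos (\<Sum>j<n. Y i j * (2 * \<rho> * \<xi> j)) = 2 * (?c i)\<^sup>2 - 1" for i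
  proof -
    have "(\<Sum>j<n. Y i j * (2 * \<rho> * \<xi> j)) = 2 * (\<rho> * (\<Sum>j<n. Y i j * \<xi> j))"
      by (simp add: sum_distrib_left mult_ac)
    then show ?thesis by (simp only: cos_double_cos)
  qed
  have "(\<Sum>i<N. 2 * (?c i)\<^sup>2 - 1) \<le> (1 - \<delta>) * real N"
    using Y[of "\<lambda>j. 2 * \<rho> * \<xi> j"] \<rho> unfolding L dbl by simp
  then have c2: "(\<Sum>i<N. (?c i)\<^sup>2) \<le> (1 - \<delta> / 2) * real N"
    by (simp add: sum_subtractf sum_distrib_left[symmetric] algebra_simps)
  have "(\<Sum>i<N. ?c i * 1)\<^sup>2 \<le> (\<Sum>i<N. (?c i)\<^sup>2) * (\<Sum>i<N. 1\<^sup>2)"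
    by (rule Cauchy_Schwarz_ineq_sum)
  also have "\<dots> \<le> (1 - \<delta> / 2) * real N * real N" using c2 by (simp add: mult_right_mono)
  finally have "(sign_char n N Y \<xi> \<rho>)\<^sup>2 \<le> 1 - \<delta> / 2"
    using N by (simp add: sign_char_def power_divide pos_divide_le_eq power2_eq_square mult.assoc)
  then have "sqrt ((sign_char n N Y \<xi> \<rho>)\<^sup>2) \<le> sqrt (1 - \<delta> / 2)" by (rule real_sqrt_le_mono)
  then show ?thesis by simp
qed

lemma sum_list_map_concat:
  fixes f :: "'a \<Rightarrow> real"
  shows "(\<Sum>x\<leftarrow>concat xss. f x) = (\<Sum>xs\<leftarrow>xss. \<Sum>x\<leftarrow>xs. f x)"
  by (induction xss) auto

text \<open>
  The points are the values of a random vector \<open>X = \<Sum> \<plusminus> a Y i\<close>, one independent choice of sign and row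
  for each \<open>a\<close> in the list \<open>as\<close>, each listed as often as its probability requires. The characteristic function of
  an independent sum is the product of the characteristic functions.
\<close>

lemma exists_points_product_char:
  fixes Y :: "nat \<Rightarrow> nat \<Rightarrow> real"
  assumes N: "0 < N" and as: "\<And>a. a \<in> set as \<Longrightarrow> 0 \<le> a"
  shows "\<exists>xs. xs \<noteq> [] \<and>
    (\<forall>x\<in>set xs. x \<in> Rn n \<and> (\<forall>z. \<bar>Rn_inner n x z\<bar> \<le> sum_list as * max_inner n N Y z)) \<and>
    (\<forall>\<xi> r. (\<Sum>x\<leftarrow>xs. cos (r * Rn_inner n x \<xi>)) = real (length xs) * (\<Prod>a\<leftarrow>as. sign_char n N Y \<xi> (r * a)))"
  using as
proof (induction as)
  case Nil
  have "Rn_inner n (Rn_zero n) z = 0" for z by (rule Rn_inner_zero_left)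
  then show ?case by (intro exI[of _ "[Rn_zero n]"]) simp
next
  case (Cons a as)
  then obtain xs where xs: "xs \<noteq> []"
    "\<And>x z. x \<in> set xs \<Longrightarrow> \<bar>Rn_inner n x z\<bar> \<le> sum_list as * max_inner n N Y z"
    "\<And>\<xi> r. (\<Sum>x\<leftarrow>xs. cos (r * Rn_inner n x \<xi>)) = real (length xs) * (\<Prod>a\<leftarrow>as. sign_char n N Y \<xi> (r * a))"
    by auto
  have a: "0 \<le> a" using Cons.prems by simp
  define pt where "pt x b i = (\<lambda>j\<in>{..<n}. x j + b * Y i j)" for x b i
  have pt: "Rn_inner n (pt x b i) z = Rn_inner n x z + b * (\<Sum>j<n. Y i j * z j)" for x b i z
  proof -
    have "Rn_inner n (pt x b i) z = (\<Sum>j<n. x j * z j + b * (Y i j * z j))"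
      unfolding Rn_inner_def by (intro sum.cong refl) (simp add: pt_def algebra_simps)
    then show ?thesis by (simp add: sum.distrib sum_distrib_left Rn_inner_def)
  qed
  define ys where "ys = concat (map (\<lambda>x. concat (map (\<lambda>i. [pt x a i, pt x (- a) i]) [0..<N])) xs)"
  have sums: "(\<Sum>y\<leftarrow>ys. f y) = (\<Sum>x\<leftarrow>xs. \<Sum>i<N. f (pt x a i) + f (pt x (- a) i))" for f :: "_ \<Rightarrow> real"
  proof -
    have inner: "(\<Sum>y\<leftarrow>concat (map (\<lambda>i. [pt x a i, pt x (- a) i]) [0..<N]). f y) = (\<Sum>i<N. f (pt x a i) + f (pt x (- a) i))" for x
      by (simp add: sum_list_map_concat o_def interv_sum_list_conv_sum_set_nat atLeast0LessThan)
    then show ?thesis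
      unfolding ys_def sum_list_map_concat[of _ "map _ xs"] by (simp add: o_def)
  qed
  have len: "real (length ys) = real (length xs) * (2 * real N)"
    using sums[of "\<lambda>_. 1"] by (simp add: sum_list_triv)
  show ?case
  proof (intro exI[of _ ys] conjI ballI allI)
    show "ys \<noteq> []" using len xs(1) N by auto
    fix y assume "y \<in> set ys"
    then have "\<exists>x\<in>set xs. \<exists>i<N. y = pt x a i \<or> y = pt x (- a) i" by (fastforce simp: ys_def)
    then obtain x i b where y: "x \<in> set xs" "i < N" "b = a \<or> b = - a" "y = pt x b i" by blast
    show "y \<in> Rn n" using y by (simp add: pt_def Rn_def)
    fix z
    have "\<bar>Rn_inner n y z\<bar> \<le> \<bar>Rn_inner n x z\<bar> + \<bar>b\<bar> * \<bar>\<Sum>j<n. Y i j * z j\<bar>"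
      unfolding y(4) pt by (metis abs_mult abs_triangle_ineq)
    also have "\<dots> \<le> sum_list as * max_inner n N Y z + a * max_inner n N Y z"
      using xs(2)[OF y(1)] max_inner_ge[OF y(2)] y(3) a by (intro add_mono mult_mono) auto
    finally show "\<bar>Rn_inner n y z\<bar> \<le> sum_list (a # as) * max_inner n N Y z" by (simp add: algebra_simps)
  next
    fix \<xi> r
    have "(\<Sum>y\<leftarrow>ys. cos (r * Rn_inner n y \<xi>))
        = (\<Sum>x\<leftarrow>xs. \<Sum>i<N. cos (r * Rn_inner n x \<xi> + r * a * (\<Sum>j<n. Y i j * \<xi> j)) + cos (r * Rn_inner n x \<xi> - r * a * (\<Sum>j<n. Y i j * \<xi> j)))"
      unfolding sums pt by (simp add: algebra_simps)
    also have "\<dots> = (\<Sum>x\<leftarrow>xs. \<Sum>i<N. 2 * cos (r * Rn_inner n x \<xi>) * cos (r * a * (\<Sum>j<n. Y i j * \<xi> j)))"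
      by (simp add: cos_add cos_diff mult.assoc)
    also have "\<dots> = (\<Sum>x\<leftarrow>xs. cos (r * Rn_inner n x \<xi>) * (2 * real N * sign_char n N Y \<xi> (r * a)))"
      using N by (simp add: sign_char_def sum_distrib_left[symmetric] mult_ac)
    also have "\<dots> = (\<Sum>x\<leftarrow>xs. cos (r * Rn_inner n x \<xi>)) * (2 * real N * sign_char n N Y \<xi> (r * a))"
      by (simp add: sum_list_mult_const)
    also have "\<dots> = real (length ys) * (\<Prod>a\<leftarrow>a # as. sign_char n N Y \<xi> (r * a))"
      unfolding xs(3) len by simp
    finally show "(\<Sum>y\<leftarrow>ys. cos (r * Rn_inner n y \<xi>)) = real (length ys) * (\<Prod>a\<leftarrow>a # as. sign_char n N Y \<xi> (r * a))" .
  qed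
qed

lemma sum_k_over_power2: "(\<Sum>k\<in>{1..K}. real k / 2 ^ k) \<le> 2 - (real K + 2) / 2 ^ K"
proof (induction K)
  case (Suc K)
  have "(\<Sum>k\<in>{1..Suc K}. real k / 2 ^ k) = (\<Sum>k\<in>{1..K}. real k / 2 ^ k) + real (Suc K) / 2 ^ Suc K" by simp
  also have "\<dots> \<le> 2 - (real K + 2) / 2 ^ K + real (Suc K) / 2 ^ Suc K" using Suc by simp
  also have "\<dots> = 2 - (real (Suc K) + 2) / 2 ^ Suc K" by (simp add: field_simps)
  finally show ?case .
qed simp

text \<open>
  Use the scale \<open>\<alpha> / 2 ^ k\<close> with multiplicity \<open>A * k\<close>. A frequency \<open>r\<close> with \<open>r * \<alpha>\<close> between
  \<open>2 ^ k / 4\<close> and \<open>2 ^ k / 2\<close> meets \<open>A * k\<close> factors of absolute value at most \<open>\<kappa>\<close>, and their product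
  is at most \<open>4\<close> to the power \<open>- k\<close>, which is the claimed quadratic decay. The total length of all
  steps is bounded, because the series of \<open>k / 2 ^ k\<close> converges.
\<close>

lemma exists_points_decay:
  fixes Y :: "nat \<Rightarrow> nat \<Rightarrow> real" and A :: nat
  assumes N: "0 < N" and \<alpha>: "0 < \<alpha>" and \<kappa>: "0 \<le> \<kappa>" "\<kappa> ^ A \<le> 1 / 4"
    and Y: "\<And>\<xi> \<rho>. L2_set \<xi> {..<n} = 1 \<Longrightarrow> 1/4 \<le> \<rho> \<Longrightarrow> \<rho> \<le> 1/2 \<Longrightarrow> \<bar>sign_char n N Y \<xi> \<rho>\<bar> \<le> \<kappa>"
  shows "\<exists>xs. xs \<noteq> [] \<and>
    (\<forall>x\<in>set xs. x \<in> Rn n \<and> (\<forall>z. \<bar>Rn_inner n x z\<bar> \<le> 2 * real A * \<alpha> * max_inner n N Y z)) \<and>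
    (\<forall>\<xi>\<in>Rn_sphere n. \<forall>r. 0 < r \<and> r \<le> R \<longrightarrow>
       \<bar>(\<Sum>x\<leftarrow>xs. cos (r * Rn_inner n x \<xi>)) / real (length xs)\<bar> \<le> 1 / (4 * \<alpha>\<^sup>2 * r\<^sup>2))"
proof -
  obtain K :: nat where K: "2 * R * \<alpha> < 2 ^ K" using real_arch_pow[of 2 "2 * R * \<alpha>"] by auto
  define as where "as = concat (map (\<lambda>k. replicate (A * k) (\<alpha> / 2 ^ k)) [1..<Suc K])"
  have sum_as: "sum_list as \<le> 2 * real A * \<alpha>"
  proof -
    have "sum_list as = (\<Sum>k\<leftarrow>[1..<Suc K]. real (A * k) * (\<alpha> / 2 ^ k))"
      unfolding as_def by (simp add: sum_list_map_concat[of "\<lambda>x. x", simplified] o_def sum_list_replicate)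
    also have "\<dots> = (\<Sum>k\<in>{1..K}. real (A * k) * (\<alpha> / 2 ^ k))"
      by (simp only: interv_sum_list_conv_sum_set_nat set_upt atLeastLessThanSuc_atLeastAtMost)
    also have "\<dots> = real A * \<alpha> * (\<Sum>k\<in>{1..K}. real k / 2 ^ k)"
      by (simp add: sum_distrib_left mult_ac)
    also have "\<dots> \<le> real A * \<alpha> * 2"
    proof (rule mult_left_mono)
      have "0 \<le> (real K + 2) / 2 ^ K" by simp
      then show "(\<Sum>k\<in>{1..K}. real k / 2 ^ k) \<le> 2" using sum_k_over_power2[of K] by linarith
    qed (use \<alpha> in simp)
    finally show ?thesis by simp
  qed
  have as0: "0 \<le> a" if "a \<in> set as" for a using that \<alpha> by (auto simp: as_def)
  have "\<exists>xs. xs \<noteq> [] \<and>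
    (\<forall>x\<in>set xs. x \<in> Rn n \<and> (\<forall>z. \<bar>Rn_inner n x z\<bar> \<le> sum_list as * max_inner n N Y z)) \<and>
    (\<forall>\<xi> r. (\<Sum>x\<leftarrow>xs. cos (r * Rn_inner n x \<xi>)) = real (length xs) * (\<Prod>a\<leftarrow>as. sign_char n N Y \<xi> (r * a)))"
    by (rule exists_points_product_char[OF N]) (rule as0)
  then obtain xs where xs: "xs \<noteq> []"
    "\<forall>x\<in>set xs. x \<in> Rn n \<and> (\<forall>z. \<bar>Rn_inner n x z\<bar> \<le> sum_list as * max_inner n N Y z)"
    "\<forall>\<xi> r. (\<Sum>x\<leftarrow>xs. cos (r * Rn_inner n x \<xi>)) = real (length xs) * (\<Prod>a\<leftarrow>as. sign_char n N Y \<xi> (r * a))"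
    by (elim exE conjE)
  have prod_as: "(\<Prod>a\<leftarrow>as. f a) = (\<Prod>k\<in>{1..K}. f (\<alpha> / 2 ^ k) ^ (A * k))" for f :: "real \<Rightarrow> real"
  proof -
    have "(\<Prod>a\<leftarrow>as. f a) = (\<Prod>k\<leftarrow>[1..<Suc K]. f (\<alpha> / 2 ^ k) ^ (A * k))"
      unfolding as_def by (induction K) (auto simp: prod_list_replicate)
    also have "\<dots> = (\<Prod>k\<in>{1..K}. f (\<alpha> / 2 ^ k) ^ (A * k))"
      by (simp only: prod.distinct_set_conv_list[symmetric] distinct_upt set_upt atLeastLessThanSuc_atLeastAtMost)
    finally show ?thesis .
  qed
  show ?thesis
  proof (intro exI[of _ xs] conjI ballI allI impI)
    show "xs \<noteq> []" by (rule xs(1))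
    fix x assume x: "x \<in> set xs"
    show "x \<in> Rn n" using xs(2) x by blast
    fix z
    have "\<bar>Rn_inner n x z\<bar> \<le> sum_list as * max_inner n N Y z" using xs(2) x by blast
    also have "\<dots> \<le> 2 * real A * \<alpha> * max_inner n N Y z"
      by (rule mult_right_mono[OF sum_as max_inner_nonneg[OF N]])
    finally show "\<bar>Rn_inner n x z\<bar> \<le> 2 * real A * \<alpha> * max_inner n N Y z" .
  next
    fix \<xi> r assume \<xi>: "\<xi> \<in> Rn_sphere n" and r: "0 < r \<and> r \<le> R"
    have L: "L2_set \<xi> {..<n} = 1" using \<xi> by (simp add: Rn_sphere_def Rn_norm_def)
    let ?P = "\<Prod>k\<in>{1..K}. sign_char n N Y \<xi> (r * (\<alpha> / 2 ^ k)) ^ (A * k)"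
    have eq: "(\<Sum>x\<leftarrow>xs. cos (r * Rn_inner n x \<xi>)) / real (length xs) = ?P"
      using xs(1) by (simp only: xs(3)[rule_format] prod_as) simp
    have f1: "\<bar>sign_char n N Y \<xi> (r * (\<alpha> / 2 ^ k)) ^ (A * k)\<bar> \<le> 1" for k
      using abs_sign_char_le_1 by (simp add: power_abs power_le_one)
    have "\<bar>?P\<bar> \<le> 1 / (4 * (r * \<alpha>)\<^sup>2)"
    proof (cases "r * \<alpha> \<le> 1 / 2")
      case True
      have ra: "0 < r * \<alpha>" using r \<alpha> by simp
      then have "(r * \<alpha>)\<^sup>2 \<le> (1/2)\<^sup>2" using True by (intro power_mono) auto
      then have "4 * (r * \<alpha>)\<^sup>2 \<le> 1" by (simp add: power_divide)
      moreover have "0 < 4 * (r * \<alpha>)\<^sup>2" using zero_less_power[OF ra, of 2] by linarith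
      ultimately have "1 \<le> 1 / (4 * (r * \<alpha>)\<^sup>2)" by (simp only: le_divide_eq_1_pos)
      moreover have "\<bar>?P\<bar> \<le> 1"
        unfolding abs_prod by (intro prod_le_1 conjI f1 abs_ge_zero)
      ultimately show ?thesis by linarith
    next
      case False
      \<comment> \<open>The scale \<open>k\<close> whose factor is small at \<open>r\<close>.\<close>
      define k where "k = (LEAST k::nat. 2 * (r * \<alpha>) \<le> 2 ^ k)"
      have "r * \<alpha> \<le> R * \<alpha>" using r \<alpha> by (intro mult_right_mono) auto
      then have ex: "2 * (r * \<alpha>) \<le> 2 ^ K" using K by simp
      have k: "2 * (r * \<alpha>) \<le> 2 ^ k" unfolding k_def by (rule LeastI[of _ K]) (rule ex)
      have kK: "k \<le> K" unfolding k_def by (rule Least_le) (rule ex)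
      have k1: "1 \<le> k" using k False by (cases k) auto
      have klow: "2 ^ (k - 1) < 2 * (r * \<alpha>)"
        using not_less_Least[of "k - 1" "\<lambda>k. 2 * (r * \<alpha>) \<le> 2 ^ k"] k1 unfolding k_def[symmetric] by simp
      have k2: "(2::real) ^ k = 2 * 2 ^ (k - 1)" using k1 by (cases k) auto
      have "1/4 \<le> r * (\<alpha> / 2 ^ k)" "r * (\<alpha> / 2 ^ k) \<le> 1/2"
      proof -
        have e: "r * (\<alpha> / 2 ^ k) = r * \<alpha> / 2 ^ k" by simp
        have p: "0 < (2::real) ^ k" by simp
        show "1/4 \<le> r * (\<alpha> / 2 ^ k)" unfolding e pos_le_divide_eq[OF p] using klow k2 by linarith
        show "r * (\<alpha> / 2 ^ k) \<le> 1/2" unfolding e pos_divide_le_eq[OF p] using k by linarith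
      qed
      then have s: "\<bar>sign_char n N Y \<xi> (r * (\<alpha> / 2 ^ k))\<bar> \<le> \<kappa>" by (rule Y[OF L])
      have "\<bar>?P\<bar> = (\<Prod>j\<in>{1..K}. \<bar>sign_char n N Y \<xi> (r * (\<alpha> / 2 ^ j)) ^ (A * j)\<bar>)" by (rule abs_prod)
      also have "\<dots> = \<bar>sign_char n N Y \<xi> (r * (\<alpha> / 2 ^ k)) ^ (A * k)\<bar> * (\<Prod>j\<in>{1..K} - {k}. \<bar>sign_char n N Y \<xi> (r * (\<alpha> / 2 ^ j)) ^ (A * j)\<bar>)"
        using k1 kK by (intro prod.remove) auto
      also have "\<dots> \<le> (1/4) ^ k * 1"
      proof (rule mult_mono)
        have "\<bar>sign_char n N Y \<xi> (r * (\<alpha> / 2 ^ k)) ^ (A * k)\<bar> \<le> \<kappa> ^ (A * k)"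
          unfolding power_abs by (rule power_mono[OF s]) simp
        also have "\<dots> \<le> (1/4) ^ k" unfolding power_mult using \<kappa> by (intro power_mono) auto
        finally show "\<bar>sign_char n N Y \<xi> (r * (\<alpha> / 2 ^ k)) ^ (A * k)\<bar> \<le> (1/4) ^ k" .
        show "(\<Prod>j\<in>{1..K} - {k}. \<bar>sign_char n N Y \<xi> (r * (\<alpha> / 2 ^ j)) ^ (A * j)\<bar>) \<le> 1"
          by (intro prod_le_1 conjI f1 abs_ge_zero)
      qed (auto intro: prod_nonneg)
      also have "\<dots> \<le> 1 / (4 * (r * \<alpha>)\<^sup>2)"
      proof -
        have "(2 * (r * \<alpha>))\<^sup>2 \<le> (2 ^ k)\<^sup>2" using k r \<alpha> by (intro power_mono) auto
        also have "((2::real) ^ k)\<^sup>2 = 4 ^ k" unfolding power2_eq_square power_mult_distrib[symmetric] by simp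
        finally have "4 * (r * \<alpha>)\<^sup>2 \<le> 4 ^ k" by (simp only: power_mult_distrib) simp
        moreover have "0 < 4 * (r * \<alpha>)\<^sup>2" using r \<alpha> by (intro mult_pos_pos zero_less_power) auto
        ultimately have "1 / 4 ^ k \<le> 1 / (4 * (r * \<alpha>)\<^sup>2)" by (intro divide_left_mono) auto
        then show ?thesis unfolding power_one_over by simp
      qed
      finally show ?thesis .
    qed
    then show "\<bar>(\<Sum>x\<leftarrow>xs. cos (r * Rn_inner n x \<xi>)) / real (length xs)\<bar> \<le> 1 / (4 * \<alpha>\<^sup>2 * r\<^sup>2)"
      unfolding eq by (simp add: power_mult_distrib mult_ac)
  qed
qed

section \<open>The Gaussian mixture\<close>

lemma integral_rational_tail:
  assumes E: "0 < E"
  shows "set_integrable lborel {0<..} (\<lambda>r. 2 * E / (E + r\<^sup>2))"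
    "(LINT r:{0<..}|lborel. 2 * E / (E + r\<^sup>2)) = pi * sqrt E"
proof -
  let ?f = "\<lambda>r. 2 * E / (E + r\<^sup>2)"
  let ?F = "\<lambda>r. 2 * sqrt E * arctan (r / sqrt E)"
  have pos: "0 < E + r\<^sup>2" for r using E by (simp add: add_pos_nonneg)
  have "(\<integral>\<^sup>+ r. ennreal (?f r) * indicator {0..} r \<partial>lborel) = ennreal (2 * sqrt E * (pi / 2) - ?F 0)"
  proof (rule nn_integral_FTC_atLeast)
    show "?f \<in> borel_measurable borel" by measurable
    show "(?F has_real_derivative ?f r) (at r)" for r
    proof -
      have "((\<lambda>r. arctan (r / sqrt E)) has_real_derivative inverse (1 + (r / sqrt E)\<^sup>2) * (1 / sqrt E)) (at r)"
        by (rule DERIV_chain2[OF DERIV_arctan DERIV_cdivide[OF DERIV_ident]])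
      then have "(?F has_real_derivative (2 * sqrt E) * (inverse (1 + (r / sqrt E)\<^sup>2) * (1 / sqrt E))) (at r)"
        by (rule DERIV_cmult)
      moreover have "(2 * sqrt E) * (inverse (1 + (r / sqrt E)\<^sup>2) * (1 / sqrt E)) = ?f r"
      proof -
        have "1 + (r / sqrt E)\<^sup>2 = (E + r\<^sup>2) / E" using E by (simp add: power_divide field_simps)
        then show ?thesis using E by simp
      qed
      ultimately show ?thesis by simp
    qed
    show "0 \<le> ?f r" for r using pos[of r] E by simp
    have "((\<lambda>r. arctan (r / sqrt E)) \<longlongrightarrow> pi / 2) at_top"
      by (rule filterlim_compose[OF tendsto_arctan_at_top])
        (use E in \<open>auto intro!: filterlim_at_top_mult_tendsto_pos[where c="1 / sqrt E", simplified] simp: divide_inverse filterlim_ident\<close>)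
    then show "(?F \<longlongrightarrow> 2 * sqrt E * (pi / 2)) at_top" by (intro tendsto_intros)
  qed
  then have nn: "(\<integral>\<^sup>+ r. ennreal (?f r) * indicator {0..} r \<partial>lborel) = ennreal (pi * sqrt E)" by (simp add: mult.commute)
  have "(\<integral>\<^sup>+ r. ennreal (indicator {0<..} r *\<^sub>R ?f r) \<partial>lborel) = (\<integral>\<^sup>+ r. ennreal (?f r) * indicator {0..} r \<partial>lborel)"
  proof (rule nn_integral_cong_AE)
    have "AE r in lborel. r \<noteq> (0::real)" by (rule AE_lborel_singleton)
    then show "AE r in lborel. ennreal (indicator {0<..} r *\<^sub>R ?f r) = ennreal (?f r) * indicator {0..} r"
      by eventually_elim (auto simp: indicator_def)
  qed
  then have "has_bochner_integral lborel (\<lambda>r. indicator {0<..} r *\<^sub>R ?f r) (pi * sqrt E)"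
    unfolding nn using pos E by (intro has_bochner_integral_nn_integral) (auto simp: indicator_def less_imp_le)
  then show "set_integrable lborel {0<..} ?f" "(LINT r:{0<..}|lborel. ?f r) = pi * sqrt E"
    unfolding set_integrable_def set_lebesgue_integral_def by (auto simp: has_bochner_integral_iff)
qed

text \<open>
  This is where the factor of order \<open>(q + 1) powr (q / 2)\<close> in the theorem arises.
\<close>

lemma powr_times_gaussian_le:
  fixes q \<sigma> r :: real
  assumes q: "0 \<le> q" and s: "0 < \<sigma>" and r: "0 < r"
  shows "r powr q * exp (- (\<sigma>\<^sup>2 * r\<^sup>2 / 4)) \<le> (4 * (q + 1) / \<sigma>\<^sup>2) powr (q / 2)"
proof -
  define y where "y = \<sigma>\<^sup>2 * r\<^sup>2 / 4 / (q + 1)"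
  have y: "0 < y" using q s r by (simp add: y_def)
  have r2: "r\<^sup>2 = (4 * (q + 1) / \<sigma>\<^sup>2) * y" using q s by (simp add: y_def)
  have "r powr q = (r\<^sup>2) powr (q / 2)" using r by (simp add: powr_powr flip: powr_numeral)
  also have "\<dots> = (4 * (q + 1) / \<sigma>\<^sup>2) powr (q / 2) * y powr (q / 2)"
    unfolding r2 by (rule powr_mult)
  finally have e: "r powr q = (4 * (q + 1) / \<sigma>\<^sup>2) powr (q / 2) * y powr (q / 2)" .
  have "y powr (q / 2) \<le> exp (\<sigma>\<^sup>2 * r\<^sup>2 / 4)"
  proof -
    have "y \<le> exp y" using exp_ge_add_one_self[of y] by linarith
    then have "y powr (q / 2) \<le> exp y powr (q / 2)" using y q by (intro powr_mono2) auto
    also have "\<dots> = exp (y * (q / 2))" by (simp add: powr_def mult.commute)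
    also have "\<dots> \<le> exp (\<sigma>\<^sup>2 * r\<^sup>2 / 4)"
    proof -
      have "y * (q / 2) \<le> y * (q + 1)" using y q by (intro mult_left_mono) auto
      also have "y * (q + 1) = \<sigma>\<^sup>2 * r\<^sup>2 / 4"
      proof -
        have "q + 1 \<noteq> 0" using q by simp
        from nonzero_eq_divide_eq[OF this] y_def show ?thesis by blast
      qed
      finally show ?thesis by simp
    qed
    finally show ?thesis .
  qed
  then have "y powr (q / 2) * exp (- (\<sigma>\<^sup>2 * r\<^sup>2 / 4)) \<le> exp (\<sigma>\<^sup>2 * r\<^sup>2 / 4) * exp (- (\<sigma>\<^sup>2 * r\<^sup>2 / 4))"
    by (rule mult_right_mono) simp
  then have "y powr (q / 2) * exp (- (\<sigma>\<^sup>2 * r\<^sup>2 / 4)) \<le> 1" by (simp flip: exp_add)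
  then have "(4 * (q + 1) / \<sigma>\<^sup>2) powr (q / 2) * (y powr (q / 2) * exp (- (\<sigma>\<^sup>2 * r\<^sup>2 / 4))) \<le> (4 * (q + 1) / \<sigma>\<^sup>2) powr (q / 2) * 1"
    by (rule mult_left_mono) simp
  then show ?thesis unfolding e by (simp add: mult.assoc)
qed

text \<open>
  One half of the Gaussian weight absorbs \<open>r powr q\<close>. The other half supplies for \<open>r > sqrt n\<close> the
  quadratic decay that \<open>\<psi>\<close> has for smaller \<open>r\<close>. Then a function bounded by \<open>1\<close> and by \<open>E / r\<^sup>2\<close>, with
  \<open>E\<close> of order \<open>1 / n\<close>, has integral of order \<open>sqrt E\<close>; both bounds together give the integrable
  majorant \<open>2 * E / (E + r\<^sup>2)\<close>.
\<close>

lemma gaussian_moment_bound: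
  fixes \<psi> :: "real \<Rightarrow> real"
  assumes q: "0 \<le> q" and s: "0 < \<sigma>" and n: "1 \<le> n" and C: "0 < C"
    and cont: "continuous_on {0<..} \<psi>" and \<psi>1: "\<And>r. 0 < r \<Longrightarrow> \<bar>\<psi> r\<bar> \<le> 1"
    and \<psi>2: "\<And>r. 0 < r \<Longrightarrow> r \<le> sqrt (real n) \<Longrightarrow> \<bar>\<psi> r\<bar> \<le> C / (real n * r\<^sup>2)"
  shows "(LINT r:{0<..}|lborel. r powr q * (exp (- (\<sigma>\<^sup>2 * r\<^sup>2 / 2)) * \<psi> r))
    \<le> (4 * (q + 1) / \<sigma>\<^sup>2) powr (q / 2) * (pi * sqrt ((C + 32 / \<sigma> ^ 4) / real n))"
proof -
  define E where "E = (C + 32 / \<sigma> ^ 4) / real n"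
  define S where "S = (4 * (q + 1) / \<sigma>\<^sup>2) powr (q / 2)"
  have E: "0 < E" using C s n by (simp add: E_def add_pos_nonneg)
  have le: "r powr q * (exp (- (\<sigma>\<^sup>2 * r\<^sup>2 / 2)) * \<psi> r) \<le> S * (2 * E / (E + r\<^sup>2))" if r: "0 < r" for r
  proof -
    let ?g = "exp (- (\<sigma>\<^sup>2 * r\<^sup>2 / 4))"
    have r2: "0 < r\<^sup>2" using r by simp
    have g1: "?g * \<bar>\<psi> r\<bar> \<le> 1" using \<psi>1[OF r] by (intro mult_le_one) auto
    have g2: "?g * \<bar>\<psi> r\<bar> \<le> E / r\<^sup>2"
    proof (cases "r \<le> sqrt (real n)")
      case True
      have "?g * \<bar>\<psi> r\<bar> \<le> 1 * (C / (real n * r\<^sup>2))" by (intro mult_mono \<psi>2 r True) auto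
      also have "\<dots> \<le> E / r\<^sup>2"
      proof -
        have "C / real n \<le> E" unfolding E_def using s by (intro divide_right_mono) auto
        then have "C / real n / r\<^sup>2 \<le> E / r\<^sup>2" by (intro divide_right_mono) auto
        then show ?thesis by simp
      qed
      finally show ?thesis .
    next
      case False
      have "(sqrt (real n))\<^sup>2 \<le> r\<^sup>2" using False by (intro power_mono) auto
      then have nr: "real n \<le> r\<^sup>2" by simp
      define x where "x = \<sigma>\<^sup>2 * r\<^sup>2 / 4"
      have x: "0 < x" using s r by (simp add: x_def)
      have "x\<^sup>2 / 2 \<le> exp x" using exp_lower_Taylor_quadratic[of x] x by linarith
      then have "exp (- x) \<le> 1 / (x\<^sup>2 / 2)" unfolding exp_minus inverse_eq_divide using x by (intro divide_left_mono mult_pos_pos) auto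
      also have "\<dots> = 32 / \<sigma> ^ 4 / r\<^sup>2 / r\<^sup>2" using s r by (simp add: x_def power_divide power_mult_distrib power2_eq_square eval_nat_numeral field_simps)
      also have "\<dots> \<le> 32 / \<sigma> ^ 4 / real n / r\<^sup>2"
        using nr n r s by (intro divide_right_mono divide_left_mono mult_pos_pos) auto
      also have "\<dots> \<le> E / r\<^sup>2" unfolding E_def using C by (intro divide_right_mono) auto
      finally have "?g \<le> E / r\<^sup>2" by (simp add: x_def)
      moreover have "?g * \<bar>\<psi> r\<bar> \<le> ?g * 1" using \<psi>1[OF r] by (intro mult_left_mono) auto
      ultimately show ?thesis by linarith
    qed
    have g: "?g * \<bar>\<psi> r\<bar> \<le> 2 * E / (E + r\<^sup>2)"
    proof -
      have "?g * \<bar>\<psi> r\<bar> * r\<^sup>2 \<le> E" using g2 r2 by (simp add: pos_le_divide_eq)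
      moreover have "?g * \<bar>\<psi> r\<bar> * E \<le> 1 * E" using g1 E by (intro mult_right_mono) auto
      ultimately have "?g * \<bar>\<psi> r\<bar> * (E + r\<^sup>2) \<le> 2 * E" unfolding distrib_left by linarith
      moreover have "0 < E + r\<^sup>2" using E r2 by linarith
      ultimately show ?thesis by (simp only: pos_le_divide_eq)
    qed
    have ee: "exp (- (\<sigma>\<^sup>2 * r\<^sup>2 / 2)) = ?g * ?g" unfolding exp_add[symmetric] by simp
    have "r powr q * (exp (- (\<sigma>\<^sup>2 * r\<^sup>2 / 2)) * \<psi> r) \<le> r powr q * (exp (- (\<sigma>\<^sup>2 * r\<^sup>2 / 2)) * \<bar>\<psi> r\<bar>)"
      by (intro mult_left_mono) auto
    also have "\<dots> = (r powr q * ?g) * (?g * \<bar>\<psi> r\<bar>)" unfolding ee by (simp only: mult_ac)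
    also have "\<dots> \<le> S * (2 * E / (E + r\<^sup>2))"
      unfolding S_def by (intro mult_mono powr_times_gaussian_le[OF q s r] g) auto
    finally show ?thesis .
  qed
  have int1: "set_integrable lborel {0<..} (\<lambda>r. r powr q * (exp (- (\<sigma>\<^sup>2 * r\<^sup>2 / 2)) * \<psi> r))"
  proof (rule set_integrable_powr_times_exp_decay)
    show "continuous_on {0<..} (\<lambda>r. exp (- (\<sigma>\<^sup>2 * r\<^sup>2 / 2)) * \<psi> r)" by (intro continuous_intros cont) auto
    fix r :: real assume r: "0 < r"
    have "\<bar>exp (- (\<sigma>\<^sup>2 * r\<^sup>2 / 2)) * \<psi> r\<bar> \<le> exp (- (\<sigma>\<^sup>2 * r\<^sup>2 / 2)) * 1"
      unfolding abs_mult abs_exp_cancel by (intro mult_left_mono \<psi>1 r) auto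
    also have "\<dots> \<le> exp (1 / (2 * \<sigma>\<^sup>2)) * exp (- r)"
      using exp_decay_gaussian_cos[OF s, of r 0] by simp
    finally show "\<bar>exp (- (\<sigma>\<^sup>2 * r\<^sup>2 / 2)) * \<psi> r\<bar> \<le> exp (1 / (2 * \<sigma>\<^sup>2)) * exp (- r)" .
  qed (use q in simp)
  have int2: "set_integrable lborel {0<..} (\<lambda>r. S * (2 * E / (E + r\<^sup>2)))"
    by (rule set_integrable_mult_right) (rule integral_rational_tail[OF E])
  have "(LINT r:{0<..}|lborel. r powr q * (exp (- (\<sigma>\<^sup>2 * r\<^sup>2 / 2)) * \<psi> r)) \<le> (LINT r:{0<..}|lborel. S * (2 * E / (E + r\<^sup>2)))"
    by (rule set_integral_mono[OF int1 int2]) (use le in auto)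
  also have "\<dots> = S * (pi * sqrt E)"
    unfolding set_integral_mult_right integral_rational_tail(2)[OF E] ..
  finally show ?thesis unfolding S_def E_def .
qed

lemma has_frac_deriv_0_add:
  assumes "has_frac_deriv_0 \<phi> q v" "has_frac_deriv_0 \<psi> q w"
  shows "has_frac_deriv_0 (\<lambda>t. \<phi> t + \<psi> t) q (v + w)"
proof -
  let ?k = "\<lambda>z \<phi> t. of_real t powr (-1 - z) * of_real (\<phi> t) :: complex"
  obtain F a where F: "-1 < q" "q < a" "F holomorphic_on {z. -1 < Re z \<and> Re z < a}"
      "\<And>z. -1 < Re z \<Longrightarrow> Re z < 0 \<Longrightarrow> set_integrable lborel {0<..} (?k z \<phi>)"
      "\<And>z. -1 < Re z \<Longrightarrow> Re z < 0 \<Longrightarrow> F z = 1 / Gamma (-z) * (LINT t:{0<..}|lborel. ?k z \<phi> t)"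
      "F (of_real q) = of_real v"
    using assms(1) unfolding has_frac_deriv_0_def by blast
  obtain G b where G: "q < b" "G holomorphic_on {z. -1 < Re z \<and> Re z < b}"
      "\<And>z. -1 < Re z \<Longrightarrow> Re z < 0 \<Longrightarrow> set_integrable lborel {0<..} (?k z \<psi>)"
      "\<And>z. -1 < Re z \<Longrightarrow> Re z < 0 \<Longrightarrow> G z = 1 / Gamma (-z) * (LINT t:{0<..}|lborel. ?k z \<psi> t)"
      "G (of_real q) = of_real w"
    using assms(2) unfolding has_frac_deriv_0_def by blast
  have k: "?k z (\<lambda>t. \<phi> t + \<psi> t) = (\<lambda>t. ?k z \<phi> t + ?k z \<psi> t)" for z
    by (simp add: distrib_left)
  show ?thesis
    unfolding has_frac_deriv_0_def
  proof (intro conjI F(1) exI[of _ "\<lambda>z. F z + G z"] exI[of _ "min a b"] allI impI)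
    show "q < min a b" using F(2) G(1) by simp
    show "(\<lambda>z. F z + G z) holomorphic_on {z. - 1 < Re z \<and> Re z < min a b}"
      by (intro holomorphic_on_add holomorphic_on_subset[OF F(3)] holomorphic_on_subset[OF G(2)]) auto
    fix z assume z: "- 1 < Re z \<and> Re z < 0"
    then have i: "set_integrable lborel {0<..} (?k z \<phi>)" "set_integrable lborel {0<..} (?k z \<psi>)" using F(4) G(3) by blast+
    show "set_integrable lborel {0<..} (?k z (\<lambda>t. \<phi> t + \<psi> t))" unfolding k using i by (rule set_integral_add)
    have "F z = 1 / Gamma (-z) * (LINT t:{0<..}|lborel. ?k z \<phi> t)" "G z = 1 / Gamma (-z) * (LINT t:{0<..}|lborel. ?k z \<psi> t)"
      using z F(5) G(4) by blast+
    then show "F z + G z = 1 / Gamma (- z) * (LINT t:{0<..}|lborel. ?k z (\<lambda>t. \<phi> t + \<psi> t) t)"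
      unfolding k set_integral_add(2)[OF i] by (simp only: distrib_left)
  qed (simp add: F(6) G(5))
qed

lemma has_frac_deriv_0_cmult:
  assumes "has_frac_deriv_0 \<phi> q v"
  shows "has_frac_deriv_0 (\<lambda>t. c * \<phi> t) q (c * v)"
proof -
  let ?k = "\<lambda>z \<phi> t. of_real t powr (-1 - z) * of_real (\<phi> t) :: complex"
  obtain F a where F: "-1 < q" "q < a" "F holomorphic_on {z. -1 < Re z \<and> Re z < a}"
      "\<And>z. -1 < Re z \<Longrightarrow> Re z < 0 \<Longrightarrow> set_integrable lborel {0<..} (?k z \<phi>)"
      "\<And>z. -1 < Re z \<Longrightarrow> Re z < 0 \<Longrightarrow> F z = 1 / Gamma (-z) * (LINT t:{0<..}|lborel. ?k z \<phi> t)"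
      "F (of_real q) = of_real v"
    using assms(1) unfolding has_frac_deriv_0_def by blast
  have k: "?k z (\<lambda>t. c * \<phi> t) = (\<lambda>t. of_real c * ?k z \<phi> t)" for z
    by (simp add: mult_ac)
  show ?thesis
    unfolding has_frac_deriv_0_def
  proof (intro conjI F(1) exI[of _ "\<lambda>z. of_real c * F z"] exI[of _ a] F(2) allI impI)
    show "(\<lambda>z. of_real c * F z) holomorphic_on {z. - 1 < Re z \<and> Re z < a}"
      by (intro holomorphic_intros F(3))
    fix z assume z: "- 1 < Re z \<and> Re z < 0"
    then have i: "set_integrable lborel {0<..} (?k z \<phi>)" using F(4) by blast
    show "set_integrable lborel {0<..} (?k z (\<lambda>t. c * \<phi> t))" unfolding k using i by (rule set_integrable_mult_right)
    have "F z = 1 / Gamma (-z) * (LINT t:{0<..}|lborel. ?k z \<phi> t)"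
      using z F(5) by blast
    then show "of_real c * F z = 1 / Gamma (- z) * (LINT t:{0<..}|lborel. ?k z (\<lambda>t. c * \<phi> t) t)"
      unfolding k set_integral_mult_right by (simp only: mult_ac)
  qed (simp add: F(6))
qed

lemma has_frac_deriv_0_sum_list:
  assumes "xs \<noteq> []" "\<And>x. x \<in> set xs \<Longrightarrow> has_frac_deriv_0 (\<phi> x) q (v x)"
  shows "has_frac_deriv_0 (\<lambda>t. \<Sum>x\<leftarrow>xs. \<phi> x t) q (\<Sum>x\<leftarrow>xs. v x)"
  using assms
proof (induction xs rule: list_nonempty_induct)
  case (cons x xs)
  then show ?case using has_frac_deriv_0_add[of "\<phi> x" q "v x" "\<lambda>t. \<Sum>x\<leftarrow>xs. \<phi> x t"] by simp
qed simp

text \<open>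
  Outside the ball of radius \<open>3 * \<sigma> * sqrt n\<close> the density is at most \<open>k ^ n\<close> times the Gaussian of
  variance \<open>2 * \<sigma>\<^sup>2\<close>, by the exponential Markov inequality, where \<open>k = sqrt 2 * exp (- (9/4)) \<le> 1/2\<close>.
\<close>

lemma gauss_mass_ge_half:
  assumes n: "1 \<le> n" and s: "0 < \<sigma>" and T: "T \<in> sets (Rn_lebesgue n)"
    and ball: "\<And>x. x \<in> Rn n \<Longrightarrow> (\<Sum>i<n. (x i - c i)\<^sup>2) \<le> 9 * \<sigma>\<^sup>2 * real n \<Longrightarrow> x \<in> T"
  shows "1 / 2 \<le> (LINT x:T|Rn_lebesgue n. gauss n \<sigma> c x)"
proof -
  let ?M = "Rn_lebesgue n"
  let ?k = "sqrt 2 * exp (- (9 / 4))"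
  have s': "0 < sqrt 2 * \<sigma>" using s by simp
  have widen: "gauss n \<sigma> c x * exp (((\<Sum>i<n. (x i - c i)\<^sup>2) - 9 * \<sigma>\<^sup>2 * real n) / (4 * \<sigma>\<^sup>2)) = ?k ^ n * gauss n (sqrt 2 * \<sigma>) c x" for x
  proof -
    let ?S = "\<Sum>i<n. (x i - c i)\<^sup>2"
    have "- ?S / (2 * \<sigma>\<^sup>2) + (?S - 9 * \<sigma>\<^sup>2 * real n) / (4 * \<sigma>\<^sup>2) = real n * (- (9/4)) + - ?S / (2 * (sqrt 2 * \<sigma>)\<^sup>2)"
      using s by (simp add: power_mult_distrib field_simps)
    then have "exp (- ?S / (2 * \<sigma>\<^sup>2)) * exp ((?S - 9 * \<sigma>\<^sup>2 * real n) / (4 * \<sigma>\<^sup>2)) = exp (- (9/4)) ^ n * exp (- ?S / (2 * (sqrt 2 * \<sigma>)\<^sup>2))"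
      by (simp only: exp_add[symmetric] exp_of_nat_mult[symmetric])
    moreover have "(1 / sqrt (2 * pi * \<sigma>\<^sup>2)) ^ n = sqrt 2 ^ n * (1 / sqrt (2 * pi * (sqrt 2 * \<sigma>)\<^sup>2)) ^ n"
    proof -
      have "1 / sqrt (2 * pi * \<sigma>\<^sup>2) = sqrt 2 * (1 / sqrt (2 * pi * (sqrt 2 * \<sigma>)\<^sup>2))"
      proof -
        have "2 * pi * (sqrt 2 * \<sigma>)\<^sup>2 = 2 * (2 * pi * \<sigma>\<^sup>2)" by (simp add: power_mult_distrib)
        then have "sqrt (2 * pi * (sqrt 2 * \<sigma>)\<^sup>2) = sqrt 2 * sqrt (2 * pi * \<sigma>\<^sup>2)" by (simp only: real_sqrt_mult)
        then show ?thesis by simp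
      qed
      then show ?thesis by (simp only: power_mult_distrib)
    qed
    ultimately show ?thesis unfolding gauss_eq_exp by (simp only: power_mult_distrib mult_ac)
  qed
  have out: "indicator (Rn n - T) x * gauss n \<sigma> c x \<le> ?k ^ n * gauss n (sqrt 2 * \<sigma>) c x" for x
  proof (cases "x \<in> Rn n - T")
    case True
    then have "9 * \<sigma>\<^sup>2 * real n < (\<Sum>i<n. (x i - c i)\<^sup>2)" using ball[of x] by force
    then have "1 \<le> exp (((\<Sum>i<n. (x i - c i)\<^sup>2) - 9 * \<sigma>\<^sup>2 * real n) / (4 * \<sigma>\<^sup>2))" using s by simp
    then have "gauss n \<sigma> c x * 1 \<le> gauss n \<sigma> c x * exp (((\<Sum>i<n. (x i - c i)\<^sup>2) - 9 * \<sigma>\<^sup>2 * real n) / (4 * \<sigma>\<^sup>2))"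
      by (intro mult_left_mono gauss_nonneg)
    then show ?thesis unfolding widen using True by simp
  qed (simp add: gauss_nonneg)
  have k: "?k ^ n \<le> 1 / 2"
  proof -
    have "(sqrt 2 * 2)\<^sup>2 \<le> (4::real)\<^sup>2" by (simp add: power_mult_distrib)
    then have "sqrt 2 * 2 \<le> (4::real)" by (rule power2_le_imp_le) simp
    also have "(4::real) \<le> exp (9 / 4)" using exp_lower_Taylor_quadratic[of "9/4::real"] by (simp add: power2_eq_square)
    finally have "sqrt 2 / exp (9 / 4) \<le> 1 / 2" by (simp add: divide_le_eq)
    then have k1: "?k \<le> 1 / 2" by (simp only: exp_minus divide_inverse)
    have "?k ^ n \<le> ?k ^ 1" using n k1 by (intro power_decreasing) auto
    then show ?thesis using k1 by simp
  qed
  have Rn: "Rn n \<in> sets ?M" using sets.top[of ?M] by simp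
  have g: "integrable ?M (gauss n \<sigma> c)" by (rule gauss_integral(1)[OF s])
  have i1: "integrable ?M (\<lambda>x. indicator T x * gauss n \<sigma> c x)" "integrable ?M (\<lambda>x. indicator (Rn n - T) x * gauss n \<sigma> c x)"
    using integrable_mult_indicator[OF T g] integrable_mult_indicator[OF sets.Diff[OF Rn T] g] by simp_all
  have "(LINT x|?M. indicator T x * gauss n \<sigma> c x) + (LINT x|?M. indicator (Rn n - T) x * gauss n \<sigma> c x)
      = (LINT x|?M. indicator T x * gauss n \<sigma> c x + indicator (Rn n - T) x * gauss n \<sigma> c x)"
    using i1 by (rule Bochner_Integration.integral_add[symmetric])
  also have "\<dots> = (LINT x|?M. gauss n \<sigma> c x)"
    by (rule Bochner_Integration.integral_cong) (auto simp: indicator_def)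
  finally have sum: "(LINT x|?M. indicator T x * gauss n \<sigma> c x) + (LINT x|?M. indicator (Rn n - T) x * gauss n \<sigma> c x) = 1"
    unfolding gauss_integral(2)[OF s] .
  have "(LINT x|?M. indicator (Rn n - T) x * gauss n \<sigma> c x) \<le> (LINT x|?M. ?k ^ n * gauss n (sqrt 2 * \<sigma>) c x)"
    using i1(2) by (rule integral_mono) (auto intro!: out integrable_mult_right gauss_integral(1)[OF s'])
  also have "\<dots> = ?k ^ n" using gauss_integral(2)[OF s', of n c] by simp
  also have "\<dots> \<le> 1 / 2" by (rule k)
  finally show ?thesis using sum unfolding set_lebesgue_integral_def by simp
qed

lemma integral_sum_list:
  fixes f :: "'a \<Rightarrow> 'b \<Rightarrow> real"
  assumes "\<And>x. x \<in> set xs \<Longrightarrow> integrable M (f x)"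
  shows "integrable M (\<lambda>y. \<Sum>x\<leftarrow>xs. f x y)" "(LINT y|M. (\<Sum>x\<leftarrow>xs. f x y)) = (\<Sum>x\<leftarrow>xs. (LINT y|M. f x y))"
proof -
  have "integrable M (\<lambda>y. \<Sum>x\<leftarrow>xs. f x y) \<and> (LINT y|M. (\<Sum>x\<leftarrow>xs. f x y)) = (\<Sum>x\<leftarrow>xs. (LINT y|M. f x y))"
    using assms by (induction xs) auto
  then show "integrable M (\<lambda>y. \<Sum>x\<leftarrow>xs. f x y)" "(LINT y|M. (\<Sum>x\<leftarrow>xs. f x y)) = (\<Sum>x\<leftarrow>xs. (LINT y|M. f x y))"
    by blast+
qed

lemma continuous_map_sum_list:
  fixes f :: "'a \<Rightarrow> 'b \<Rightarrow> real"
  assumes "\<And>x. x \<in> set xs \<Longrightarrow> continuous_map X euclideanreal (f x)"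
  shows "continuous_map X euclideanreal (\<lambda>y. \<Sum>x\<leftarrow>xs. f x y)"
  using assms by (induction xs) (auto intro!: continuous_map_add)

lemma continuous_map_real_compose:
  fixes f :: "'a \<Rightarrow> real" and h :: "real \<Rightarrow> real"
  assumes "continuous_map X euclideanreal f" "continuous_on UNIV h"
  shows "continuous_map X euclideanreal (\<lambda>x. h (f x))"
proof -
  have "continuous_map X euclideanreal (h \<circ> f)"
    by (rule continuous_map_compose[OF assms(1)]) (simp add: assms(2))
  then show ?thesis by (simp add: o_def)
qed

lemma continuous_map_gauss:
  assumes "0 < \<sigma>"
  shows "continuous_map (Rn_top n) euclideanreal (gauss n \<sigma> c)"
proof -
  have "continuous_on UNIV (normal_density \<mu> \<sigma>)" for \<mu>
    unfolding normal_density_def using assms by (intro continuous_intros) auto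
  then show ?thesis
    unfolding gauss_def[abs_def]
    by (intro continuous_map_prod continuous_map_real_compose[OF continuous_map_Rn_coordinate]) auto
qed

lemma continuous_gaussian_cos_moment:
  fixes q \<sigma> :: real
  assumes q: "0 \<le> q" and s: "0 < \<sigma>"
  shows "continuous_on UNIV (\<lambda>u. LINT r:{0<..}|lborel. r powr q * (exp (- (\<sigma>\<^sup>2 * r\<^sup>2 / 2)) * cos (r * u)))"
proof (rule continuous_at_imp_continuous_on, intro ballI)
  fix u :: real
  let ?f = "\<lambda>u r. indicator {0<..} r *\<^sub>R (r powr q * (exp (- (\<sigma>\<^sup>2 * r\<^sup>2 / 2)) * cos (r * u)))"
  have cont: "continuous_on {0<..} (\<lambda>r. exp (- (\<sigma>\<^sup>2 * r\<^sup>2 / 2)) * cos (r * u))" for u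
    by (intro continuous_intros) auto
  have int: "integrable lborel (?f u)" for u
    using set_integrable_powr_times_exp_decay[OF cont exp_decay_gaussian_cos[OF s], of q u] q
    unfolding set_integrable_def by simp
  show "isCont (\<lambda>u. LINT r:{0<..}|lborel. r powr q * (exp (- (\<sigma>\<^sup>2 * r\<^sup>2 / 2)) * cos (r * u))) u"
    unfolding continuous_at_sequentially o_def set_lebesgue_integral_def
  proof (intro allI impI)
    fix X :: "nat \<Rightarrow> real" assume X: "X \<longlonglongrightarrow> u"
    show "(\<lambda>k. LINT r|lborel. ?f (X k) r) \<longlonglongrightarrow> (LINT r|lborel. ?f u r)"
    proof (rule integral_dominated_convergence[where w="?f 0"])
      show "?f u \<in> borel_measurable lborel" by (rule borel_measurable_integrable[OF int])
      show "?f (X k) \<in> borel_measurable lborel" for k by (rule borel_measurable_integrable[OF int])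
      show "integrable lborel (?f 0)" by (rule int)
      show "AE r in lborel. (\<lambda>k. ?f (X k) r) \<longlonglongrightarrow> ?f u r"
        by (intro AE_I2 tendsto_intros X)
      show "AE r in lborel. norm (?f (X k) r) \<le> ?f 0 r" for k
      proof (intro AE_I2)
        fix r :: real
        have "exp (- (\<sigma>\<^sup>2 * r\<^sup>2 / 2)) * \<bar>cos (r * X k)\<bar> \<le> exp (- (\<sigma>\<^sup>2 * r\<^sup>2 / 2)) * 1"
          by (intro mult_left_mono) auto
        then have "r powr q * (exp (- (\<sigma>\<^sup>2 * r\<^sup>2 / 2)) * \<bar>cos (r * X k)\<bar>) \<le> r powr q * (exp (- (\<sigma>\<^sup>2 * r\<^sup>2 / 2)) * 1)"
          by (intro mult_left_mono) auto
        then show "norm (?f (X k) r) \<le> ?f 0 r"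
          by (auto simp: indicator_def abs_mult)
      qed
    qed
  qed
qed

lemma Rn_sphere_nonempty: "1 \<le> n \<Longrightarrow> Rn_sphere n \<noteq> {}"
proof -
  assume n: "1 \<le> n"
  let ?e = "\<lambda>i\<in>{..<n}. if i = 0 then 1 else (0::real)"
  have "(\<Sum>i<n. (?e i)\<^sup>2) = (\<Sum>i<n. if i = 0 then 1 else 0)" by (intro sum.cong) auto
  also have "\<dots> = 1" using n by simp
  finally have "?e \<in> Rn_sphere n" by (simp add: Rn_sphere_def Rn_def Rn_norm_def L2_set_def)
  then show ?thesis by blast
qed

lemma Rn_continuous_attains_max:
  assumes f: "continuous_map (Rn_top n) euclideanreal f" and n: "1 \<le> n"
  shows "\<exists>\<xi>\<^sub>0\<in>Rn_sphere n. \<forall>\<xi>\<in>Rn_sphere n. f \<xi> \<le> f \<xi>\<^sub>0"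
proof -
  have "compact (f ` Rn_sphere n)" using image_compactin[OF compactin_Rn_sphere f] by simp
  moreover have "f ` Rn_sphere n \<noteq> {}" using Rn_sphere_nonempty[OF n] by simp
  ultimately obtain y where "y \<in> f ` Rn_sphere n" "\<forall>t\<in>f ` Rn_sphere n. t \<le> y"
    using compact_attains_sup by blast
  then show ?thesis by blast
qed

text \<open>
  Symmetrising the mixture makes the density even, and by \<open>normal_sym\<close> its sections become even too.
\<close>

definition gauss_sym :: "nat \<Rightarrow> real \<Rightarrow> (nat \<Rightarrow> real) \<Rightarrow> (nat \<Rightarrow> real) \<Rightarrow> real" where
  "gauss_sym n \<sigma> c x = (gauss n \<sigma> c x + gauss n \<sigma> (Rn_scale n (-1) c) x) / 2"

lemma gauss_sym_even: "gauss_sym n \<sigma> c (Rn_scale n (-1) x) = gauss_sym n \<sigma> c x"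
proof -
  have "gauss n \<sigma> c (Rn_scale n (-1) x) = gauss n \<sigma> (Rn_scale n (-1) c) x"
    "gauss n \<sigma> (Rn_scale n (-1) c) (Rn_scale n (-1) x) = gauss n \<sigma> c x"
    unfolding gauss_def by (auto intro!: prod.cong simp: Rn_scale_def normal_density_minus)
  then show ?thesis by (simp add: gauss_sym_def)
qed

lemma hyperplane_lebesgue_gauss_sym:
  assumes "\<xi> \<in> Rn_sphere n" "1 \<le> n" "0 < \<sigma>"
  shows "integrable (hyperplane_lebesgue n \<xi> t) (gauss_sym n \<sigma> c)"
    "radon n (gauss_sym n \<sigma> c) \<xi> t = normal_sym \<sigma> (Rn_inner n c \<xi>) t"
proof -
  note H = hyperplane_lebesgue_gauss[OF assms]
  show "integrable (hyperplane_lebesgue n \<xi> t) (gauss_sym n \<sigma> c)"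
    unfolding gauss_sym_def[abs_def] using H(1) by (intro integrable_divide_zero Bochner_Integration.integrable_add)
  show "radon n (gauss_sym n \<sigma> c) \<xi> t = normal_sym \<sigma> (Rn_inner n c \<xi>) t"
    using H(1)[of t c] H(1)[of t "Rn_scale n (-1) c"] H(2)[of c t] H(2)[of "Rn_scale n (-1) c" t]
    by (simp add: radon_def gauss_sym_def normal_sym_def Rn_inner_scale_left)
qed

text \<open>
  The average of Gaussians centred at the points of \<open>xs\<close> and their negatives. The function \<open>\<psi>\<close> is
  the characteristic function of the uniform distribution on these centres; the formula for the
  fractional derivative is linear in the density, so it sees the centres only through \<open>\<psi>\<close>.
\<close>

lemma gauss_mixture:
  fixes xs :: "(nat \<Rightarrow> real) list"
  assumes n: "1 \<le> n" and s: "0 < \<sigma>" and q: "0 \<le> q" and xs: "xs \<noteq> []" and D: "D \<in> sets (Rn_lebesgue n)"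
    and mem: "\<forall>c\<in>set xs. \<forall>x\<in>Rn n.
      (\<Sum>i<n. (x i - c i)\<^sup>2) \<le> 9 * \<sigma>\<^sup>2 * real n \<or> (\<Sum>i<n. (x i - Rn_scale n (-1) c i)\<^sup>2) \<le> 9 * \<sigma>\<^sup>2 * real n \<longrightarrow> x \<in> D"
  defines "\<psi> \<equiv> \<lambda>\<xi> r. (\<Sum>c\<leftarrow>xs. cos (r * Rn_inner n c \<xi>)) / real (length xs)"
  shows "\<exists>g G d. 1 / 2 \<le> G \<and>
      continuous_map (Rn_top n) euclideanreal g \<and>
      (\<forall>x\<in>Rn n. g x \<ge> 0) \<and>
      (\<forall>x\<in>Rn n. g (Rn_scale n (-1) x) = g x) \<and>
      (LINT x:D|Rn_lebesgue n. g x) = 1 \<and>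
      (\<forall>\<xi>\<in>Rn_sphere n. \<forall>t. integrable (hyperplane_lebesgue n \<xi> t) g) \<and>
      (\<forall>\<xi>\<in>Rn_sphere n. has_frac_deriv_0 (radon n g \<xi>) q (d \<xi>)) \<and>
      continuous_map (Rn_top n) euclideanreal d \<and>
      (\<forall>\<xi>. d \<xi> = cos (pi * q / 2) * (1 / (pi * G) *
        (LINT r:{0<..}|lborel. r powr q * (exp (- (\<sigma>\<^sup>2 * r\<^sup>2 / 2)) * \<psi> \<xi> r))))"
proof -
  let ?M = "Rn_lebesgue n"
  define m where "m = real (length xs)"
  have m: "0 < m" using xs by (simp add: m_def)
  define g0 where "g0 x = (\<Sum>c\<leftarrow>xs. gauss_sym n \<sigma> c x) / m" for x
  define G where "G = (LINT x:D|?M. g0 x)"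
  define h where "h u = (LINT r:{0<..}|lborel. r powr q * (exp (- (\<sigma>\<^sup>2 * r\<^sup>2 / 2)) * cos (r * u)))" for u
  define d where "d \<xi> = 1 / (m * G) * (\<Sum>c\<leftarrow>xs. cos (pi * q / 2) / pi * h (Rn_inner n c \<xi>))" for \<xi>
  have nn: "0 \<le> gauss_sym n \<sigma> c x" for c x by (simp add: gauss_sym_def gauss_nonneg)
  have iD: "integrable ?M (\<lambda>x. indicator D x *\<^sub>R gauss_sym n \<sigma> c x)" for c
    unfolding gauss_sym_def
    by (intro integrable_mult_indicator D integrable_divide_zero Bochner_Integration.integrable_add gauss_integral(1) s)
  have G: "1 / 2 \<le> G"
  proof -
    have mass: "1 / 2 \<le> (LINT x|?M. indicator D x *\<^sub>R gauss_sym n \<sigma> c x)" if c: "c \<in> set xs" for c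
    proof -
      have i: "integrable ?M (\<lambda>x. indicator D x *\<^sub>R gauss n \<sigma> c x)" for c
        by (intro integrable_mult_indicator D gauss_integral(1) s)
      have half: "1 / 2 \<le> (LINT x:D|?M. gauss n \<sigma> c x)" "1 / 2 \<le> (LINT x:D|?M. gauss n \<sigma> (Rn_scale n (-1) c) x)"
        by (rule gauss_mass_ge_half[OF n s D], use mem c in blast)+
      have avg: "1 / 2 \<le> (a + b) / 2" if "1 / 2 \<le> a" "1 / 2 \<le> b" for a b :: real using that by simp
      have eq: "(LINT x|?M. indicator D x *\<^sub>R gauss_sym n \<sigma> c x)
          = ((LINT x:D|?M. gauss n \<sigma> c x) + (LINT x:D|?M. gauss n \<sigma> (Rn_scale n (-1) c) x)) / 2"
        unfolding set_lebesgue_integral_def Bochner_Integration.integral_add[OF i i, symmetric]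
          integral_divide_zero[symmetric] by (simp add: gauss_sym_def distrib_left)
      show ?thesis unfolding eq by (rule avg[OF half])
    qed
    have "G = (LINT x|?M. (\<Sum>c\<leftarrow>xs. indicator D x *\<^sub>R gauss_sym n \<sigma> c x) / m)"
      unfolding G_def g0_def set_lebesgue_integral_def by (simp add: sum_list_const_mult)
    also have "\<dots> = (\<Sum>c\<leftarrow>xs. (LINT x|?M. indicator D x *\<^sub>R gauss_sym n \<sigma> c x)) / m"
      using integral_sum_list(2)[of xs ?M "\<lambda>c x. indicator D x *\<^sub>R gauss_sym n \<sigma> c x"] iD by simp
    also have "\<dots> \<ge> (\<Sum>c\<leftarrow>xs. 1 / 2) / m"
      using m by (intro divide_right_mono sum_list_mono mass) auto
    finally show ?thesis using m by (simp add: m_def sum_list_triv)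
  qed
  define g where "g x = 1 / (m * G) * (\<Sum>c\<leftarrow>xs. gauss_sym n \<sigma> c x)" for x
  have gg0: "g x = g0 x / G" for x by (simp add: g_def g0_def)
  have radon: "radon n g \<xi> = (\<lambda>t. 1 / (m * G) * (\<Sum>c\<leftarrow>xs. normal_sym \<sigma> (Rn_inner n c \<xi>) t))"
    and gint: "\<And>t. integrable (hyperplane_lebesgue n \<xi> t) g" if \<xi>: "\<xi> \<in> Rn_sphere n" for \<xi>
  proof -
    note H = hyperplane_lebesgue_gauss_sym[OF \<xi> n s]
    show "integrable (hyperplane_lebesgue n \<xi> t) g" for t
      unfolding g_def by (intro integrable_mult_right integral_sum_list H(1))
    show "radon n g \<xi> = (\<lambda>t. 1 / (m * G) * (\<Sum>c\<leftarrow>xs. normal_sym \<sigma> (Rn_inner n c \<xi>) t))"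
    proof
      fix t
      have "radon n g \<xi> t = 1 / (m * G) * (\<Sum>c\<leftarrow>xs. radon n (gauss_sym n \<sigma> c) \<xi> t)"
        unfolding radon_def g_def by (simp only: integral_mult_right_zero integral_sum_list(2)[OF H(1)])
      then show "radon n g \<xi> t = 1 / (m * G) * (\<Sum>c\<leftarrow>xs. normal_sym \<sigma> (Rn_inner n c \<xi>) t)"
        unfolding H(2) .
    qed
  qed
  have d: "has_frac_deriv_0 (radon n g \<xi>) q (d \<xi>)" if \<xi>: "\<xi> \<in> Rn_sphere n" for \<xi>
    unfolding radon[OF \<xi>] d_def h_def
    by (intro has_frac_deriv_0_cmult has_frac_deriv_0_sum_list xs has_frac_deriv_0_normal_sym s) (use q in simp)
  have cont_inner: "continuous_map (Rn_top n) euclideanreal (Rn_inner n c)" for c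
  proof -
    have "Rn_inner n c = (\<lambda>x. Rn_inner n x c)" by (rule ext) (rule Rn_inner_commute)
    then show ?thesis using continuous_map_Rn_inner[of n c] by (simp only:)
  qed
  have d_cont: "continuous_map (Rn_top n) euclideanreal d"
    unfolding d_def[abs_def]
    by (intro continuous_map_real_mult_left continuous_map_sum_list continuous_map_real_compose[OF cont_inner])
      (unfold h_def, rule continuous_gaussian_cos_moment[OF q s])
  have d_eq: "d \<xi> = cos (pi * q / 2) * (1 / (pi * G) *
        (LINT r:{0<..}|lborel. r powr q * (exp (- (\<sigma>\<^sup>2 * r\<^sup>2 / 2)) * \<psi> \<xi> r)))" for \<xi>
  proof -
    let ?f = "\<lambda>c r. indicator {0<..} r *\<^sub>R (r powr q * (exp (- (\<sigma>\<^sup>2 * r\<^sup>2 / 2)) * cos (r * Rn_inner n c \<xi>)))"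
    have int: "integrable lborel (?f c)" for c
    proof -
      have "continuous_on {0<..} (\<lambda>r. exp (- (\<sigma>\<^sup>2 * r\<^sup>2 / 2)) * cos (r * Rn_inner n c \<xi>))"
        by (intro continuous_intros) auto
      from set_integrable_powr_times_exp_decay[OF this exp_decay_gaussian_cos[OF s], of q] show ?thesis
        using q unfolding set_integrable_def by simp
    qed
    have "(LINT r:{0<..}|lborel. r powr q * (exp (- (\<sigma>\<^sup>2 * r\<^sup>2 / 2)) * \<psi> \<xi> r)) = (LINT r|lborel. (\<Sum>c\<leftarrow>xs. ?f c r) / m)"
      unfolding set_lebesgue_integral_def \<psi>_def m_def
      by (simp add: sum_list_const_mult)
    also have "\<dots> = (\<Sum>c\<leftarrow>xs. h (Rn_inner n c \<xi>)) / m"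
      using integral_sum_list(2)[of xs lborel ?f] int by (simp add: h_def set_lebesgue_integral_def)
    finally have I: "(LINT r:{0<..}|lborel. r powr q * (exp (- (\<sigma>\<^sup>2 * r\<^sup>2 / 2)) * \<psi> \<xi> r)) = (\<Sum>c\<leftarrow>xs. h (Rn_inner n c \<xi>)) / m" .
    have "d \<xi> = 1 / (m * G) * (cos (pi * q / 2) / pi * (\<Sum>c\<leftarrow>xs. h (Rn_inner n c \<xi>)))"
      unfolding d_def by (simp only: sum_list_const_mult)
    then show ?thesis unfolding I by simp
  qed
  show ?thesis
  proof (rule exI[of _ g], rule exI[of _ G], rule exI[of _ d], intro conjI ballI allI)
    show "1 / 2 \<le> G" by (rule G)
    show "continuous_map (Rn_top n) euclideanreal g"
      unfolding g_def[abs_def] gauss_sym_def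
      by (intro continuous_map_real_mult_left continuous_map_sum_list continuous_map_real_divide continuous_map_add continuous_map_gauss s) auto
    show "0 \<le> g x" for x unfolding g_def using m G nn by (intro mult_nonneg_nonneg sum_list_nonneg) auto
    show "g (Rn_scale n (-1) x) = g x" for x by (simp add: g_def gauss_sym_even)
    show "(LINT x:D|?M. g x) = 1"
      unfolding gg0 set_integral_divide_zero G_def[symmetric] using G by simp
  qed (use gint d d_cont d_eq in blast)+
qed

section \<open>The main estimate\<close>

theorem theorem4:
  "\<exists>c::real. c > 0 \<and>
    (\<forall>(n::nat) (q::real). n \<ge> 1 \<and> 0 \<le> q \<and> q < real n - 1 \<and> \<not> (\<exists>k::int. odd k \<and> q = of_int k) \<longrightarrow>
      (\<exists>(D :: (nat \<Rightarrow> real) set) (g :: (nat \<Rightarrow> real) \<Rightarrow> real).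
        convex_body n D \<and> infinitely_smooth n D \<and> Rn_symmetric n D \<and>
        measure (Rn_lebesgue n) D = 1 \<and>
        continuous_map (Rn_top n) euclideanreal g \<and>
        (\<forall>x\<in>Rn n. g x \<ge> 0) \<and>
        (\<forall>x\<in>Rn n. g (Rn_scale n (-1) x) = g x) \<and>
        (LINT x:D|Rn_lebesgue n. g x) = 1 \<and>
        (\<forall>\<xi>\<in>Rn_sphere n. \<forall>t. integrable (hyperplane_lebesgue n \<xi> t) g) \<and>
        (\<exists>d :: (nat \<Rightarrow> real) \<Rightarrow> real.
          (\<forall>\<xi>\<in>Rn_sphere n. has_frac_deriv_0 (radon n g \<xi>) q (d \<xi>)) \<and>
          (\<exists>\<xi>\<^sub>0\<in>Rn_sphere n.
            (\<forall>\<xi>\<in>Rn_sphere n. 1 / cos (pi * q / 2) * d \<xi> \<le> 1 / cos (pi * q / 2) * d \<xi>\<^sub>0) \<and>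
            1 / cos (pi * q / 2) * d \<xi>\<^sub>0
              \<le> 1 / sqrt (real n) * (c * (q + 1)) powr ((q + 1) / 2)))))"
proof -
  obtain B :: nat and \<delta> :: real where B: "1 \<le> B" and \<delta>: "0 < \<delta>" "\<delta> \<le> 1" and signs: "\<And>n. 1 \<le> n \<Longrightarrow> \<exists>Y :: nat \<Rightarrow> nat \<Rightarrow> real.
     (\<forall>i<B * n. \<forall>j<n. Y i j \<in> {-1, 1}) \<and>
     (\<forall>\<eta>. 1/2 \<le> L2_set \<eta> {..<n} \<and> L2_set \<eta> {..<n} \<le> 1 \<longrightarrow>
        (\<Sum>i<B * n. cos (\<Sum>j<n. Y i j * \<eta> j)) \<le> (1 - \<delta>) * real (B * n))"
    using exists_sign_matrix by (elim exE conjE) blast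
  define \<kappa> where "\<kappa> = sqrt (1 - \<delta> / 2)"
  have \<kappa>: "0 \<le> \<kappa>" "\<kappa> < 1" using \<delta> by (auto simp: \<kappa>_def)
  obtain A :: nat where A: "\<kappa> ^ A < 1 / 4" using real_arch_pow_inv[of "1/4" \<kappa>] \<kappa> by auto
  have A1: "1 \<le> A" using A by (cases A) auto
  define b where "b = body_const B"
  have b: "1 \<le> b" by (simp add: b_def body_const_ge_1)
  define \<alpha>\<^sub>0 where "\<alpha>\<^sub>0 = 1 / (4 * real A * b)"
  define \<sigma> where "\<sigma> = 1 / (6 * b)"
  have \<alpha>0: "0 < \<alpha>\<^sub>0" and s: "0 < \<sigma>" using b A1 by (auto simp: \<alpha>\<^sub>0_def \<sigma>_def)
  define C where "C = 1 / (4 * \<alpha>\<^sub>0\<^sup>2)"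
  have C: "0 < C" using \<alpha>0 by (simp add: C_def)
  define C' where "C' = C + 32 / \<sigma> ^ 4"
  have C': "0 < C'" using C s by (simp add: C'_def add_pos_nonneg)
  define c where "c = max 1 (max (4 / \<sigma>\<^sup>2) (4 * C'))"
  have c: "1 \<le> c" "4 / \<sigma>\<^sup>2 \<le> c" "4 * C' \<le> c" by (auto simp: c_def)
  show ?thesis
  proof (intro exI[of _ c] conjI allI impI)
    show "0 < c" using c by linarith
    fix n :: nat and q :: real
    assume asm: "n \<ge> 1 \<and> 0 \<le> q \<and> q < real n - 1 \<and> \<not> (\<exists>k::int. odd k \<and> q = of_int k)"
    then have n: "1 \<le> n" and q: "0 \<le> q" by auto
    have cosq: "cos (pi * q / 2) \<noteq> 0"
    proof
      assume "cos (pi * q / 2) = 0"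
      then obtain i where "odd i" "pi * q / 2 = of_int i * (pi / 2)" using cos_zero_iff_int by blast
      then have "odd i" "q = of_int i" by auto
      then show False using asm by blast
    qed
    define N where "N = B * n"
    have N: "0 < N" using n B by (simp add: N_def)
    obtain Y :: "nat \<Rightarrow> nat \<Rightarrow> real" where Y: "\<And>i j. i < B * n \<Longrightarrow> j < n \<Longrightarrow> Y i j \<in> {-1, 1}"
      "\<And>\<eta>. 1/2 \<le> L2_set \<eta> {..<n} \<Longrightarrow> L2_set \<eta> {..<n} \<le> 1 \<Longrightarrow>
        (\<Sum>i<N. cos (\<Sum>j<n. Y i j * \<eta> j)) \<le> (1 - \<delta>) * real N"
      using signs[OF n] unfolding N_def by blast
    obtain D where D: "convex_body n D" "infinitely_smooth n D" "Rn_symmetric n D"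
      "D \<in> sets (Rn_lebesgue n)" "measure (Rn_lebesgue n) D = 1"
      "\<And>x. x \<in> Rn n \<Longrightarrow> (\<And>z. \<bar>Rn_inner n x z\<bar> \<le> 1 / (2 * b) * sqrt (real n) * (max_inner n N Y z + Rn_norm n z)) \<Longrightarrow> x \<in> D"
      using exists_smooth_body[where Y=Y, OF n B Y(1)] unfolding N_def b_def by blast
    define \<alpha> where "\<alpha> = \<alpha>\<^sub>0 * sqrt (real n)"
    have \<alpha>: "0 < \<alpha>" using \<alpha>0 n by (simp add: \<alpha>_def)
    have "\<exists>xs. xs \<noteq> [] \<and>
      (\<forall>x\<in>set xs. x \<in> Rn n \<and> (\<forall>z. \<bar>Rn_inner n x z\<bar> \<le> 2 * real A * \<alpha> * max_inner n N Y z)) \<and>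
      (\<forall>\<xi>\<in>Rn_sphere n. \<forall>r. 0 < r \<and> r \<le> sqrt (real n) \<longrightarrow>
        \<bar>(\<Sum>x\<leftarrow>xs. cos (r * Rn_inner n x \<xi>)) / real (length xs)\<bar> \<le> 1 / (4 * \<alpha>\<^sup>2 * r\<^sup>2))"
    proof (rule exists_points_decay[OF N \<alpha> \<kappa>(1)])
      show "\<kappa> ^ A \<le> 1 / 4" using A by simp
      show "\<bar>sign_char n N Y \<xi> \<rho>\<bar> \<le> \<kappa>" if "L2_set \<xi> {..<n} = 1" "1/4 \<le> \<rho>" "\<rho> \<le> 1/2" for \<xi> \<rho>
        unfolding \<kappa>_def by (rule sign_char_bound[OF N Y(2) that])
    qed
    then obtain xs where xs: "xs \<noteq> []"
      "\<forall>x\<in>set xs. x \<in> Rn n \<and> (\<forall>z. \<bar>Rn_inner n x z\<bar> \<le> 2 * real A * \<alpha> * max_inner n N Y z)"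
      "\<forall>\<xi>\<in>Rn_sphere n. \<forall>r. 0 < r \<and> r \<le> sqrt (real n) \<longrightarrow>
        \<bar>(\<Sum>x\<leftarrow>xs. cos (r * Rn_inner n x \<xi>)) / real (length xs)\<bar> \<le> 1 / (4 * \<alpha>\<^sup>2 * r\<^sup>2)"
      by (elim exE conjE)
    define \<psi> where "\<psi> \<xi> r = (\<Sum>x\<leftarrow>xs. cos (r * Rn_inner n x \<xi>)) / real (length xs)" for \<xi> r
    have near: "x \<in> D"
      if x: "x \<in> Rn n" and y: "\<And>z. \<bar>Rn_inner n y z\<bar> \<le> 2 * real A * \<alpha> * max_inner n N Y z"
        and xy: "(\<Sum>i<n. (x i - y i)\<^sup>2) \<le> 9 * \<sigma>\<^sup>2 * real n" for x y
    proof (rule D(6)[OF x])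
      fix z
      have t: "2 * real A * \<alpha> = 1 / (2 * b) * sqrt (real n)"
        using A1 b by (simp add: \<alpha>_def \<alpha>\<^sub>0_def)
      have "Rn_norm n (\<lambda>i. x i - y i) \<le> sqrt (9 * \<sigma>\<^sup>2 * real n)"
        unfolding Rn_norm_def L2_set_def by (rule real_sqrt_le_mono[OF xy])
      also have "\<dots> = 3 * \<sigma> * sqrt (real n)"
      proof -
        have "9 * \<sigma>\<^sup>2 * real n = (3 * \<sigma>)\<^sup>2 * real n" by (simp add: power_mult_distrib)
        then have "sqrt (9 * \<sigma>\<^sup>2 * real n) = sqrt ((3 * \<sigma>)\<^sup>2) * sqrt (real n)" by (simp only: real_sqrt_mult)
        then show ?thesis using s by (simp only: real_sqrt_abs)
      qed
      also have "\<dots> = 1 / (2 * b) * sqrt (real n)" by (simp add: \<sigma>_def)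
      finally have nd: "Rn_norm n (\<lambda>i. x i - y i) \<le> 1 / (2 * b) * sqrt (real n)" .
      have "Rn_inner n x z = Rn_inner n y z + Rn_inner n (\<lambda>i. x i - y i) z"
        by (simp add: Rn_inner_def sum.distrib[symmetric] algebra_simps)
      then have "\<bar>Rn_inner n x z\<bar> \<le> \<bar>Rn_inner n y z\<bar> + \<bar>Rn_inner n (\<lambda>i. x i - y i) z\<bar>" by simp
      also have "\<dots> \<le> 1 / (2 * b) * sqrt (real n) * max_inner n N Y z + 1 / (2 * b) * sqrt (real n) * Rn_norm n z"
      proof (rule add_mono)
        show "\<bar>Rn_inner n y z\<bar> \<le> 1 / (2 * b) * sqrt (real n) * max_inner n N Y z" using y[of z] unfolding t .
        have "\<bar>Rn_inner n (\<lambda>i. x i - y i) z\<bar> \<le> Rn_norm n (\<lambda>i. x i - y i) * Rn_norm n z" by (rule abs_Rn_inner_le)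
        also have "\<dots> \<le> 1 / (2 * b) * sqrt (real n) * Rn_norm n z" by (rule mult_right_mono[OF nd]) (simp add: Rn_norm_def)
        finally show "\<bar>Rn_inner n (\<lambda>i. x i - y i) z\<bar> \<le> 1 / (2 * b) * sqrt (real n) * Rn_norm n z" .
      qed
      finally show "\<bar>Rn_inner n x z\<bar> \<le> 1 / (2 * b) * sqrt (real n) * (max_inner n N Y z + Rn_norm n z)"
        by (simp only: distrib_left)
    qed
    have mem': "x \<in> D" if y: "y \<in> set xs" and x: "x \<in> Rn n"
      and xy: "(\<Sum>i<n. (x i - y i)\<^sup>2) \<le> 9 * \<sigma>\<^sup>2 * real n \<or> (\<Sum>i<n. (x i - Rn_scale n (-1) y i)\<^sup>2) \<le> 9 * \<sigma>\<^sup>2 * real n" for x y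
    proof -
      have y1: "\<bar>Rn_inner n y z\<bar> \<le> 2 * real A * \<alpha> * max_inner n N Y z" for z using xs(2) y by blast
      then have y2: "\<bar>Rn_inner n (Rn_scale n (-1) y) z\<bar> \<le> 2 * real A * \<alpha> * max_inner n N Y z" for z
        by (simp add: Rn_inner_scale_left)
      from xy show ?thesis using near[OF x y1] near[OF x y2] by blast
    qed
    then have mem: "\<forall>y\<in>set xs. \<forall>x\<in>Rn n. (\<Sum>i<n. (x i - y i)\<^sup>2) \<le> 9 * \<sigma>\<^sup>2 * real n \<or>
        (\<Sum>i<n. (x i - Rn_scale n (-1) y i)\<^sup>2) \<le> 9 * \<sigma>\<^sup>2 * real n \<longrightarrow> x \<in> D" by blast
    obtain g G d where G: "1 / 2 \<le> G" and g: "continuous_map (Rn_top n) euclideanreal g"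
      "\<forall>x\<in>Rn n. g x \<ge> 0" "\<forall>x\<in>Rn n. g (Rn_scale n (-1) x) = g x" "(LINT x:D|Rn_lebesgue n. g x) = 1"
      "\<forall>\<xi>\<in>Rn_sphere n. \<forall>t. integrable (hyperplane_lebesgue n \<xi> t) g"
      and d: "\<forall>\<xi>\<in>Rn_sphere n. has_frac_deriv_0 (radon n g \<xi>) q (d \<xi>)"
      "continuous_map (Rn_top n) euclideanreal d"
      "\<forall>\<xi>. d \<xi> = cos (pi * q / 2) * (1 / (pi * G) *
        (LINT r:{0<..}|lborel. r powr q * (exp (- (\<sigma>\<^sup>2 * r\<^sup>2 / 2)) * \<psi> \<xi> r)))"
      using gauss_mixture[OF n s q xs(1) D(4) mem] unfolding \<psi>_def by (elim exE conjE) 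
    have bound: "1 / cos (pi * q / 2) * d \<xi> \<le> 1 / sqrt (real n) * (c * (q + 1)) powr ((q + 1) / 2)"
      if \<xi>: "\<xi> \<in> Rn_sphere n" for \<xi>
    proof -
      let ?I = "LINT r:{0<..}|lborel. r powr q * (exp (- (\<sigma>\<^sup>2 * r\<^sup>2 / 2)) * \<psi> \<xi> r)"
      let ?S = "(4 * (q + 1) / \<sigma>\<^sup>2) powr (q / 2)"
      have I: "?I \<le> ?S * (pi * sqrt (C' / real n))"
        unfolding C'_def
      proof (rule gaussian_moment_bound[OF q s n C])
        show "continuous_on {0<..} (\<psi> \<xi>)"
        proof -
          have "continuous_on UNIV (\<lambda>r. \<Sum>x\<leftarrow>xs. cos (r * Rn_inner n x \<xi>))"
            using continuous_map_sum_list[of xs euclideanreal "\<lambda>x r. cos (r * Rn_inner n x \<xi>)"]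
            by (simp add: continuous_on_cos continuous_on_mult_right)
          then have "continuous_on {0<..} (\<lambda>r. \<Sum>x\<leftarrow>xs. cos (r * Rn_inner n x \<xi>))" by (rule continuous_on_subset) simp
          then show ?thesis unfolding \<psi>_def[abs_def] using xs(1) by (intro continuous_intros) simp_all
        qed
        show "\<bar>\<psi> \<xi> r\<bar> \<le> 1" for r
        proof -
          have "\<bar>\<Sum>x\<leftarrow>ys. cos (r * Rn_inner n x \<xi>)\<bar> \<le> real (length ys)" for ys
          proof (induction ys)
            case (Cons y ys)
            have "\<bar>cos (r * Rn_inner n y \<xi>)\<bar> \<le> 1" by simp
            then show ?case using Cons by (simp del: abs_cos_le_one)
          qed simp
          then show ?thesis using xs(1) by (simp add: \<psi>_def)
        qed
        fix r :: real assume r: "0 < r" "r \<le> sqrt (real n)"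
        have "\<bar>\<psi> \<xi> r\<bar> \<le> 1 / (4 * \<alpha>\<^sup>2 * r\<^sup>2)" using xs(3) \<xi> r unfolding \<psi>_def by blast
        also have "\<dots> = C / (real n * r\<^sup>2)" by (simp add: C_def \<alpha>_def power_mult_distrib)
        finally show "\<bar>\<psi> \<xi> r\<bar> \<le> C / (real n * r\<^sup>2)" .
      qed
      have "1 / cos (pi * q / 2) * d \<xi> = 1 / (pi * G) * ?I" using cosq d(3) by simp
      also have "\<dots> \<le> 1 / (pi * G) * (?S * (pi * sqrt (C' / real n)))"
        using I G by (intro mult_left_mono) auto
      also have "\<dots> = 1 / G * (?S * sqrt (C' / real n))" by simp
      also have "\<dots> \<le> 2 * (?S * sqrt (C' / real n))"
      proof (rule mult_right_mono)
        show "1 / G \<le> 2" using G by (simp add: pos_divide_le_eq)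
      qed (use C' in simp)
      also have "\<dots> = 1 / sqrt (real n) * (sqrt (4 * C') * ?S)" by (simp add: real_sqrt_divide real_sqrt_mult)
      also have "\<dots> \<le> 1 / sqrt (real n) * (c * (q + 1)) powr ((q + 1) / 2)"
      proof (rule mult_left_mono)
        have p1: "sqrt (4 * C') \<le> (c * (q + 1)) powr (1 / 2)"
        proof -
          have "4 * C' \<le> c * 1" using c by simp
          also have "\<dots> \<le> c * (q + 1)" using c q by (intro mult_left_mono) auto
          finally show ?thesis using C' by (simp add: powr_half_sqrt)
        qed
        have p2: "?S \<le> (c * (q + 1)) powr (q / 2)"
        proof (rule powr_mono2)
          have "(4 / \<sigma>\<^sup>2) * (q + 1) \<le> c * (q + 1)" using c q by (intro mult_right_mono) auto
          then show "4 * (q + 1) / \<sigma>\<^sup>2 \<le> c * (q + 1)" by simp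
        qed (use q in auto)
        have "sqrt (4 * C') * ?S \<le> (c * (q + 1)) powr (1 / 2) * (c * (q + 1)) powr (q / 2)"
          using C' by (intro mult_mono p1 p2) auto
        also have "\<dots> = (c * (q + 1)) powr ((q + 1) / 2)" by (simp add: powr_add[symmetric] add_divide_distrib add.commute)
        finally show "sqrt (4 * C') * ?S \<le> (c * (q + 1)) powr ((q + 1) / 2)" .
      qed simp
      finally show ?thesis .
    qed
    have "continuous_map (Rn_top n) euclideanreal (\<lambda>\<xi>. 1 / cos (pi * q / 2) * d \<xi>)"
      by (intro continuous_map_real_mult_left d(2))
    from Rn_continuous_attains_max[OF this n] obtain \<xi>\<^sub>0 where \<xi>0: "\<xi>\<^sub>0 \<in> Rn_sphere n"
      "\<forall>\<xi>\<in>Rn_sphere n. 1 / cos (pi * q / 2) * d \<xi> \<le> 1 / cos (pi * q / 2) * d \<xi>\<^sub>0" by blast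
    show "\<exists>(D :: (nat \<Rightarrow> real) set) (g :: (nat \<Rightarrow> real) \<Rightarrow> real).
        convex_body n D \<and> infinitely_smooth n D \<and> Rn_symmetric n D \<and>
        measure (Rn_lebesgue n) D = 1 \<and>
        continuous_map (Rn_top n) euclideanreal g \<and>
        (\<forall>x\<in>Rn n. g x \<ge> 0) \<and>
        (\<forall>x\<in>Rn n. g (Rn_scale n (-1) x) = g x) \<and>
        (LINT x:D|Rn_lebesgue n. g x) = 1 \<and>
        (\<forall>\<xi>\<in>Rn_sphere n. \<forall>t. integrable (hyperplane_lebesgue n \<xi> t) g) \<and>
        (\<exists>d :: (nat \<Rightarrow> real) \<Rightarrow> real.
          (\<forall>\<xi>\<in>Rn_sphere n. has_frac_deriv_0 (radon n g \<xi>) q (d \<xi>)) \<and>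
          (\<exists>\<xi>\<^sub>0\<in>Rn_sphere n.
            (\<forall>\<xi>\<in>Rn_sphere n. 1 / cos (pi * q / 2) * d \<xi> \<le> 1 / cos (pi * q / 2) * d \<xi>\<^sub>0) \<and>
            1 / cos (pi * q / 2) * d \<xi>\<^sub>0
              \<le> 1 / sqrt (real n) * (c * (q + 1)) powr ((q + 1) / 2)))"
      by (rule exI[of _ D], rule exI[of _ g], intro conjI D(1-3,5) g, rule exI[of _ d],
          intro conjI d(1) bexI[OF _ \<xi>0(1)] \<xi>0(2) bound[OF \<xi>0(1)])
  qed
qed

end
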